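(* Let $k\geq 1$, $\alpha\geq 1$ and $m\geq 1$ be integers with $\gcd(m,2)=1$. Then the set $\{n\in\mathbb{N}: \bar a_{2^\alpha m}(n)\equiv 0 \pmod{2^k}\}$ has arithmetic density $1$, i.e. $$\lim_{X\to\infty}\frac{\#\{0\leq n\leq X: \bar a_{2^\alpha m}(n)\equiv 0\pmod{2^k}\}}{X}=1.$$
   Context: For an integer $k\geq 1$ let $f_k:=\prod_{n\geq 1}(1-q^{kn})$. For an integer $c\geq1$, the generalized overcubic partition function $\bar a_c(n)$ is defined by the generating function $\sum_{n\geq 0}\bar a_c(n)q^n=\dfrac{f_4^{c-1}}{f_1^2f_2^{2c-3}}$. *)

theory Defs
  imports Complex_Main "HOL-Computational_Algebra.Formal_Power_Series"
begin

text \<open>Truncation of f_k = prod_{j>=1} (1 - q^{k j}) to the factors j = 1..N,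
  as an integer formal power series. For coefficient n, truncation at N = n is exact.\<close>
definition f_trunc :: "nat \<Rightarrow> nat \<Rightarrow> int fps" where
  "f_trunc k N = (\<Prod>j\<in>{1..N}. 1 - fps_X ^ (k * j))"

definition geom :: "nat \<Rightarrow> int fps" where
  "geom d = Abs_fps (\<lambda>n. if d dvd n then 1 else 0)"

definition finv_trunc :: "nat \<Rightarrow> nat \<Rightarrow> int fps" where
  "finv_trunc k N = (\<Prod>j\<in>{1..N}. geom (k * j))"

text \<open>Generalized overcubic partition function: coefficient of q^n in
  f_4^{c-1} / (f_1^2 f_2^{2c-3}).  The factor f_2^{-(2c-3)} is 1/f_2^{2c-3} if 2c >= 3,
  and f_2 if c = 1 (c = 0 is not meaningful; then the formula gives f_2^3 f_4^{-1}
  only formally and is not used).\<close>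
definition overcubic :: "nat \<Rightarrow> nat \<Rightarrow> int" where
  "overcubic c n = fps_nth
     (f_trunc 4 n ^ (c - 1) * finv_trunc 1 n ^ 2 *
      (if 2 * c \<ge> 3 then finv_trunc 2 n ^ (2 * c - 3) else f_trunc 2 n ^ (3 - 2 * c))) n"

end

theory Submission
  imports Defs "HOL-Complex_Analysis.Complex_Analysis" "HOL-Number_Theory.Cong" "HOL-Real_Asymp.Real_Asymp"
begin

text \<open>
  With X = \<phi>(-q) = f_1^2/f_2 and Y = \<phi>(-q^2), the generating function is 1/(X Y^(c-1)), and c is even.
  Put E4 = X^8 + 256 q \<psi>(q)^8 and \<Delta> = q \<psi>(q)^8 X^16; by the transformation law of the theta functions and
  Jacobi's identity these are modular forms of level one. Inverting the algebraic relations between X, Y, E4 and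
  \<Delta> by Hensel iteration shows that, modulo every power of 2, the generating function is a polynomial in E4 and
  \<Delta> divided by a power of 2.

  The Hecke operators T_p preserve the lattice spanned by the forms E4^a \<Delta>^b of a fixed weight. Modulo 2 one has
  E4 = 1, and \<Delta>^c has exponents congruent to c modulo 8 times the largest power of 2 dividing c. Hence T_p is
  strictly triangular modulo 2 if p is odd and not 1 modulo 8, so a product of sufficiently many such T_p is
  divisible by a given power of 2. Therefore the coefficients at all n that are exactly divisible by many such
  primes vanish modulo that power of 2, and almost all n are of this kind.
\<close>

section \<open>The transformation law of the theta function\<close>

text \<open>The generating function has negative weight and is not of level one, so Hecke operators
  are not applied to it directly. Level one is the target because there the monomials
  \<open>E4^a * Dl^b\<close> give an integral basis in echelon form, on which triangularity modulo 2
  can be read off from q-expansions. The passage has a cost: a 2-adic square root requires division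
  by 8, so the approximants are integral combinations of the monomials only after multiplication by
  some \<open>2^s\<close>. This is harmless, since s further factors of 2 are won by using more
  primes. Evenness of c enters through the square roots. X is known to be 1 only modulo 2, which is
  too coarse for the iteration, whereas X^2 is 1 modulo 4, and X Y is congruent modulo 4 to 1 + (X^2
  - 1)/2. Thus X Y and Y^2 are reached although X and Y are not, and X Y^(c-1) is X Y times a power
  of Y^2. Exact divisibility by p is demanded because only then is the coefficient of f at n the
  coefficient of T_p f at n/p, without the second Hecke term.\<close>

lemma cos_power2_le_exp:
  fixes x :: real
  assumes "0 \<le> x" "x < pi/2"
  shows "cos x ^ 2 \<le> exp (-(x^2))"
proof -
  have "(\<lambda>x. ln (cos x) + x^2/2) x \<le> (\<lambda>x. ln (cos x) + x^2/2) 0"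
  proof (rule DERIV_nonpos_imp_nonincreasing[OF assms(1)])
    fix y assume y: "0 \<le> y" "y \<le> x"
    have c: "cos y > 0" using y assms by (intro cos_gt_zero_pi) auto
    have "((\<lambda>x. ln (cos x) + x^2/2) has_real_derivative (- sin y / cos y + y)) (at y)"
      using c by (auto intro!: derivative_eq_intros)
    moreover have "y \<le> sin y / cos y"
    proof -
      have "(\<lambda>y. sin y - y * cos y) 0 \<le> (\<lambda>y. sin y - y * cos y) y"
      proof (rule DERIV_nonneg_imp_nondecreasing[OF y(1)])
        fix u assume u: "0 \<le> u" "u \<le> y"
        have "((\<lambda>y. sin y - y * cos y) has_real_derivative (u * sin u)) (at u)"
          by (auto intro!: derivative_eq_intros)
        moreover have "sin u \<ge> 0" using u y assms by (intro sin_ge_zero) auto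
        ultimately show "\<exists>z. ((\<lambda>y. sin y - y * cos y) has_real_derivative z) (at u) \<and> 0 \<le> z"
          using u by auto
      qed
      thus ?thesis using c by (simp add: field_simps)
    qed
    ultimately show "\<exists>z. ((\<lambda>x. ln (cos x) + x^2/2) has_real_derivative z) (at y) \<and> z \<le> 0"
      by (intro exI[of _ "- sin y / cos y + y"]) auto
  qed
  hence *: "2 * ln (cos x) \<le> -(x^2)" by simp
  have c: "cos x > 0" using assms by (intro cos_gt_zero_pi) auto
  have "cos x ^ 2 = exp (2 * ln (cos x))"
    using c by (metis exp_ln exp_double)
  thus ?thesis using * by simp
qed

lemma cos_power2_ge_exp:
  fixes x :: real
  assumes "x^2 < 1"
  shows "exp (- (x^2 / (1 - x^2))) \<le> cos x ^ 2"
proof -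
  have "sin x ^ 2 \<le> x ^ 2"
    using abs_sin_x_le_abs_x[of x] by (simp add: abs_le_square_iff)
  hence "1 - x^2 \<le> cos x ^ 2" by (simp add: cos_squared_eq)
  moreover have "exp (- (x^2 / (1 - x^2))) \<le> 1 - x^2"
  proof -
    have "1 / (1 - x^2) \<le> exp (x^2 / (1 - x^2))"
      using exp_ge_add_one_self[of "x^2 / (1 - x^2)"] assms by (simp add: field_simps)
    thus ?thesis using assms by (simp add: exp_minus field_simps)
  qed
  ultimately show ?thesis by linarith
qed

text \<open>The quotient of the two binomials is the product over i = 1..r of 1 - r/(m+i). Applying
  1 + x \<le> exp x to each factor gives the upper bound, and applying it to the reciprocal factors
  1 + r/(m-r+i) gives the lower one; in the exponents m+i and m-r+i are replaced by the extremes m+r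
  and m-r.\<close>

lemma central_binomial_ratio_bounds:
  fixes m r :: nat
  shows "real ((2*m) choose (m+r)) \<le> exp (- (real r^2 / (m + r))) * real ((2*m) choose m)"
    and "r < m \<Longrightarrow> exp (- (real r^2 / (m - r))) * real ((2*m) choose m) \<le> real ((2*m) choose (m+r))"
proof -
  have ratio: "real ((2*m) choose (m+s)) * (\<Prod>i=1..s. real (m+i)) = real ((2*m) choose m) * (\<Prod>i=1..s. (real m - real s + real i))" if "s \<le> m" for s
    using that
  proof (induction s)
    case (Suc s)
    have "Suc (m+s) * (2*m choose Suc (m+s)) = (2*m - (m+s)) * (2*m choose (m+s))"
      by (metis binomial_absorb_comp binomial_absorption mult.commute)
    hence 1: "real (m + Suc s) * real (2*m choose (m+Suc s)) = (real m - real s) * real (2*m choose (m+s))"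
      using Suc.prems by (metis (no_types, lifting) Suc_leD add_Suc_right add_diff_cancel_left' diff_diff_left mult_2 of_nat_diff of_nat_mult)
    have 2: "(\<Prod>i=1..Suc s. (real m - real (Suc s) + real i)) = (real m - real s) * (\<Prod>i=1..s. (real m - real s + real i))"
    proof -
      have "(\<Prod>i=1..Suc s. (real m - real (Suc s) + real i)) = (\<Prod>i=0..s. (real m - real (Suc s) + real (Suc i)))"
        by (simp only: One_nat_def prod.shift_bounds_cl_Suc_ivl)
      also have "\<dots> = (\<Prod>i=0..s. (real m - real s + real i))" by (intro prod.cong) auto
      also have "\<dots> = (real m - real s) * (\<Prod>i=Suc 0..s. (real m - real s + real i))"
        by (subst prod.atLeast_Suc_atMost) auto
      finally show ?thesis by simp
    qed
    have "real (2*m choose (m + Suc s)) * (\<Prod>i=1..Suc s. real (m+i))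
        = (real (m + Suc s) * real (2*m choose (m+Suc s))) * (\<Prod>i=1..s. real (m+i))"
      by (simp add: mult_ac)
    also have "\<dots> = (real m - real s) * (real (2*m choose (m+s)) * (\<Prod>i=1..s. real (m+i)))"
      unfolding 1 by simp
    also have "\<dots> = (real m - real s) * (real (2*m choose m) * (\<Prod>i=1..s. (real m - real s + real i)))"
      using Suc by simp
    finally show ?case unfolding 2 by simp
  qed auto
  have pos: "(\<Prod>i=1..r. real (m+i)) > 0" by (intro prod_pos) auto
  show "real ((2*m) choose (m+r)) \<le> exp (- (real r^2 / (m + r))) * real ((2*m) choose m)"
  proof (cases "r \<le> m")
    case True
    have "(\<Prod>i=1..r. (real m - real r + real i)) \<le> (\<Prod>i=1..r. exp (- (real r / (m+r))) * real (m+i))"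
    proof (rule prod_mono, safe)
      fix i assume i: "i \<in> {1..r}"
      show "0 \<le> real m - real r + real i" using True by simp
      have "1 - real r / real (m+i) \<le> exp (- (real r / (m+i)))"
        using exp_ge_add_one_self[of "- (real r / real (m+i))"] by simp
      also have "\<dots> \<le> exp (- (real r / (m+r)))"
        using i by (auto intro!: divide_left_mono)
      finally have "(1 - real r / real (m+i)) * real (m+i) \<le> exp (- (real r / (m+r))) * real (m+i)"
        by (intro mult_right_mono) auto
      moreover have "(1 - real r / real (m+i)) * real (m+i) = real m - real r + real i"
      proof -
        have "(1 - a / b) * b = b - a" if "b > 0" for a b :: real using that by (simp add: field_simps)
        from this[of "real (m+i)" "real r"] i show ?thesis by simp
      qed
      ultimately show "real m - real r + real i \<le> exp (- (real r / (m+r))) * real (m+i)" by simp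
    qed
    also have "\<dots> = exp (- (real r^2 / (m + r))) * (\<Prod>i=1..r. real (m+i))"
      by (simp add: prod.distrib exp_of_nat_mult[symmetric] power2_eq_square)
    finally have "real ((2*m) choose (m+r)) * (\<Prod>i=1..r. real (m+i)) \<le> real ((2*m) choose m) * (exp (- (real r^2 / (m + r))) * (\<Prod>i=1..r. real (m+i)))"
      unfolding ratio[OF True] by (intro mult_left_mono) auto
    hence "real ((2*m) choose (m+r)) * (\<Prod>i=1..r. real (m+i)) \<le> (exp (- (real r^2 / (m + r))) * real ((2*m) choose m)) * (\<Prod>i=1..r. real (m+i))"
      by (simp only: mult_ac)
    thus ?thesis using pos by (rule mult_right_le_imp_le)
  qed (simp add: binomial_eq_0)
  assume rm: "r < m"
  have "(\<Prod>i=1..r. exp (- (real r / (m-r))) * real (m+i)) \<le> (\<Prod>i=1..r. (real m - real r + real i))"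
  proof (rule prod_mono, safe)
    fix i assume i: "i \<in> {1..r}"
    show "0 \<le> exp (- (real r / real (m-r))) * real (m+i)" by simp
    have "real (m+i) / (real m - real r + real i) = 1 + real r / (real m - real r + real i)"
      using rm i by (simp add: field_simps)
    also have "\<dots> \<le> exp (real r / (real m - real r + real i))" by simp
    also have "\<dots> \<le> exp (real r / real (m-r))"
      using rm i by (auto intro!: divide_left_mono simp: of_nat_diff)
    finally show "exp (- (real r / real (m-r))) * real (m+i) \<le> (real m - real r + real i)"
      using rm i by (simp add: exp_minus field_simps)
  qed
  also have "(\<Prod>i=1..r. exp (- (real r / (m-r))) * real (m+i)) = exp (- (real r^2 / (m - r))) * (\<Prod>i=1..r. real (m+i))"
    by (simp add: prod.distrib exp_of_nat_mult[symmetric] power2_eq_square)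
  finally have "real ((2*m) choose m) * (exp (- (real r^2 / (m - r))) * (\<Prod>i=1..r. real (m+i))) \<le> real ((2*m) choose (m+r)) * (\<Prod>i=1..r. real (m+i))"
    unfolding ratio[OF less_imp_le[OF rm]] by (intro mult_left_mono) auto
  hence "(exp (- (real r^2 / (m - r))) * real ((2*m) choose m)) * (\<Prod>i=1..r. real (m+i)) \<le> real ((2*m) choose (m+r)) * (\<Prod>i=1..r. real (m+i))"
    by (simp only: mult_ac)
  thus "exp (- (real r^2 / (m - r))) * real ((2*m) choose m) \<le> real ((2*m) choose (m+r))"
    using pos by (rule mult_right_le_imp_le)
qed

text \<open>The square of the normalized central binomial coefficient, times 2m+1, is exactly the
  reciprocal of a partial Wallis product and tends to 2/pi. The factor m/(2m+1) contributes the
  remaining 1/2.\<close>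

lemma central_binomial_asymp:
  "(\<lambda>m. sqrt (real m) * real ((2*m) choose m) / 4^m) \<longlonglongrightarrow> 1 / sqrt pi"
proof -
  have eq: "(real ((2*m) choose m) / 4^m)^2 * (2 * real m + 1) = inverse (\<Prod>k=1..m. (4*real k^2) / (4*real k^2 - 1))" for m
  proof (induction m)
    case (Suc m)
    have "real (Suc m) * (2 * Suc m choose Suc m) = 2 * (2 * real m + 1) * (2*m choose m)"
    proof -
      have 1: "Suc m * (2 * Suc m choose Suc m) = (2 * Suc m) * (Suc (2*m) choose m)"
        using Suc_times_binomial[of m "Suc (2*m)"] by simp
      have "Suc m * (Suc (2*m) choose m) = Suc (2*m) * (2*m choose m)"
        using binomial_absorb_comp[of "Suc (2*m)" m] by simp
      hence "Suc m * (Suc m * (2 * Suc m choose Suc m)) = Suc m * (2 * (2 * m + 1) * (2*m choose m))"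
        unfolding 1 by (metis (no_types, opaque_lifting) Suc_eq_plus1 mult.assoc mult.left_commute)
      hence "Suc m * (2 * Suc m choose Suc m) = 2 * (2 * m + 1) * (2*m choose m)"
        by (subst (asm) mult_cancel1) simp
      hence "real (Suc m * (2 * Suc m choose Suc m)) = real (2 * (2 * m + 1) * (2*m choose m))" by (rule arg_cong)
      thus ?thesis by (simp only: of_nat_mult of_nat_add of_nat_1 of_nat_numeral)
    qed
    hence *: "real (2 * Suc m choose Suc m) = 2 * (2 * real m + 1) * (2*m choose m) / real (Suc m)"
      by (simp add: field_simps)
    have "(real ((2*Suc m) choose Suc m) / 4^Suc m)^2 * (2 * real (Suc m) + 1)
       = (real ((2*m) choose m) / 4^m)^2 * (2 * real m + 1) * ((4*real (Suc m)^2 - 1) / (4*real (Suc m)^2))"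
    proof -
      have "(2 * (2 * n - 1) * B / n / (4 * P))^2 * (2 * n + 1) = (B / P)^2 * (2 * n - 1) * ((4*n^2 - 1) / (4*n^2))"
        if "n > 0" "P > 0" for n B P :: real
        using that by (simp add: field_simps power2_eq_square)
      from this[of "real (Suc m)" "4^m" "real ((2*m) choose m)"] show ?thesis unfolding * by (simp add: add.commute)
    qed
    also have "\<dots> = inverse (\<Prod>k=1..m. (4*real k^2) / (4*real k^2 - 1)) * ((4*real (Suc m)^2 - 1) / (4*real (Suc m)^2))"
      by (simp only: Suc.IH)
    also have "\<dots> = inverse (\<Prod>k=1..Suc m. (4*real k^2) / (4*real k^2 - 1))"
    proof -
      have "(\<Prod>k=1..Suc m. (4*real k^2) / (4*real k^2 - 1)) = (\<Prod>k=1..m. (4*real k^2) / (4*real k^2 - 1)) * ((4*real (Suc m)^2) / (4*real (Suc m)^2 - 1))"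
        by simp
      thus ?thesis by (simp only: inverse_mult_distrib inverse_divide)
    qed
    finally show ?case .
  qed auto
  have "(\<lambda>m. inverse (\<Prod>k=1..m. (4*real k^2) / (4*real k^2 - 1))) \<longlonglongrightarrow> inverse (pi/2)"
    by (intro tendsto_inverse wallis) auto
  hence "(\<lambda>m. (real ((2*m) choose m) / 4^m)^2 * (2 * real m + 1) * (real m / (2 * real m + 1))) \<longlonglongrightarrow> inverse (pi/2) * (1/2)"
    unfolding eq[symmetric] by (intro tendsto_mult) (assumption, real_asymp)
  hence "(\<lambda>m. sqrt ((real ((2*m) choose m) / 4^m)^2 * (2 * real m + 1) * (real m / (2 * real m + 1)))) \<longlonglongrightarrow> sqrt (inverse (pi/2) * (1/2))"
    by (rule tendsto_real_sqrt)
  moreover have "sqrt ((real ((2*m) choose m) / 4^m)^2 * (2 * real m + 1) * (real m / (2 * real m + 1))) = sqrt (real m) * real ((2*m) choose m) / 4^m" for m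
  proof -
    have "(real ((2*m) choose m) / 4^m)^2 * (2 * real m + 1) * (real m / (2 * real m + 1)) = (real ((2*m) choose m) / 4^m)^2 * real m"
    proof -
      have "A * (2 * real m + 1) * (real m / (2 * real m + 1)) = A * real m" for A :: real
        by (simp add: field_simps)
      thus ?thesis .
    qed
    also have "sqrt \<dots> = real ((2*m) choose m) / 4^m * sqrt (real m)"
      by (simp only: real_sqrt_mult real_sqrt_abs) simp
    finally show ?thesis by simp
  qed
  moreover have "sqrt (inverse (pi/2) * (1/2)) = 1 / sqrt pi"
  proof -
    have "inverse (pi/2) * (1/2) = 1 / pi" by (simp add: field_simps)
    thus ?thesis by (simp only: real_sqrt_divide real_sqrt_one)
  qed
  ultimately show ?thesis by (simp only:)
qed

lemma sum_roots_unity_power: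
  fixes l :: nat and d :: int
  assumes "l > 0"
  shows "(\<Sum>k<l. cis (2 * pi * of_int d * real k / real l)) = (if int l dvd d then of_nat l else 0)"
proof -
  define w where "w = cis (2 * pi * of_int d / real l)"
  have wk: "cis (2 * pi * of_int d * real k / real l) = w ^ k" for k
    unfolding w_def by (simp add: Complex.DeMoivre mult_ac)
  show ?thesis
  proof (cases "int l dvd d")
    case True
    then obtain e where e: "d = int l * e" by auto
    have "2 * pi * of_int d / real l = 2 * pi * of_int e" using assms unfolding e by simp
    hence "w = cis (2 * pi * of_int e)" unfolding w_def by (rule arg_cong)
    also have "\<dots> = 1" by (rule cis_multiple_2pi) simp
    finally have "w = 1" .
    thus ?thesis using True by (simp add: wk)
  next
    case False
    have "w \<noteq> 1"
    proof
      assume "w = 1"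
      hence "cos (2 * pi * of_int d / real l) = 1" unfolding w_def by (simp add: complex_eq_iff)
      then obtain n :: int where n: "2 * pi * of_int d / real l = of_int n * 2 * pi"
        by (auto simp: cos_one_2pi_int)
      hence "real_of_int d = of_int n * real l" using assms by (simp add: field_simps)
      hence "d = n * int l" by (metis of_int_eq_iff of_int_mult of_int_of_nat_eq)
      thus False using False by simp
    qed
    moreover have "w ^ l = 1"
    proof -
      have "w ^ l = cis (2 * pi * of_int d)" using assms wk[of l] by simp
      also have "\<dots> = 1" by (rule cis_multiple_2pi) simp
      finally show ?thesis .
    qed
    ultimately show ?thesis using False by (simp add: wk geometric_sum)
  qed
qed

text \<open>After expanding 2 cos x = exp(ix) + exp(-ix), the sum over k retains only the indices r
  congruent to m modulo l. These are m itself and the pairs m + l*j, m - l*j, which carry equal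
  binomial coefficients.\<close>

lemma sum_cos_power:
  fixes l m :: nat
  assumes "l > 0"
  shows "(\<Sum>k<l. (2 * cos (pi * real k / real l)) ^ (2*m))
     = real l * (real (2*m choose m) + 2 * (\<Sum>j=1..m. real (2*m choose (m + l*j))))"
proof -
  have 1: "of_real ((2 * cos x) ^ (2*m)) = (\<Sum>r\<le>2*m. of_nat (2*m choose r) * cis (2 * (real r - real m) * x))" for x
  proof -
    have "of_real ((2 * cos x) ^ (2*m)) = (cis x + cis (-x)) ^ (2*m)"
    proof -
      have "cis x + cis (-x) = of_real (2 * cos x)" by (simp add: complex_eq_iff)
      thus ?thesis by (simp only: of_real_power)
    qed
    also have "\<dots> = (\<Sum>r\<le>2*m. of_nat (2*m choose r) * cis x ^ r * cis (-x) ^ (2*m - r))"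
      by (rule binomial_ring)
    also have "\<dots> = (\<Sum>r\<le>2*m. of_nat (2*m choose r) * cis (2 * (real r - real m) * x))"
    proof (rule sum.cong[OF refl])
      fix r assume "r \<in> {..2*m}"
      hence "cis x ^ r * cis (-x) ^ (2*m - r) = cis (2 * (real r - real m) * x)"
        by (simp add: Complex.DeMoivre cis_mult of_nat_diff algebra_simps)
      thus "of_nat (2*m choose r) * cis x ^ r * cis (-x) ^ (2*m - r) = of_nat (2*m choose r) * cis (2 * (real r - real m) * x)"
        by (simp add: mult.assoc)
    qed
    finally show ?thesis .
  qed
  have "complex_of_real (\<Sum>k<l. (2 * cos (pi * real k / real l)) ^ (2*m))
     = (\<Sum>k<l. \<Sum>r\<le>2*m. of_nat (2*m choose r) * cis (2 * (real r - real m) * (pi * real k / real l)))"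
    by (simp only: of_real_sum 1)
  also have "\<dots> = (\<Sum>r\<le>2*m. \<Sum>k<l. of_nat (2*m choose r) * cis (2 * (real r - real m) * (pi * real k / real l)))"
    by (rule sum.swap)
  also have "\<dots> = (\<Sum>r\<le>2*m. of_nat (2*m choose r) * (\<Sum>k<l. cis (2 * pi * of_int (int r - int m) * real k / real l)))"
    by (simp add: sum_distrib_left mult_ac)
  also have "\<dots> = (\<Sum>r\<le>2*m. of_nat (2*m choose r) * (if int l dvd int r - int m then of_nat l else 0))"
    by (simp only: sum_roots_unity_power[OF assms])
  also have "\<dots> = of_real (real l * (\<Sum>r | r \<le> 2*m \<and> int l dvd int r - int m. real (2*m choose r)))"
    by (simp add: sum_distrib_left mult_ac if_distrib[of "\<lambda>x. x * _"] if_distrib[of "\<lambda>x. _ * x"] sum.inter_filter[symmetric] sum.If_cases Collect_conj_eq atMost_def Int_commute cong: if_cong)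
  finally have 2: "(\<Sum>k<l. (2 * cos (pi * real k / real l)) ^ (2*m)) = real l * (\<Sum>r | r \<le> 2*m \<and> int l dvd int r - int m. real (2*m choose r))"
    by (simp only: of_real_eq_iff)
  \<comment> \<open>Beyond \<open>l * j \<le> m\<close> the natural number \<open>m - l*j\<close>
    would be truncated to 0. There the binomial coefficient at \<open>m + l*j\<close> vanishes, so
    the sum extends to all \<open>j \<le> m\<close> at the end.\<close>
  define J where "J = {j \<in> {1..m}. l * j \<le> m}"
  have split: "{r. r \<le> 2*m \<and> int l dvd int r - int m} = insert m ((\<lambda>j. m + l*j) ` J \<union> (\<lambda>j. m - l*j) ` J)"
  proof (intro equalityI subsetI)
    fix r assume "r \<in> {r. r \<le> 2*m \<and> int l dvd int r - int m}"
    hence r: "r \<le> 2*m" and "int l dvd int r - int m" by auto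
    then obtain e where e: "int r - int m = int l * e" by auto
    show "r \<in> insert m ((\<lambda>j. m + l*j) ` J \<union> (\<lambda>j. m - l*j) ` J)"
    proof (cases "e = 0")
      case False
      define j where "j = nat \<bar>e\<bar>"
      have j: "j \<ge> 1" using False j_def by auto
      have lj: "int (l * j) = \<bar>int r - int m\<bar>" unfolding e j_def by (simp add: abs_mult)
      hence ljm: "l * j \<le> m" using r by linarith
      have "j \<le> l * j" using assms by simp
      hence "j \<le> m" using ljm by (rule order_trans)
      hence "j \<in> J" using j ljm unfolding J_def by auto
      moreover have "r = m + l*j \<or> r = m - l*j" using lj by linarith
      ultimately show ?thesis by auto
    qed (use e in auto)
  next
    fix r assume "r \<in> insert m ((\<lambda>j. m + l*j) ` J \<union> (\<lambda>j. m - l*j) ` J)"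
    moreover have "m + l * j \<le> 2 * m" if "j \<in> J" for j using that unfolding J_def by auto
    ultimately show "r \<in> {r. r \<le> 2*m \<and> int l dvd int r - int m}"
      unfolding J_def by (auto simp: of_nat_diff)
  qed
  have fJ: "finite J" unfolding J_def by auto
  have "(\<Sum>r | r \<le> 2*m \<and> int l dvd int r - int m. real (2*m choose r))
    = real (2*m choose m) + (\<Sum>r\<in>(\<lambda>j. m + l*j) ` J. real (2*m choose r)) + (\<Sum>r\<in>(\<lambda>j. m - l*j) ` J. real (2*m choose r))"
  proof -
    have a: "m \<notin> (\<lambda>j. m + l*j) ` J \<union> (\<lambda>j. m - l*j) ` J"
    proof -
      have "l * j > 0" if "j \<in> J" for j using that assms unfolding J_def by auto
      thus ?thesis unfolding J_def by fastforce
    qed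
    have b: "(\<lambda>j. m + l*j) ` J \<inter> (\<lambda>j. m - l*j) ` J = {}"
    proof -
      have "m + l * i \<noteq> m - l * j" if "i \<in> J" for i j
      proof -
        have "l * i > 0" using that assms unfolding J_def by auto
        thus ?thesis by linarith
      qed
      thus ?thesis by blast
    qed
    show ?thesis unfolding split using fJ a b
      by (subst sum.insert) (auto simp: sum.union_disjoint)
  qed
  also have "(\<Sum>r\<in>(\<lambda>j. m + l*j) ` J. real (2*m choose r)) = (\<Sum>j\<in>J. real (2*m choose (m + l*j)))"
    using assms by (subst sum.reindex) (auto simp: inj_on_def)
  also have "(\<Sum>r\<in>(\<lambda>j. m - l*j) ` J. real (2*m choose r)) = (\<Sum>j\<in>J. real (2*m choose (m - l*j)))"
  proof (subst sum.reindex)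
    show "inj_on (\<lambda>j. m - l*j) J"
    proof (rule inj_onI)
      fix x y assume "x \<in> J" "y \<in> J" "m - l*x = m - l*y"
      hence "l * x = l * y" unfolding J_def by (metis (mono_tags, lifting) diff_diff_cancel mem_Collect_eq)
      thus "x = y" using assms by simp
    qed
  qed auto
  also have "\<dots> = (\<Sum>j\<in>J. real (2*m choose (m + l*j)))"
  proof (rule sum.cong[OF refl])
    fix j assume "j \<in> J"
    hence "l * j \<le> m" unfolding J_def by auto
    hence e: "2*m - (m - l*j) = m + l*j" by linarith
    have "2*m choose (m - l*j) = 2*m choose (2*m - (m - l*j))"
      by (rule binomial_symmetric) simp
    with e have "2*m choose (m - l*j) = 2*m choose (m + l*j)" by simp
    thus "real (2*m choose (m - l*j)) = real (2*m choose (m + l*j))" by simp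
  qed
  also have "(\<Sum>j\<in>J. real (2*m choose (m + l*j))) = (\<Sum>j=1..m. real (2*m choose (m + l*j)))"
    unfolding J_def by (rule sum.mono_neutral_left) (auto simp: binomial_eq_0)
  finally show ?thesis unfolding 2 by simp
qed

lemma summable_exp_neg_quadratic:
  fixes a :: real
  assumes "a > 0"
  shows "summable (\<lambda>n. exp (- (real n ^ 2 * a)))"
proof (rule summable_comparison_test_ev)
  show "summable (\<lambda>n. exp (-a) ^ n)" using assms by (intro summable_geometric) auto
  show "eventually (\<lambda>n. norm (exp (- (real n ^ 2 * a))) \<le> exp (-a) ^ n) at_top"
  proof (rule always_eventually, rule allI)
    fix n
    have "real n \<le> real n ^ 2" by (metis of_nat_le_iff of_nat_power le_square power2_eq_square)
    hence "real n * a \<le> real n ^ 2 * a" using assms by simp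
    thus "norm (exp (- (real n ^ 2 * a))) \<le> exp (-a) ^ n"
      by (simp add: exp_of_nat_mult[symmetric])
  qed
qed

text \<open>Polya's argument: a roots-of-unity filter equates a sum of powers of cosines with a sum of binomial
  coefficients, and both sides tend to sums of Gaussians.\<close>
lemma gaussian_sum_transform:
  fixes u :: real
  assumes u: "u > 0"
  shows "1 + 2 * (\<Sum>k. exp (- (pi^2 * real (Suc k)^2 * u))) = (1 + 2 * (\<Sum>k. exp (- (real (Suc k)^2 / u)))) / sqrt (pi * u)"
proof -
  \<comment> \<open>An odd modulus lets the nonzero k fall into pairs k, l - k with equal even
    powers of the cosine, and keeps the angles with k \<le> L strictly below pi/2. With m of size u
    l^2 the exponents m (pi k / l)^2 converge to pi^2 k^2 u.\<close>
  define l where "l = (\<lambda>L::nat. 2 * L + 1)"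
  define m where "m = (\<lambda>L. nat \<lfloor>u * real (l L)^2\<rfloor>)"
  have lpos: "l L > 0" for L unfolding l_def by simp
  have linf: "filterlim (\<lambda>L. real (l L)) at_top sequentially"
    unfolding l_def by real_asymp
  have mle: "real (m L) \<le> u * real (l L)^2" for L unfolding m_def using u by simp
  have mge: "real (m L) \<ge> u * real (l L)^2 - 1" for L unfolding m_def using u by (simp add: algebra_simps) linarith
  have ml: "(\<lambda>L. real (m L) / real (l L)^2) \<longlonglongrightarrow> u"
  proof (rule tendsto_sandwich)
    show "eventually (\<lambda>L. u - 1 / real (l L)^2 \<le> real (m L) / real (l L)^2) sequentially"
    proof (intro always_eventually allI)
      fix L
      have "(u * real (l L)^2 - 1) / real (l L)^2 \<le> real (m L) / real (l L)^2"
        using mge[of L] by (rule divide_right_mono) simp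
      thus "u - 1 / real (l L)^2 \<le> real (m L) / real (l L)^2" using lpos[of L] by (simp add: diff_divide_distrib)
    qed
    show "eventually (\<lambda>L. real (m L) / real (l L)^2 \<le> u) sequentially"
    proof (intro always_eventually allI)
      fix L
      have "real (m L) / real (l L)^2 \<le> (u * real (l L)^2) / real (l L)^2"
        using mle[of L] by (rule divide_right_mono) simp
      thus "real (m L) / real (l L)^2 \<le> u" using lpos[of L] by simp
    qed
    show "(\<lambda>L. u - 1 / real (l L)^2) \<longlonglongrightarrow> u" unfolding l_def by real_asymp
  qed auto
  have minf: "filterlim (\<lambda>L. real (m L)) at_top sequentially"
    by (rule filterlim_at_top_mono[OF _ always_eventually[OF allI[OF mge]]]) (use u in \<open>unfold l_def, real_asymp\<close>)
  hence minf': "filterlim m at_top sequentially"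
    using filterlim_sequentially_iff_filterlim_real by blast
  define C where "C = (\<lambda>L. real (l L) * real (2 * m L choose m L) / 4 ^ m L)"
  define a where "a = (\<lambda>k L. if Suc k \<le> L then cos (pi * real (Suc k) / real (l L)) ^ (2 * m L) else 0)"
  define b where "b = (\<lambda>j L. real (2 * m L choose (m L + l L * Suc j)) / real (2 * m L choose m L))"
  have key: "1 + 2 * (\<Sum>k. a k L) = C L * (1 + 2 * (\<Sum>j. b j L))" for L
  proof -
    have A: "(\<Sum>k. a k L) = (\<Sum>k<L. a k L)"
      by (rule suminf_finite) (auto simp: a_def)
    have B: "(\<Sum>j. b j L) = (\<Sum>j<m L. b j L)"
    proof (rule suminf_finite)
      fix j assume "j \<notin> {..<m L}"
      hence "m L < 1 * Suc j" by auto
      also have "1 * Suc j \<le> l L * Suc j" using lpos[of L] by (intro mult_right_mono) auto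
      finally show "b j L = 0" unfolding b_def by (simp add: binomial_eq_0)
    qed auto
    have "(\<Sum>k<l L. (2 * cos (pi * real k / real (l L))) ^ (2 * m L)) = 4 ^ m L * (\<Sum>k<l L. cos (pi * real k / real (l L)) ^ (2 * m L))"
      by (simp add: power_mult_distrib sum_distrib_left power_mult)
    also have "(\<Sum>k<l L. cos (pi * real k / real (l L)) ^ (2 * m L)) = 1 + (\<Sum>k<2*L. cos (pi * real (Suc k) / real (l L)) ^ (2 * m L))"
    proof -
      have "l L = Suc (2 * L)" unfolding l_def by simp
      thus ?thesis by (simp only: sum.lessThan_Suc_shift) simp
    qed
    also have "(\<Sum>k<2*L. cos (pi * real (Suc k) / real (l L)) ^ (2 * m L)) = (\<Sum>k<L. a k L) + (\<Sum>k<L. a k L)"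
    proof -
      have "{..<2*L} = {..<L} \<union> {L..<2*L}" by auto
      hence "(\<Sum>k<2*L. cos (pi * real (Suc k) / real (l L)) ^ (2 * m L)) =
         (\<Sum>k<L. cos (pi * real (Suc k) / real (l L)) ^ (2 * m L)) + (\<Sum>k=L..<2*L. cos (pi * real (Suc k) / real (l L)) ^ (2 * m L))"
        by (simp add: sum.union_disjoint ivl_disj_int)
      also have "(\<Sum>k=L..<2*L. cos (pi * real (Suc k) / real (l L)) ^ (2 * m L)) = (\<Sum>k<L. cos (pi * real (Suc k) / real (l L)) ^ (2 * m L))"
      proof (rule sum.reindex_bij_witness[of _ "\<lambda>k. 2*L - 1 - k" "\<lambda>k. 2*L - 1 - k"])
        fix k assume k: "k \<in> {L..<2*L}"
        have "pi * real (Suc (2*L - 1 - k)) / real (l L) = pi - pi * real (Suc k) / real (l L)"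
        proof -
          have "real (Suc (2*L - 1 - k)) = real (l L) - real (Suc k)" using k unfolding l_def by auto
          thus ?thesis using lpos[of L] by (simp only: right_diff_distrib diff_divide_distrib) simp
        qed
        thus "cos (pi * real (Suc (2*L - 1 - k)) / real (l L)) ^ (2 * m L) = cos (pi * real (Suc k) / real (l L)) ^ (2 * m L)"
          by (simp add: power_mult)
      qed auto
      finally show ?thesis by (simp add: a_def)
    qed
    finally have "4 ^ m L * (1 + 2 * (\<Sum>k<L. a k L)) = real (l L) * (real (2 * m L choose m L) + 2 * (\<Sum>j=1..m L. real (2 * m L choose (m L + l L * j))))"
      unfolding sum_cos_power[OF lpos] by simp
    also have "(\<Sum>j=1..m L. real (2 * m L choose (m L + l L * j))) = real (2 * m L choose m L) * (\<Sum>j<m L. b j L)"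
    proof -
      have "(\<Sum>j=1..m L. real (2 * m L choose (m L + l L * j))) = (\<Sum>j<m L. real (2 * m L choose (m L + l L * Suc j)))"
        by (simp add: sum.atLeast1_atMost_eq)
      thus ?thesis by (simp add: b_def sum_distrib_left)
    qed
    finally show ?thesis unfolding A B C_def by (simp add: field_simps)
  qed
  have mulim: "(\<lambda>L. real (m L) * (pi * real k / real (l L))^2) \<longlonglongrightarrow> pi^2 * real k^2 * u" for k
  proof -
    have "(\<lambda>L. pi^2 * real k^2 * (real (m L) / real (l L)^2)) \<longlonglongrightarrow> pi^2 * real k^2 * u"
      by (intro tendsto_intros ml)
    thus ?thesis by (simp add: power_divide power_mult_distrib mult_ac)
  qed
  have xl: "(\<lambda>L. (c / real (l L))^2) \<longlonglongrightarrow> 0" for c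
  proof -
    have "(\<lambda>L. c / real (l L)) \<longlonglongrightarrow> 0"
      by (intro real_tendsto_divide_at_top[OF tendsto_const linf])
    from tendsto_power[OF this, of 2] show ?thesis by simp
  qed
  have a_up: "a k L \<le> exp (- (real (m L) * (pi * real (Suc k) / real (l L))^2))" and a_ge: "a k L \<ge> 0" for k L
  proof -
    show "a k L \<le> exp (- (real (m L) * (pi * real (Suc k) / real (l L))^2))"
    proof (cases "Suc k \<le> L")
      case True
      have "cos (pi * real (Suc k) / real (l L)) ^ 2 \<le> exp (-((pi * real (Suc k) / real (l L))^2))"
      proof (rule cos_power2_le_exp)
        have "real (Suc k) / real (l L) < 1/2" using True unfolding l_def by (simp add: field_simps)
        hence "pi * (real (Suc k) / real (l L)) < pi * (1/2)" by (intro mult_strict_left_mono) auto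
        thus "pi * real (Suc k) / real (l L) < pi / 2" by simp
      qed auto
      hence "(cos (pi * real (Suc k) / real (l L)) ^ 2) ^ m L \<le> exp (-((pi * real (Suc k) / real (l L))^2)) ^ m L"
        by (rule power_mono) simp
      thus ?thesis using True unfolding a_def by (simp only: if_True power_mult exp_of_nat_mult[symmetric] mult_minus_right)
    qed (simp add: a_def)
    show "a k L \<ge> 0" unfolding a_def by (simp add: power_mult)
  qed
  have alim: "(\<lambda>L. a k L) \<longlonglongrightarrow> exp (- (pi^2 * real (Suc k)^2 * u))" for k
  proof (rule tendsto_sandwich[where h = "\<lambda>L. exp (- (real (m L) * (pi * real (Suc k) / real (l L))^2))" and
      f = "\<lambda>L. exp (- (real (m L) * (pi * real (Suc k) / real (l L))^2 / (1 - (pi * real (Suc k) / real (l L))^2)))"])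
    show "eventually (\<lambda>L. a k L \<le> exp (- (real (m L) * (pi * real (Suc k) / real (l L))^2))) sequentially"
      using a_up by (intro always_eventually allI)
    show "(\<lambda>L. exp (- (real (m L) * (pi * real (Suc k) / real (l L))^2))) \<longlonglongrightarrow> exp (- (pi^2 * real (Suc k)^2 * u))"
      by (intro tendsto_intros mulim)
    have "(\<lambda>L. exp (- (real (m L) * (pi * real (Suc k) / real (l L))^2 / (1 - (pi * real (Suc k) / real (l L))^2)))) \<longlonglongrightarrow> exp (- (pi^2 * real (Suc k)^2 * u / (1 - 0)))"
      by (intro tendsto_intros mulim xl) auto
    thus "(\<lambda>L. exp (- (real (m L) * (pi * real (Suc k) / real (l L))^2 / (1 - (pi * real (Suc k) / real (l L))^2)))) \<longlonglongrightarrow> exp (- (pi^2 * real (Suc k)^2 * u))"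
      by simp
    have "eventually (\<lambda>L. (pi * real (Suc k) / real (l L))^2 < 1) sequentially"
      using order_tendstoD(2)[OF xl[of "pi * real (Suc k)"], of 1] by (simp only: zero_less_one)
    thus "eventually (\<lambda>L. exp (- (real (m L) * (pi * real (Suc k) / real (l L))^2 / (1 - (pi * real (Suc k) / real (l L))^2))) \<le> a k L) sequentially"
      using eventually_ge_at_top[of "Suc k"]
    proof eventually_elim
      case (elim L)
      define x where "x = pi * real (Suc k) / real (l L)"
      have x1: "x^2 < 1" using elim(1) unfolding x_def .
      have "exp (- (x^2 / (1 - x^2))) ^ m L \<le> (cos x ^ 2) ^ m L"
        by (rule power_mono[OF cos_power2_ge_exp[OF x1]]) simp
      moreover have "exp (- (x^2 / (1 - x^2))) ^ m L = exp (- (real (m L) * x^2 / (1 - x^2)))"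
        unfolding exp_of_nat_mult[symmetric] by simp
      moreover have "a k L = (cos x ^ 2) ^ m L"
        using elim(2) unfolding a_def x_def by (simp only: if_True power_mult)
      ultimately show ?case unfolding x_def[symmetric] by simp
    qed
  qed
  have b_up: "b j L \<le> exp (- (real (l L * Suc j)^2 / (m L + l L * Suc j)))" for j L
    using central_binomial_ratio_bounds(1)[of "m L" "l L * Suc j"] unfolding b_def
    by (simp add: divide_le_eq del: of_nat_mult of_nat_Suc of_nat_add)
  have b_ge: "b j L \<ge> 0" for j L unfolding b_def by simp
  have lm: "(\<lambda>L. real (l L)^2 / (real (m L) + c * real (l L))) \<longlonglongrightarrow> 1 / u" for c
  proof -
    have "(\<lambda>L. 1 / (real (m L) / real (l L)^2 + c / real (l L))) \<longlonglongrightarrow> 1 / (u + 0)"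
      using u by (intro tendsto_intros ml) (auto intro!: real_tendsto_divide_at_top linf)
    moreover have "1 / (real (m L) / real (l L)^2 + c / real (l L)) = real (l L)^2 / (real (m L) + c * real (l L))" for L
    proof -
      have "1 / (A / l^2 + c / l) = l^2 / (A + c * l)" if "l > 0" for A l :: real
        using that by (cases "A + c * l = 0") (simp_all add: field_simps power2_eq_square)
      from this[of "real (l L)" "real (m L)"] lpos[of L] show ?thesis by simp
    qed
    ultimately show ?thesis by simp
  qed
  have blim: "(\<lambda>L. b j L) \<longlonglongrightarrow> exp (- (real (Suc j)^2 / u))" for j
  proof (rule tendsto_sandwich[where h = "\<lambda>L. exp (- (real (Suc j)^2 * (real (l L)^2 / (real (m L) + real (Suc j) * real (l L)))))" and
      f = "\<lambda>L. exp (- (real (Suc j)^2 * (real (l L)^2 / (real (m L) + (-real (Suc j)) * real (l L)))))"])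
    show "eventually (\<lambda>L. b j L \<le> exp (- (real (Suc j)^2 * (real (l L)^2 / (real (m L) + real (Suc j) * real (l L)))))) sequentially"
    proof (intro always_eventually allI)
      fix L
      have "real (l L * Suc j)^2 / real (m L + l L * Suc j) = real (Suc j)^2 * (real (l L)^2 / (real (m L) + real (Suc j) * real (l L)))"
        by (simp only: of_nat_mult of_nat_add power_mult_distrib mult.commute times_divide_eq_right)
      thus "b j L \<le> exp (- (real (Suc j)^2 * (real (l L)^2 / (real (m L) + real (Suc j) * real (l L)))))"
        using b_up[of j L] by (simp only:)
    qed
    have "(\<lambda>L. exp (- (real (Suc j)^2 * (real (l L)^2 / (real (m L) + c * real (l L)))))) \<longlonglongrightarrow> exp (- (real (Suc j)^2 * (1 / u)))" for c
      by (intro tendsto_intros lm)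
    thus "(\<lambda>L. exp (- (real (Suc j)^2 * (real (l L)^2 / (real (m L) + real (Suc j) * real (l L)))))) \<longlonglongrightarrow> exp (- (real (Suc j)^2 / u))"
      "(\<lambda>L. exp (- (real (Suc j)^2 * (real (l L)^2 / (real (m L) + (-real (Suc j)) * real (l L)))))) \<longlonglongrightarrow> exp (- (real (Suc j)^2 / u))"
      by simp_all
    have "eventually (\<lambda>L. u * real (l L)^2 - 1 - real (Suc j) * real (l L) > 0) sequentially"
      using u unfolding l_def by real_asymp
    thus "eventually (\<lambda>L. exp (- (real (Suc j)^2 * (real (l L)^2 / (real (m L) + (-real (Suc j)) * real (l L))))) \<le> b j L) sequentially"
    proof eventually_elim
      case (elim L)
      hence "real (l L * Suc j) < real (m L)" using mge[of L] by (simp add: algebra_simps)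
      hence less: "l L * Suc j < m L" by linarith
      have "real (2 * m L choose m L) > 0" by simp
      hence "exp (- (real (l L * Suc j)^2 / real (m L - l L * Suc j))) \<le> b j L"
        using central_binomial_ratio_bounds(2)[OF less] unfolding b_def by (simp only: pos_le_divide_eq)
      moreover have "real (l L * Suc j)^2 / real (m L - l L * Suc j) = real (Suc j)^2 * (real (l L)^2 / (real (m L) + (- real (Suc j)) * real (l L)))"
      proof -
        have "real (m L - l L * Suc j) = real (m L) - real (l L) * real (Suc j)"
          by (simp only: of_nat_diff[OF less_imp_le[OF less]] of_nat_mult)
        also have "\<dots> = real (m L) + (- real (Suc j)) * real (l L)" by algebra
        finally have e: "real (m L - l L * Suc j) = real (m L) + (- real (Suc j)) * real (l L)" .
        have "(x * y)^2 / D = y^2 * (x^2 / D)" for x y D :: real by (simp add: power_mult_distrib)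
        thus ?thesis unfolding e of_nat_mult .
      qed
      ultimately show ?case by (simp only:)
    qed
  qed
  \<comment> \<open>Tannery's theorem: eventually m/l^2 exceeds u/2, which gives a summable majorant
    independent of L.\<close>
  have asum: "(\<lambda>L. \<Sum>k. a k L) \<longlonglongrightarrow> (\<Sum>k. exp (- (pi^2 * real (Suc k)^2 * u)))"
  proof -
    have "eventually (\<lambda>L. real (m L) / real (l L)^2 > u / 2) sequentially"
      using u by (intro order_tendstoD(1)[OF ml]) auto
    hence "eventually (\<lambda>(k,L). norm (a k L) \<le> exp (- (real (Suc k)^2 * (pi^2 * u / 2)))) (at_top \<times>\<^sub>F sequentially)"
    proof -
      assume ev: "eventually (\<lambda>L. real (m L) / real (l L)^2 > u / 2) sequentially"
      have "eventually (\<lambda>L. \<forall>k. norm (a k L) \<le> exp (- (real (Suc k)^2 * (pi^2 * u / 2)))) sequentially"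
        using ev
      proof eventually_elim
        case (elim L)
        show ?case
        proof
          fix k
          have "norm (a k L) \<le> exp (- (real (m L) * (pi * real (Suc k) / real (l L))^2))"
            using a_up a_ge by simp
          also have "real (m L) * (pi * real (Suc k) / real (l L))^2 = (real (Suc k)^2 * pi^2) * (real (m L) / real (l L)^2)"
            by (simp add: power_mult_distrib power_divide)
          also have "exp (- ((real (Suc k)^2 * pi^2) * (real (m L) / real (l L)^2))) \<le> exp (- ((real (Suc k)^2 * pi^2) * (u / 2)))"
            using elim by (simp only: exp_le_cancel_iff neg_le_iff_le) (intro mult_left_mono, auto)
          finally show "norm (a k L) \<le> exp (- (real (Suc k)^2 * (pi^2 * u / 2)))" by (simp add: mult_ac)
        qed
      qed
      thus ?thesis unfolding eventually_prod_filter
        by (intro exI[of _ "\<lambda>_. True"] exI[of _ "\<lambda>L. \<forall>k. norm (a k L) \<le> exp (- (real (Suc k)^2 * (pi^2 * u / 2)))"]) auto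
    qed
    moreover have "summable (\<lambda>k. exp (- (real (Suc k)^2 * (pi^2 * u / 2))))"
      using summable_exp_neg_quadratic[of "pi^2 * u / 2"] u by (subst summable_Suc_iff) simp
    ultimately show ?thesis using tannerys_theorem[of a _ sequentially, OF alim] by auto
  qed
  \<comment> \<open>The majorant holds here for every L: either the binomial vanishes, or l*(j+1)
    \<le> m, and then m + l*(j+1) \<le> 2m \<le> 2 u l^2.\<close>
  have bsum: "(\<lambda>L. \<Sum>k. b k L) \<longlonglongrightarrow> (\<Sum>k. exp (- (real (Suc k)^2 / u)))"
  proof -
    have "norm (b j L) \<le> exp (- (real (Suc j)^2 * (1 / (2 * u))))" for j L
    proof (cases "l L * Suc j \<le> m L")
      case False
      thus ?thesis unfolding b_def by (simp add: binomial_eq_0)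
    next
      case True
      have m0: "m L > 0" using True lpos[of L] by (metis Suc_mult_less_cancel1 gr0I le_zero_eq mult_is_0 nat.distinct(1) not_gr0)
      have "norm (b j L) \<le> exp (- (real (l L * Suc j)^2 / (m L + l L * Suc j)))" using b_up b_ge by simp
      also have "\<dots> \<le> exp (- (real (l L * Suc j)^2 / (2 * real (m L))))"
      proof -
        have "real (m L + l L * Suc j) \<le> 2 * real (m L)" using True by linarith
        moreover have "0 < real (m L + l L * Suc j)" using m0 by linarith
        ultimately have "real (l L * Suc j)^2 / (2 * real (m L)) \<le> real (l L * Suc j)^2 / real (m L + l L * Suc j)"
          by (intro frac_le) (simp_all only: zero_le_power2 order_refl)
        thus ?thesis by (simp only: exp_le_cancel_iff neg_le_iff_le)
      qed
      also have "\<dots> \<le> exp (- (real (Suc j)^2 * (1 / (2 * u))))"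
      proof -
        have "1 / (2 * u) \<le> real (l L)^2 / (2 * real (m L))"
        proof -
          have "1 / (2 * u) \<le> B / (2 * M)" if "M \<le> u * B" "M > 0" for M B :: real
            using that u by (simp add: field_simps)
          from this[OF mle[of L]] m0 show ?thesis by simp
        qed
        hence "real (Suc j)^2 * (1 / (2 * u)) \<le> real (Suc j)^2 * (real (l L)^2 / (2 * real (m L)))"
          by (rule mult_left_mono) (rule zero_le_power2)
        moreover have "(x * y)^2 / D = y^2 * (x^2 / D)" for x y D :: real by (simp add: power_mult_distrib)
        ultimately show ?thesis unfolding of_nat_mult by (simp only: exp_le_cancel_iff neg_le_iff_le)
      qed
      finally show ?thesis .
    qed
    hence "eventually (\<lambda>(k,L). norm (b k L) \<le> exp (- (real (Suc k)^2 * (1 / (2 * u))))) (at_top \<times>\<^sub>F sequentially)"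
      by (intro always_eventually) auto
    moreover have "summable (\<lambda>k. exp (- (real (Suc k)^2 * (1 / (2 * u)))))"
      using summable_exp_neg_quadratic[of "1 / (2 * u)"] u by (subst summable_Suc_iff) simp
    ultimately show ?thesis using tannerys_theorem[of b _ sequentially, OF blim] by auto
  qed
  have "C \<longlonglongrightarrow> 1 / sqrt (pi * u)"
  proof -
    have 1: "(\<lambda>L. sqrt (real (m L)) * real ((2*m L) choose m L) / 4^m L) \<longlonglongrightarrow> 1 / sqrt pi"
      using filterlim_compose[OF central_binomial_asymp minf'] .
    have 2: "(\<lambda>L. 1 / sqrt (real (m L) / real (l L)^2)) \<longlonglongrightarrow> 1 / sqrt u"
      using u by (intro tendsto_intros ml) auto
    have "eventually (\<lambda>L. sqrt (real (m L)) * real ((2*m L) choose m L) / 4^m L * (1 / sqrt (real (m L) / real (l L)^2)) = C L) sequentially"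
      using filterlim_at_top_dense[THEN iffD1, OF minf, rule_format, of 0]
      by eventually_elim (simp add: C_def real_sqrt_divide field_simps)
    from Lim_transform_eventually[OF tendsto_mult[OF 1 2] this] show ?thesis
      by (simp add: real_sqrt_mult)
  qed
  hence "(\<lambda>L. C L * (1 + 2 * (\<Sum>j. b j L))) \<longlonglongrightarrow> 1 / sqrt (pi * u) * (1 + 2 * (\<Sum>k. exp (- (real (Suc k)^2 / u))))"
    by (intro tendsto_intros bsum)
  moreover have "(\<lambda>L. 1 + 2 * (\<Sum>k. a k L)) \<longlonglongrightarrow> 1 + 2 * (\<Sum>k. exp (- (pi^2 * real (Suc k)^2 * u)))"
    by (intro tendsto_intros asum)
  ultimately show ?thesis unfolding key using LIMSEQ_unique by fastforce
qed

section \<open>Theta functions\<close>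

definition cfps :: "int fps \<Rightarrow> complex fps" where
  "cfps f = Abs_fps (\<lambda>n. of_int (fps_nth f n))"

lemma cfps_nth [simp]: "fps_nth (cfps f) n = of_int (fps_nth f n)"
  by (simp add: cfps_def)

lemma cfps_0 [simp]: "cfps 0 = 0" and cfps_1 [simp]: "cfps 1 = 1" and cfps_X [simp]: "cfps fps_X = fps_X"
  by (simp_all add: fps_eq_iff fps_one_nth fps_X_nth)

lemma cfps_add [simp]: "cfps (f + g) = cfps f + cfps g" and cfps_diff [simp]: "cfps (f - g) = cfps f - cfps g"
  and cfps_minus [simp]: "cfps (- f) = - cfps f"
  by (simp_all add: fps_eq_iff)

lemma cfps_mult [simp]: "cfps (f * g) = cfps f * cfps g"
  by (simp add: fps_eq_iff fps_mult_nth)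

lemma cfps_power [simp]: "cfps (f ^ n) = cfps f ^ n"
  by (induction n) auto

lemma cfps_of_int [simp]: "cfps (of_int c) = of_int c"
  by (simp add: fps_eq_iff fps_of_int[symmetric])

lemma cfps_numeral [simp]: "cfps (numeral c) = numeral c"
  using cfps_of_int[of "numeral c"] by simp

lemma cfps_eq_iff [simp]: "cfps f = cfps g \<longleftrightarrow> f = g"
  by (simp add: fps_eq_iff)

definition conv1 :: "int fps \<Rightarrow> bool" where
  "conv1 f \<longleftrightarrow> fps_conv_radius (cfps f) \<ge> 1"

definition ev :: "int fps \<Rightarrow> complex \<Rightarrow> complex" where
  "ev f = eval_fps (cfps f)"

lemma conv1_const [simp]: "conv1 0" "conv1 1" "conv1 fps_X" "conv1 (of_int c)" "conv1 (numeral k)"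
proof -
  have "fps_conv_radius (of_int c :: complex fps) = \<infinity>" by (simp add: fps_of_int[symmetric])
  thus "conv1 (of_int c)" by (simp add: conv1_def)
qed (simp_all add: conv1_def)

lemma conv1_mult [intro]: "conv1 f \<Longrightarrow> conv1 g \<Longrightarrow> conv1 (f * g)"
  unfolding conv1_def using fps_conv_radius_mult[of "cfps f" "cfps g"] by (simp add: min_def split: if_splits)

lemma conv1_add [intro]: "conv1 f \<Longrightarrow> conv1 g \<Longrightarrow> conv1 (f + g)"
  unfolding conv1_def using fps_conv_radius_add[of "cfps f" "cfps g"] by (simp add: min_def split: if_splits)

lemma conv1_diff [intro]: "conv1 f \<Longrightarrow> conv1 g \<Longrightarrow> conv1 (f - g)"
  unfolding conv1_def using fps_conv_radius_diff[of "cfps f" "cfps g"] by (simp add: min_def split: if_splits)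

lemma conv1_power [intro]: "conv1 f \<Longrightarrow> conv1 (f ^ n)"
  by (induction n) auto

lemma conv1_sum [intro]: "(\<And>i. i \<in> I \<Longrightarrow> conv1 (f i)) \<Longrightarrow> conv1 (\<Sum>i\<in>I. f i)"
  by (induction I rule: infinite_finite_induct) auto

lemma less_radius: "conv1 f \<Longrightarrow> norm q < 1 \<Longrightarrow> ereal (norm q) < fps_conv_radius (cfps f)"
  unfolding conv1_def by (meson less_le_trans ereal_less(3))

lemma ev_const [simp]: "ev 0 q = 0" "ev 1 q = 1" "ev fps_X q = q" "ev (of_int c) q = of_int c" "ev (numeral k) q = numeral k"
proof -
  have "eval_fps (of_int c :: complex fps) q = of_int c" by (simp add: fps_of_int[symmetric])
  thus "ev (of_int c) q = of_int c" by (simp add: ev_def)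
qed (simp_all add: ev_def)

lemma ev_mult: "conv1 f \<Longrightarrow> conv1 g \<Longrightarrow> norm q < 1 \<Longrightarrow> ev (f * g) q = ev f q * ev g q"
  unfolding ev_def by (simp add: eval_fps_mult less_radius)

lemma ev_add: "conv1 f \<Longrightarrow> conv1 g \<Longrightarrow> norm q < 1 \<Longrightarrow> ev (f + g) q = ev f q + ev g q"
  unfolding ev_def by (simp add: eval_fps_add less_radius)

lemma ev_diff: "conv1 f \<Longrightarrow> conv1 g \<Longrightarrow> norm q < 1 \<Longrightarrow> ev (f - g) q = ev f q - ev g q"
  unfolding ev_def by (simp add: eval_fps_diff less_radius)

lemma ev_power: "conv1 f \<Longrightarrow> norm q < 1 \<Longrightarrow> ev (f ^ n) q = ev f q ^ n"
  unfolding ev_def by (simp add: eval_fps_power less_radius)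

lemma ev_sums: "conv1 f \<Longrightarrow> norm q < 1 \<Longrightarrow> (\<lambda>n. of_int (fps_nth f n) * q ^ n) sums ev f q"
  unfolding ev_def using sums_eval_fps[of q "cfps f"] less_radius[of f q] by simp

lemma ev_holomorphic: "conv1 f \<Longrightarrow> ev f holomorphic_on ball 0 1"
  unfolding ev_def by (rule holomorphic_on_eval_fps) (auto simp: less_radius)

lemma conv1_bounded:
  assumes "\<And>n. \<bar>fps_nth f n\<bar> \<le> B"
  shows "conv1 f"
  unfolding conv1_def fps_conv_radius_def
proof (rule conv_radius_geI_ex')
  fix r :: real assume r: "0 < r" "ereal r < 1"
  show "summable (\<lambda>n. fps_nth (cfps f) n * of_real r ^ n)"
  proof (rule summable_comparison_test)
    show "summable (\<lambda>n. of_int B * r ^ n)" using r by (intro summable_mult summable_geometric) auto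
    have "norm (fps_nth (cfps f) n * of_real r ^ n) \<le> of_int B * r ^ n" for n
    proof -
      have "\<bar>real_of_int (fps_nth f n)\<bar> \<le> of_int B" using assms[of n] by linarith
      thus ?thesis using r by (simp add: norm_mult norm_power mult_right_mono)
    qed
    thus "\<exists>N. \<forall>n\<ge>N. norm (fps_nth (cfps f) n * of_real r ^ n) \<le> of_int B * r ^ n" by auto
  qed
qed

definition dil :: "nat \<Rightarrow> int fps \<Rightarrow> int fps" where
  "dil k f = fps_compose f (fps_X ^ k)"

definition alt :: "int fps \<Rightarrow> int fps" where
  "alt f = Abs_fps (\<lambda>n. (-1) ^ n * fps_nth f n)"

lemma dil_nth: "k > 0 \<Longrightarrow> fps_nth (dil k f) n = (if k dvd n then fps_nth f (n div k) else 0)"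
  unfolding dil_def by (simp add: fps_nth_compose_X_power)

lemma dil_mult: "k > 0 \<Longrightarrow> dil k (f * g) = dil k f * dil k g"
  unfolding dil_def by (rule fps_compose_mult_distrib) simp

lemma dil_power: "k > 0 \<Longrightarrow> dil k (f ^ n) = dil k f ^ n"
  unfolding dil_def by (rule fps_compose_power[symmetric]) simp

lemma alt_nth [simp]: "fps_nth (alt f) n = (-1) ^ n * fps_nth f n"
  by (simp add: alt_def)

lemma dil_sums:
  assumes "conv1 f" "k > 0" "norm q < 1"
  shows "(\<lambda>n. of_int (fps_nth (dil k f) n) * q ^ n) sums ev f (q ^ k)"
proof -
  have "norm (q ^ k) < 1" using assms by (simp add: norm_power power_less_one_iff)
  hence "(\<lambda>n. of_int (fps_nth f n) * (q ^ k) ^ n) sums ev f (q ^ k)"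
    using assms by (intro ev_sums)
  also have "(\<lambda>n. of_int (fps_nth f n) * (q ^ k) ^ n) = (\<lambda>n. (\<lambda>n. of_int (fps_nth (dil k f) n) * q ^ n) (k * n))"
    using assms by (simp add: dil_nth power_mult fun_eq_iff)
  finally show ?thesis
    by (subst (asm) sums_mono_reindex) (use assms in \<open>auto simp: strict_mono_def dil_nth elim!: dvdE\<close>)
qed

lemma conv1_dil [intro]:
  assumes "conv1 f" "k > 0"
  shows "conv1 (dil k f)"
  unfolding conv1_def fps_conv_radius_def
proof (rule conv_radius_geI_ex')
  fix r :: real assume r: "0 < r" "ereal r < 1"
  have "norm (complex_of_real r) < 1" using r by simp
  from dil_sums[OF assms this] show "summable (\<lambda>n. fps_nth (cfps (dil k f)) n * of_real r ^ n)"
    by (auto simp: sums_iff)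
qed

lemma ev_dil: "conv1 f \<Longrightarrow> k > 0 \<Longrightarrow> norm q < 1 \<Longrightarrow> ev (dil k f) q = ev f (q ^ k)"
  using dil_sums[of f k q] ev_sums[OF conv1_dil, of f k q] sums_unique2 by blast

lemma conv1_alt [intro]:
  assumes "conv1 f"
  shows "conv1 (alt f)"
proof -
  have "fps_conv_radius (cfps (alt f)) = fps_conv_radius (cfps f)"
  proof -
    have "Abs_fps (\<lambda>n. norm (fps_nth (cfps (alt f)) n)) = Abs_fps (\<lambda>n. norm (fps_nth (cfps f) n))"
      by (simp add: norm_mult norm_power)
    thus ?thesis using fps_conv_radius_norm[of "cfps (alt f)"] fps_conv_radius_norm[of "cfps f"] by simp
  qed
  thus ?thesis using assms by (simp add: conv1_def)
qed

lemma ev_alt: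
  assumes "conv1 f" "norm q < 1"
  shows "ev (alt f) q = ev f (- q)"
proof -
  have "(\<lambda>n. of_int (fps_nth (alt f) n) * q ^ n) = (\<lambda>n. of_int (fps_nth f n) * (- q) ^ n)"
    by (simp add: fun_eq_iff power_minus' power_minus[of q])
  thus ?thesis using ev_sums[OF conv1_alt[OF assms(1)] assms(2)] ev_sums[OF assms(1), of "-q"] assms(2) sums_unique2 by simp
qed

text \<open>Ramanujan's theta series: \<open>phi\<close> is the sum of q^(n^2) over all integers n,
  so a positive square is hit twice, and \<open>psi\<close> is the sum of q^(n(n+1)/2) over n \<ge>
  0.\<close>

definition phi :: "int fps" where
  "phi = Abs_fps (\<lambda>n. if n = 0 then 1 else if \<exists>k. n = k\<^sup>2 then 2 else 0)"

definition psi :: "int fps" where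
  "psi = Abs_fps (\<lambda>n. if \<exists>k. 2 * n = k * (k + 1) then 1 else 0)"

lemma conv1_phi [simp, intro]: "conv1 phi" by (rule conv1_bounded[of _ 2]) (auto simp: phi_def)
lemma conv1_psi [simp, intro]: "conv1 psi" by (rule conv1_bounded[of _ 1]) (auto simp: psi_def)

lemma phi_sums:
  assumes "norm q < 1"
  shows "(\<lambda>k. q ^ (Suc k)\<^sup>2) sums ((ev phi q - 1) / 2)"
proof -
  have "(\<lambda>n. of_int (fps_nth phi n) * q ^ n) sums ev phi q" using assms by (intro ev_sums) auto
  hence "(\<lambda>n. of_int (fps_nth phi n) * q ^ n - (if n = 0 then 1 else 0)) sums (ev phi q - 1)"
    using sums_diff sums_single[of 0 "\<lambda>_. 1::complex"] by (metis (no_types, lifting) sums_cong)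
  hence "(\<lambda>n. (of_int (fps_nth phi n) * q ^ n - (if n = 0 then 1 else 0)) / 2) sums ((ev phi q - 1) / 2)"
    by (rule sums_divide)
  hence "(\<lambda>n. if \<exists>k. n = (Suc k)\<^sup>2 then q ^ n else 0) sums ((ev phi q - 1) / 2)"
  proof (rule sums_cong[THEN iffD1, rotated])
    fix n
    have "(\<exists>k. n = k\<^sup>2) \<longleftrightarrow> (\<exists>k. n = (Suc k)\<^sup>2)" if "n > 0"
      using that by (metis Suc_pred bot_nat_0.not_eq_extremum power_zero_numeral)
    thus "(of_int (fps_nth phi n) * q ^ n - (if n = 0 then 1 else 0)) / 2 = (if \<exists>k. n = (Suc k)\<^sup>2 then q ^ n else 0)"
      by (cases "n = 0") (auto simp: phi_def)
  qed
  moreover have "strict_mono (\<lambda>k. (Suc k)\<^sup>2)"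
    by (auto simp: strict_mono_def power_strict_mono)
  ultimately show ?thesis
    using sums_mono_reindex[of "\<lambda>k. (Suc k)\<^sup>2" "\<lambda>n. if \<exists>k. n = (Suc k)\<^sup>2 then q ^ n else 0" "(ev phi q - 1) / 2"]
    by (auto simp: image_iff)
qed

text \<open>Even n contribute phi(q^4). An odd n = 2j+1 has n^2 = 1 + 8 * j(j+1)/2, and the factor 2
  accounts for the sign of n. The splitting later expresses \<open>th2\<close> and
  \<open>th4\<close> through values of \<open>th3\<close>.\<close>

lemma phi_split: "phi = dil 4 phi + 2 * fps_X * dil 8 psi"
proof (rule fps_ext)
  fix n
  show "fps_nth phi n = fps_nth (dil 4 phi + 2 * fps_X * dil 8 psi) n"
  proof (cases n)
    case 0
    thus ?thesis by (simp add: dil_nth phi_def)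
  next
    case (Suc m)
    have "fps_nth (2 * fps_X * dil 8 psi) n = 2 * fps_nth (fps_X * dil 8 psi) n"
      by (simp only: mult.assoc fps_mult_numeral_left)
    also have "\<dots> = 2 * (if 8 dvd m then fps_nth psi (m div 8) else 0)" using Suc by (simp add: dil_nth)
    finally have rhs: "fps_nth (dil 4 phi + 2 * fps_X * dil 8 psi) n = (if 4 dvd n then fps_nth phi (n div 4) else 0) + 2 * (if 8 dvd m then fps_nth psi (m div 8) else 0)"
      by (simp add: dil_nth)
    have sq: "(\<exists>k. n = k\<^sup>2) \<longleftrightarrow> (4 dvd n \<and> (\<exists>k. n div 4 = k\<^sup>2)) \<or> (8 dvd m \<and> (\<exists>k. 2 * (m div 8) = k * (k+1)))"
    proof
      assume "\<exists>k. n = k\<^sup>2"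
      then obtain k where k: "n = k\<^sup>2" by auto
      show "(4 dvd n \<and> (\<exists>k. n div 4 = k\<^sup>2)) \<or> (8 dvd m \<and> (\<exists>k. 2 * (m div 8) = k * (k+1)))"
      proof (cases "even k")
        case True
        then obtain j where "k = 2 * j" by auto
        hence "n = 4 * j\<^sup>2" using k by (simp add: power2_eq_square)
        thus ?thesis by auto
      next
        case False
        then obtain j where j: "k = 2 * j + 1" by (auto elim: oddE)
        have "even (j * (j+1))" by simp
        then obtain t where t: "j * (j+1) = 2 * t" by (rule evenE)
        have "n = 4 * (j * (j+1)) + 1" using k j by (simp add: power2_eq_square algebra_simps)
        hence "m = 8 * t" using t Suc by simp
        hence "8 dvd m" "2 * (m div 8) = j * (j+1)" using t by simp_all
        thus ?thesis by blast
      qed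
    next
      assume "(4 dvd n \<and> (\<exists>k. n div 4 = k\<^sup>2)) \<or> (8 dvd m \<and> (\<exists>k. 2 * (m div 8) = k * (k+1)))"
      thus "\<exists>k. n = k\<^sup>2"
      proof (elim disjE conjE exE)
        fix k assume "4 dvd n" "n div 4 = k\<^sup>2"
        hence "n = (2 * k)\<^sup>2" by (auto simp: power2_eq_square)
        thus ?thesis by blast
      next
        fix k assume "8 dvd m" "2 * (m div 8) = k * (k+1)"
        hence "m = 4 * (k * (k+1))" by auto
        hence "n = (2 * k + 1)\<^sup>2" using Suc by (simp add: power2_eq_square algebra_simps)
        thus ?thesis by blast
      qed
    qed
    have excl: "\<not> (4 dvd n \<and> 8 dvd m)"
    proof
      assume "4 dvd n \<and> 8 dvd m"
      hence "4 dvd Suc m" "4 dvd m" using Suc by (auto intro: dvd_trans[of 4 8 m])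
      hence "4 dvd Suc m - m" by (intro dvd_diff_nat)
      thus False by simp
    qed
    have n0: "n \<noteq> 0" "4 dvd n \<Longrightarrow> n div 4 \<noteq> 0" using Suc by (auto elim!: dvdE)
    show ?thesis unfolding rhs using sq excl n0 by (auto simp: phi_def psi_def)
  qed
qed

text \<open>A finite form, in the manner of Shanks, of Gauss's product formula for \<phi>(-q).\<close>
lemma gauss_finite:
  fixes q :: "'a :: comm_ring_1"
  defines "M \<equiv> \<lambda>n. \<Prod>j<n. 1 + q ^ Suc j" and "N \<equiv> \<lambda>a b. \<Prod>j=a..<b. 1 - q ^ Suc j"
  shows "M n * (1 + 2 * (\<Sum>t<n. (-1) ^ Suc t * q ^ (Suc t)\<^sup>2))
    = N 0 n + (\<Sum>t<n. 2 * (-1) ^ Suc t * q ^ (Suc t * Suc n) * N (Suc t) n * M t)"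
proof (induction n)
  case 0
  show ?case by (simp add: M_def N_def)
next
  case (Suc n)
  define Q where "Q = q ^ Suc n"
  \<comment> \<open>A telescoping certificate: the t-th summand for n+1, minus 1 + Q times the t-th
    summand for n, is V (t+1) - V t.\<close>
  define V where "V = (\<lambda>t. 2 * (-1) ^ Suc t * Q ^ Suc t * N t n * M t)"
  define A where "A = (\<Sum>t<n. 2 * (-1) ^ Suc t * q ^ (Suc t * Suc n) * N (Suc t) n * M t)"
  have MS: "M (Suc t) = M t * (1 + q ^ Suc t)" for t unfolding M_def by simp
  have NS: "N t (Suc n) = N t n * (1 - Q)" if "t \<le> n" for t unfolding N_def Q_def using that by simp
  have NL: "N t n = (1 - q ^ Suc t) * N (Suc t) n" if "t < n" for t
    unfolding N_def using that by (simp add: prod.atLeast_Suc_lessThan)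
  have qQ: "q ^ (Suc t * Suc n) = Q ^ Suc t" for t unfolding Q_def by (simp only: power_mult[symmetric] mult.commute)
  have qQ': "q ^ (Suc t * Suc (Suc n)) = Q ^ Suc t * q ^ Suc t" for t
    unfolding Q_def by (simp only: power_mult[symmetric] power_add[symmetric]) (simp add: algebra_simps)
  have diff: "2 * (-1) ^ Suc t * q ^ (Suc t * Suc (Suc n)) * N (Suc t) (Suc n) * M t
      - (1 + Q) * (2 * (-1) ^ Suc t * q ^ (Suc t * Suc n) * N (Suc t) n * M t) = V (Suc t) - V t" if "t < n" for t
    unfolding qQ qQ' V_def MS NL[OF that] NS[OF Suc_leI[OF that]] by (simp add: algebra_simps)
  have tel: "(\<Sum>t<n. 2 * (-1) ^ Suc t * q ^ (Suc t * Suc (Suc n)) * N (Suc t) (Suc n) * M t) = (1 + Q) * A + (V n - V 0)"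
  proof -
    have "(\<Sum>t<n. 2 * (-1) ^ Suc t * q ^ (Suc t * Suc (Suc n)) * N (Suc t) (Suc n) * M t) - (1 + Q) * A = (\<Sum>t<n. V (Suc t) - V t)"
      unfolding A_def sum_distrib_left sum_subtractf[symmetric] by (intro sum.cong refl diff) auto
    also have "\<dots> = V n - V 0" by (rule sum_lessThan_telescope)
    finally show ?thesis by (simp add: algebra_simps)
  qed
  have Vn: "V n = 2 * (-1) ^ Suc n * Q ^ Suc n * M n" unfolding V_def N_def by simp
  have V0: "V 0 = - 2 * Q * N 0 n" unfolding V_def M_def by simp
  have last: "2 * (-1) ^ Suc n * q ^ (Suc n * Suc (Suc n)) * N (Suc n) (Suc n) * M n = 2 * (-1) ^ Suc n * Q ^ Suc n * Q * M n"
    unfolding qQ' Q_def[symmetric] by (simp add: N_def mult_ac)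
  have sq: "q ^ (Suc n)\<^sup>2 = Q ^ Suc n" unfolding Q_def by (simp only: power_mult[symmetric] power2_eq_square)
  have "M (Suc n) * (1 + 2 * (\<Sum>t<Suc n. (-1) ^ Suc t * q ^ (Suc t)\<^sup>2))
    = (1 + Q) * (M n * (1 + 2 * (\<Sum>t<n. (-1) ^ Suc t * q ^ (Suc t)\<^sup>2))) + (1 + Q) * (2 * (-1) ^ Suc n * Q ^ Suc n * M n)"
    unfolding sum.lessThan_Suc sq MS Q_def[symmetric] by (simp add: algebra_simps)
  also have "\<dots> = (1 + Q) * (N 0 n + A) + (1 + Q) * (2 * (-1) ^ Suc n * Q ^ Suc n * M n)"
    unfolding Suc.IH A_def ..
  also have "\<dots> = N 0 (Suc n) + ((1 + Q) * A + (V n - V 0) + 2 * (-1) ^ Suc n * Q ^ Suc n * Q * M n)"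
    unfolding Vn V0 NS[OF le0] by (simp add: algebra_simps)
  also have "\<dots> = N 0 (Suc n) + (\<Sum>t<Suc n. 2 * (-1) ^ Suc t * q ^ (Suc t * Suc (Suc n)) * N (Suc t) (Suc n) * M t)"
    unfolding sum.lessThan_Suc tel last ..
  finally show ?case .
qed

section \<open>Truncated Euler products and Gauss's product formula\<close>

definition feq :: "nat \<Rightarrow> 'a :: comm_ring_1 fps \<Rightarrow> 'a fps \<Rightarrow> bool" where
  "feq N f g \<longleftrightarrow> (\<forall>n\<le>N. fps_nth f n = fps_nth g n)"

lemma feq_refl [simp]: "feq N f f" by (simp add: feq_def)
lemma feq_sym: "feq N f g \<Longrightarrow> feq N g f" by (simp add: feq_def)
lemma feq_trans [trans]: "feq N f g \<Longrightarrow> feq N g h \<Longrightarrow> feq N f h" by (simp add: feq_def)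

lemma feq_mult: "feq N f f' \<Longrightarrow> feq N g g' \<Longrightarrow> feq N (f * g) (f' * g')"
  by (auto simp: feq_def fps_mult_nth intro!: sum.cong)

lemma feq_power: "feq N f f' \<Longrightarrow> feq N (f ^ n) (f' ^ n)"
  by (induction n) (auto intro: feq_mult)

text \<open>The coefficient of q^n is stable from truncation n on, so the diagonal assembles the
  infinite product f_k into one power series.\<close>

definition eulerf :: "nat \<Rightarrow> int fps" where
  "eulerf k = Abs_fps (\<lambda>n. fps_nth (f_trunc k n) n)"

lemma f_trunc_feq:
  assumes "k \<ge> 1" "N \<le> N'"
  shows "feq N (f_trunc k N') (f_trunc k N)"
  using assms(2)
proof (induction N' rule: dec_induct)
  case (step n)
  have "N < k * Suc n" using step assms by (metis Suc_le_lessD le_imp_less_Suc le_trans mult_le_mono1 nat_mult_1 not_less_eq_eq less_le_trans)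
  hence "feq N (1 - fps_X ^ (k * Suc n)) (1 :: int fps)"
    by (auto simp: feq_def fps_X_power_nth)
  hence "feq N (f_trunc k n * (1 - fps_X ^ (k * Suc n))) (f_trunc k N * 1)"
    using step by (intro feq_mult)
  thus ?case by (simp add: f_trunc_def)
qed auto

lemma eulerf_feq: "k \<ge> 1 \<Longrightarrow> feq N (eulerf k) (f_trunc k N)"
  using f_trunc_feq[of k] by (auto simp: feq_def eulerf_def)

lemma alt_phi_feq: "feq n (alt phi) (1 + 2 * (\<Sum>t<n. (-1) ^ Suc t * fps_X ^ (Suc t)\<^sup>2))"
  unfolding feq_def
proof (intro allI impI)
  fix i assume i: "i \<le> n"
  have m1: "((-1) ^ m :: int fps) = fps_const ((-1) ^ m)" for m
    by (metis fps_const_1_eq_1 fps_const_neg fps_const_power)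
  have "fps_nth (1 + 2 * (\<Sum>t<n. (-1) ^ Suc t * fps_X ^ (Suc t)\<^sup>2) :: int fps) i
     = (if i = 0 then 1 else 0) + 2 * (\<Sum>t<n. (-1) ^ Suc t * (if i = (Suc t)\<^sup>2 then 1 else 0))"
    unfolding m1 by (simp add: fps_sum_nth fps_X_power_nth del: power_Suc)
  also have "\<dots> = fps_nth (alt phi) i"
  proof (cases "\<exists>t. i = (Suc t)\<^sup>2")
    case True
    then obtain t where t: "i = (Suc t)\<^sup>2" by auto
    have "Suc t \<le> (Suc t)\<^sup>2" by (simp add: power2_eq_square)
    hence tn: "t < n" using i t by linarith
    have "(\<Sum>s<n. (-1) ^ Suc s * (if i = (Suc s)\<^sup>2 then 1 else 0 :: int)) = (\<Sum>s<n. if s = t then (-1) ^ Suc t else 0)"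
      by (intro sum.cong refl) (auto simp: t simp del: power_Suc)
    also have "\<dots> = (-1) ^ Suc t" using tn by (simp del: power_Suc)
    also have "\<dots> = (-1) ^ i" unfolding t by (simp add: minus_one_power_iff del: power_Suc)
    finally show ?thesis using t by (auto simp: phi_def)
  next
    case False
    hence 1: "(\<Sum>s<n. (-1) ^ Suc s * (if i = (Suc s)\<^sup>2 then 1 else 0 :: int)) = 0" by (intro sum.neutral) auto
    have "i = 0 \<or> \<not> (\<exists>k. i = k\<^sup>2)" using False by (metis not0_implies_Suc power_zero_numeral)
    thus ?thesis unfolding 1 by (auto simp: phi_def)
  qed
  finally show "fps_nth (alt phi) i = fps_nth (1 + 2 * (\<Sum>t<n. (-1) ^ Suc t * fps_X ^ (Suc t)\<^sup>2)) i" by simp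
qed

text \<open>Each error term of \<open>gauss_finite\<close> carries the factor q^((t+1)(n+1)) and
  vanishes through degree n. Multiplying what remains by f_1 turns f_1 times the product of the 1 +
  q^j into f_2.\<close>

theorem gauss_phi: "alt phi * eulerf 2 = eulerf 1 ^ 2"
proof (rule fps_ext)
  fix n
  let ?S = "1 + 2 * (\<Sum>t<n. (-1) ^ Suc t * fps_X ^ (Suc t)\<^sup>2) :: int fps"
  let ?M = "\<lambda>n. \<Prod>j<n. 1 + fps_X ^ Suc j :: int fps" and ?N = "\<lambda>a b. \<Prod>j=a..<b. 1 - fps_X ^ Suc j :: int fps"
  let ?R = "\<Sum>t<n. 2 * (-1) ^ Suc t * fps_X ^ (Suc t * Suc n) * ?N (Suc t) n * ?M t"
  have N: "?N 0 n = f_trunc 1 n"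
    unfolding f_trunc_def by (simp add: prod.atLeast1_atMost_eq atLeast0LessThan del: power_Suc)
  have MN: "?M n * ?N 0 n = f_trunc 2 n"
  proof -
    have "(1 + fps_X ^ Suc j) * (1 - fps_X ^ Suc j) = (1 - fps_X ^ (2 * Suc j) :: int fps)" for j
      by (simp add: algebra_simps power_add[symmetric] mult_2 del: power_Suc) (simp add: power_add[symmetric] del: power_Suc)?
    hence "?M n * ?N 0 n = (\<Prod>j<n. 1 - fps_X ^ (2 * Suc j))"
      by (simp only: prod.distrib[symmetric] atLeast0LessThan)
    also have "\<dots> = (\<Prod>j=1..n. 1 - fps_X ^ (2 * j))" unfolding One_nat_def by (rule prod.atLeast1_atMost_eq[symmetric])
    finally show ?thesis unfolding f_trunc_def .
  qed
  have R: "fps_nth ?R i = 0" if "i \<le> n" for i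
    unfolding fps_sum_nth
  proof (intro sum.neutral ballI)
    fix t assume "t \<in> {..<n}"
    have "2 * (-1) ^ Suc t * fps_X ^ (Suc t * Suc n) * ?N (Suc t) n * ?M t = fps_X ^ (Suc t * Suc n) * (2 * (-1) ^ Suc t * ?N (Suc t) n * ?M t)"
      by (simp only: mult_ac)
    moreover have "i < Suc t * Suc n" using that by simp
    ultimately show "fps_nth (2 * (-1) ^ Suc t * fps_X ^ (Suc t * Suc n) * ?N (Suc t) n * ?M t) i = 0"
      by (simp only: fps_X_power_mult_nth if_True)
  qed
  have "feq n (?N 0 n + ?R) (f_trunc 1 n)" unfolding feq_def N using R by simp
  hence "feq n (?M n * ?S) (f_trunc 1 n)" using gauss_finite[of "fps_X :: int fps" n] by simp
  hence "feq n (f_trunc 1 n * (?M n * ?S)) (f_trunc 1 n * f_trunc 1 n)" by (intro feq_mult) auto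
  moreover have "f_trunc 1 n * (?M n * ?S) = ?S * f_trunc 2 n"
    unfolding MN[symmetric] N by (simp only: mult_ac)
  ultimately have "feq n (?S * f_trunc 2 n) (f_trunc 1 n ^ 2)" by (simp only: power2_eq_square)
  moreover have "feq n (alt phi * eulerf 2) (?S * f_trunc 2 n)"
    by (intro feq_mult alt_phi_feq eulerf_feq) auto
  moreover have "feq n (f_trunc 1 n ^ 2) (eulerf 1 ^ 2)"
    by (intro feq_power feq_sym[OF eulerf_feq]) auto
  ultimately have "feq n (alt phi * eulerf 2) (eulerf 1 ^ 2)" using feq_trans by blast
  thus "fps_nth (alt phi * eulerf 2) n = fps_nth (eulerf 1 ^ 2) n" by (simp add: feq_def)
qed

lemma norm_prod_one_plus_powers_le:
  fixes q :: complex and f :: "nat \<Rightarrow> complex"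
  assumes "norm q < 1" "finite A" "\<And>j. norm (f j) \<le> 1 + norm q ^ Suc j"
  shows "norm (\<Prod>j\<in>A. f j) \<le> exp (1 / (1 - norm q))"
proof -
  have "norm (\<Prod>j\<in>A. f j) = (\<Prod>j\<in>A. norm (f j))" by (rule prod_norm[symmetric])
  also have "\<dots> \<le> (\<Prod>j\<in>A. exp (norm q ^ Suc j))"
    using order_trans[OF assms(3) exp_ge_add_one_self] by (intro prod_mono conjI norm_ge_zero)
  also have "\<dots> = exp (\<Sum>j\<in>A. norm q ^ Suc j)" using assms by (simp add: exp_sum)
  also have "(\<Sum>j\<in>A. norm q ^ Suc j) \<le> (\<Sum>j\<in>A. norm q ^ j)"
    using assms by (intro sum_mono) (auto intro: mult_left_le_one_le)
  also have "\<dots> \<le> (\<Sum>j. norm q ^ j)" using assms by (intro sum_le_suminf) (auto intro: summable_geometric)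
  also have "\<dots> = 1 / (1 - norm q)" using assms by (intro suminf_geometric) auto
  finally show ?thesis by simp
qed

text \<open>The finite identity is now used analytically; its error is O(n |q|^n). Nonvanishing
  follows because the products of the 1 - q^j and of the 1 + q^j converge absolutely and have no
  zero factor.\<close>

lemma gauss_product:
  fixes q :: complex
  assumes q: "norm q < 1"
  shows "(\<lambda>n. \<Prod>j<n. (1 - q ^ Suc j) / (1 + q ^ Suc j)) \<longlonglongrightarrow> ev phi (- q)" and "ev phi (- q) \<noteq> 0"
proof -
  have qs: "norm (q ^ Suc j) < 1" for j using q by (simp add: norm_power power_less_one_iff del: power_Suc)
  have ne: "1 + q ^ Suc j \<noteq> 0" "1 - q ^ Suc j \<noteq> 0" for j
    using qs[of j] by (metis add_eq_0_iff2 norm_minus_cancel norm_one less_irrefl, metis eq_iff_diff_eq_0 norm_one less_irrefl)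
  have sm: "summable (\<lambda>j. norm (q ^ Suc j))"
    using q by (simp add: norm_power summable_mult summable_geometric norm_mult)
  define MM where "MM = prodinf (\<lambda>j. 1 + q ^ Suc j)"
  define NN where "NN = prodinf (\<lambda>j. 1 - q ^ Suc j)"
  have c1: "convergent_prod (\<lambda>j. 1 + q ^ Suc j)" and c2: "convergent_prod (\<lambda>j. 1 - q ^ Suc j)"
    using sm by (auto intro!: abs_convergent_prod_imp_convergent_prod simp: abs_convergent_prod_conv_summable simp del: power_Suc)
  have M: "(\<lambda>n. \<Prod>j<n. 1 + q ^ Suc j) \<longlonglongrightarrow> MM" and N: "(\<lambda>n. \<Prod>j<n. 1 - q ^ Suc j) \<longlonglongrightarrow> NN"
    unfolding MM_def NN_def LIMSEQ_lessThan_iff_atMost using c1 c2 by (auto intro!: convergent_prod_LIMSEQ simp del: power_Suc)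
  have M0: "MM \<noteq> 0" and N0: "NN \<noteq> 0" unfolding MM_def NN_def using prodinf_nonzero[OF c1 ne(1)] prodinf_nonzero[OF c2 ne(2)] by simp_all
  define B where "B = exp (1 / (1 - norm q))"
  have B0: "B \<ge> 0" unfolding B_def by simp
  let ?M = "\<lambda>n. \<Prod>j<n. 1 + q ^ Suc j" and ?N = "\<lambda>a b. \<Prod>j=a..<b. 1 - q ^ Suc j"
  define R where "R = (\<lambda>n. \<Sum>t<n. 2 * (-1) ^ Suc t * q ^ (Suc t * Suc n) * ?N (Suc t) n * ?M t)"
  have Rb: "norm (R n) \<le> 2 * B^2 * norm q * (of_nat n * norm q ^ n)" for n
  proof -
    have "norm (R n) \<le> (\<Sum>t<n. 2 * B^2 * norm q ^ Suc n)"
      unfolding R_def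
    proof (rule sum_norm_le)
      fix t assume "t \<in> {..<n}"
      have b1: "norm (?N (Suc t) n) \<le> B" and b2: "norm (?M t) \<le> B"
        unfolding B_def using q by (auto intro!: norm_prod_one_plus_powers_le norm_triangle_le norm_triangle_le_diff simp: norm_mult norm_power)
      have "norm q ^ (Suc t * Suc n) \<le> norm q ^ Suc n" using q by (intro power_decreasing) auto
      hence "2 * norm q ^ (Suc t * Suc n) * norm (?N (Suc t) n) * norm (?M t) \<le> 2 * norm q ^ Suc n * B * B"
        using b1 b2 B0 by (intro mult_mono) auto
      thus "norm (2 * (-1) ^ Suc t * q ^ (Suc t * Suc n) * ?N (Suc t) n * ?M t) \<le> 2 * B^2 * norm q ^ Suc n"
        by (simp only: norm_mult norm_power norm_minus_cancel norm_one power_one norm_numeral power2_eq_square mult_ac mult_1_left mult_1_right)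
    qed
    thus ?thesis by (simp add: mult_ac)
  qed
  have "(\<lambda>n. 2 * B^2 * norm q * (of_nat n * norm q ^ n)) \<longlonglongrightarrow> 2 * B^2 * norm q * 0"
    using q by (intro tendsto_mult tendsto_const powser_times_n_limit_0) auto
  hence "R \<longlonglongrightarrow> 0" using Rb by (intro Lim_null_comparison[of R]) auto
  hence lim1: "(\<lambda>n. ?N 0 n + R n) \<longlonglongrightarrow> NN + 0" using N by (intro tendsto_add) (simp_all add: atLeast0LessThan)
  have "(\<lambda>t. (- q) ^ (Suc t)\<^sup>2) sums ((ev phi (-q) - 1) / 2)" using q by (intro phi_sums) simp
  hence "(\<lambda>n. \<Sum>t<n. (- q) ^ (Suc t)\<^sup>2) \<longlonglongrightarrow> (ev phi (-q) - 1) / 2" by (simp add: sums_def)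
  moreover have "(- q) ^ (Suc t)\<^sup>2 = (-1) ^ Suc t * q ^ (Suc t)\<^sup>2" for t
    by (subst power_minus) (simp add: minus_one_power_iff del: power_Suc)
  ultimately have "(\<lambda>n. \<Sum>t<n. (-1) ^ Suc t * q ^ (Suc t)\<^sup>2) \<longlonglongrightarrow> (ev phi (-q) - 1) / 2" by (simp only:)
  hence "(\<lambda>n. ?M n * (1 + 2 * (\<Sum>t<n. (-1) ^ Suc t * q ^ (Suc t)\<^sup>2))) \<longlonglongrightarrow> MM * (1 + 2 * ((ev phi (-q) - 1) / 2))"
    by (intro tendsto_intros M)
  moreover have "?M n * (1 + 2 * (\<Sum>t<n. (-1) ^ Suc t * q ^ (Suc t)\<^sup>2)) = ?N 0 n + R n" for n
    unfolding R_def by (rule gauss_finite)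
  ultimately have "(\<lambda>n. ?N 0 n + R n) \<longlonglongrightarrow> MM * (1 + 2 * ((ev phi (-q) - 1) / 2))" by (simp only:)
  hence "MM * (1 + 2 * ((ev phi (-q) - 1) / 2)) = NN + 0" by (rule LIMSEQ_unique) (rule lim1)
  moreover have "1 + 2 * ((x - 1) / 2) = x" for x :: complex by (simp add: field_simps)
  ultimately have eq: "MM * ev phi (-q) = NN" by (simp only: add_0_right)
  thus "ev phi (-q) \<noteq> 0" using N0 by auto
  have "(\<lambda>n. (\<Prod>j<n. 1 - q ^ Suc j) / (\<Prod>j<n. 1 + q ^ Suc j)) \<longlonglongrightarrow> NN / MM"
    by (intro tendsto_divide M N M0)
  moreover have "NN / MM = ev phi (-q)" unfolding eq[symmetric] using M0 by (rule nonzero_mult_div_cancel_left)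
  ultimately show "(\<lambda>n. \<Prod>j<n. (1 - q ^ Suc j) / (1 + q ^ Suc j)) \<longlonglongrightarrow> ev phi (- q)"
    by (simp only: prod_dividef)
qed

text \<open>In the product formula the factors of odd index for q and -q are reciprocal and cancel,
  while those of even index coincide and give the square of the product at q^2.\<close>

lemma phi_duplication:
  assumes "norm q < 1"
  shows "ev phi (- (q\<^sup>2)) ^ 2 = ev phi q * ev phi (- q)"
proof -
  define P where "P = (\<lambda>q::complex. \<lambda>n. \<Prod>j<n. (1 - q ^ Suc j) / (1 + q ^ Suc j))"
  have Plim: "P q \<longlonglongrightarrow> ev phi (- q)" if "norm q < 1" for q
    using gauss_product(1)[OF that] unfolding P_def .
  have q2: "norm (q\<^sup>2) < 1" using assms by (simp add: norm_power power_less_one_iff)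
  have qs: "norm (q ^ Suc j) < 1" for j using assms by (simp add: norm_power power_less_one_iff del: power_Suc)
  have ne: "1 + q ^ Suc j \<noteq> 0" "1 - q ^ Suc j \<noteq> 0" for j
    using qs[of j] by (metis add_eq_0_iff2 norm_minus_cancel norm_one less_irrefl, metis eq_iff_diff_eq_0 norm_one less_irrefl)
  have eq: "P q (2 * n) * P (- q) (2 * n) = P (q\<^sup>2) n ^ 2" for n
  proof (induction n)
    case (Suc n)
    have S: "P x (2 * Suc n) = P x (2 * n) * ((1 - x ^ Suc (2 * n)) / (1 + x ^ Suc (2 * n))) * ((1 - x ^ Suc (Suc (2 * n))) / (1 + x ^ Suc (Suc (2 * n))))" for x
      unfolding P_def by simp
    have S': "P x (Suc n) = P x n * ((1 - x ^ Suc n) / (1 + x ^ Suc n))" for x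
      unfolding P_def by simp
    have o: "(- q) ^ Suc (2 * n) = - (q ^ Suc (2 * n))" by simp
    have e: "(- q) ^ Suc (Suc (2 * n)) = q ^ Suc (Suc (2 * n))" by simp
    have t: "(q\<^sup>2) ^ Suc n = q ^ Suc (Suc (2 * n))" unfolding power_mult[symmetric] by (rule arg_cong) simp
    have "P q (2 * Suc n) * P (- q) (2 * Suc n) = (P q (2 * n) * P (- q) (2 * n)) *
        (((1 - q ^ Suc (2 * n)) / (1 + q ^ Suc (2 * n))) * ((1 + q ^ Suc (2 * n)) / (1 - q ^ Suc (2 * n)))) *
        ((1 - q ^ Suc (Suc (2 * n))) / (1 + q ^ Suc (Suc (2 * n))))^2"
      unfolding S o e by (simp add: power2_eq_square mult_ac del: power_Suc)
    also have "((1 - q ^ Suc (2 * n)) / (1 + q ^ Suc (2 * n))) * ((1 + q ^ Suc (2 * n)) / (1 - q ^ Suc (2 * n))) = 1"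
      using ne[of "2 * n"] by (simp del: power_Suc)
    finally show ?case unfolding S' t Suc.IH power_mult_distrib by (simp only: mult_1_right)
  qed (simp add: P_def)
  have sub: "strict_mono (\<lambda>n::nat. 2 * n)" by (simp add: strict_mono_def)
  have "(\<lambda>n. P q (2 * n) * P (- q) (2 * n)) \<longlonglongrightarrow> ev phi (- q) * ev phi (- (- q))"
    using Plim[of q] Plim[of "-q"] assms
    by (intro tendsto_mult LIMSEQ_subseq_LIMSEQ[OF _ sub, unfolded o_def]) auto
  moreover have "(\<lambda>n. P (q\<^sup>2) n ^ 2) \<longlonglongrightarrow> ev phi (- (q\<^sup>2)) ^ 2"
    using Plim[OF q2] by (intro tendsto_power)
  ultimately show ?thesis unfolding eq using LIMSEQ_unique by (fastforce simp: mult.commute)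
qed

section \<open>Theta constants on the upper half-plane\<close>

abbreviation uhp :: "complex set" where "uhp \<equiv> {\<tau>. Im \<tau> > 0}"

definition nome :: "complex \<Rightarrow> complex" where "nome \<tau> = exp (\<i> * pi * \<tau>)"

lemma norm_nome: "Im \<tau> > 0 \<Longrightarrow> norm (nome \<tau>) < 1"
  by (simp add: nome_def)

lemma nome_mult_nat: "nome (of_nat n * \<tau>) = nome \<tau> ^ n"
  by (simp add: nome_def exp_of_nat_mult[symmetric] mult_ac)

lemma nome_numeral: "nome (numeral n * \<tau>) = nome \<tau> ^ numeral n"
  using nome_mult_nat[of "numeral n"] by simp

text \<open>The Jacobi theta constants with nome exp(i pi \<tau>). The fourth root of the nome in
  \<open>th2\<close> is fixed as a function of \<tau>, since it is not a power series in the
  nome.\<close>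

definition th2 :: "complex \<Rightarrow> complex" where "th2 \<tau> = 2 * exp (\<i> * pi * \<tau> / 4) * ev psi (nome \<tau> ^ 2)"
definition th3 :: "complex \<Rightarrow> complex" where "th3 \<tau> = ev phi (nome \<tau>)"
definition th4 :: "complex \<Rightarrow> complex" where "th4 \<tau> = ev phi (- nome \<tau>)"

lemma ev_phi_split: "norm q < 1 \<Longrightarrow> ev phi q = ev phi (q ^ 4) + 2 * q * ev psi (q ^ 8)"
  by (subst phi_split) (simp add: ev_add ev_mult ev_dil conv1_mult conv1_dil)

lemma th2_four: "th2 (4 * \<tau>) = 2 * nome \<tau> * ev psi (nome \<tau> ^ 8)"
proof -
  have "exp (\<i> * pi * (4 * \<tau>) / 4) = nome \<tau>" unfolding nome_def by (rule arg_cong[where f = exp]) simp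
  moreover have "nome (4 * \<tau>) ^ 2 = nome \<tau> ^ 8" by (simp add: nome_numeral power_mult[symmetric])
  ultimately show ?thesis by (simp only: th2_def)
qed

lemma th3_split: "Im \<tau> > 0 \<Longrightarrow> th3 \<tau> = th3 (4 * \<tau>) + th2 (4 * \<tau>)"
  using ev_phi_split[OF norm_nome, of \<tau>] by (simp add: th3_def th2_four nome_numeral)

lemma th4_split: "Im \<tau> > 0 \<Longrightarrow> th4 \<tau> = th3 (4 * \<tau>) - th2 (4 * \<tau>)"
  using ev_phi_split[of "- nome \<tau>"] norm_nome[of \<tau>] by (simp add: th3_def th4_def th2_four nome_numeral)

lemma th3_real:
  assumes "t > 0"
  shows "th3 (\<i> * of_real t) = of_real (1 + 2 * (\<Sum>k. exp (- (pi * real (Suc k)^2 * t))))"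
proof -
  have n: "nome (\<i> * of_real t) = of_real (exp (- (pi * t)))"
    by (simp add: nome_def exp_of_real[symmetric] mult_ac)
  have "norm (nome (\<i> * of_real t)) < 1" using assms by (intro norm_nome) simp
  from phi_sums[OF this] have "(\<lambda>k. of_real (exp (- (pi * real (Suc k)^2 * t)))) sums ((th3 (\<i> * of_real t) - 1) / 2)"
    unfolding th3_def n of_real_power[symmetric] exp_of_nat_mult[symmetric] by (simp add: mult_ac)
  hence 1: "(\<Sum>k. complex_of_real (exp (- (pi * real (Suc k)^2 * t)))) = (th3 (\<i> * of_real t) - 1) / 2"
    by (simp add: sums_iff)
  have "summable (\<lambda>k. exp (- (real (Suc k)^2 * (pi * t))))"
    using summable_exp_neg_quadratic[of "pi * t"] assms by (subst summable_Suc_iff) simp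
  hence "summable (\<lambda>k. exp (- (pi * real (Suc k)^2 * t)))" by (simp only: mult_ac)
  hence "complex_of_real (\<Sum>k. exp (- (pi * real (Suc k)^2 * t))) = (\<Sum>k. complex_of_real (exp (- (pi * real (Suc k)^2 * t))))"
    by (rule suminf_of_real)
  thus ?thesis using 1 by (simp add: field_simps)
qed

lemma th3_real_transform:
  assumes t: "t > 0"
  shows "th3 (\<i> * of_real (1 / t)) = of_real (sqrt t) * th3 (\<i> * of_real t)"
proof -
  \<comment> \<open>With u = t/pi the Gaussian exponents become pi k^2 t and pi k^2 / t.\<close>
  have "1 + 2 * (\<Sum>k. exp (- (pi^2 * real (Suc k)^2 * (t/pi)))) = (1 + 2 * (\<Sum>k. exp (- (real (Suc k)^2 / (t/pi))))) / sqrt (pi * (t/pi))"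
    by (rule gaussian_sum_transform) (use t in auto)
  also have "(\<lambda>k. exp (- (pi^2 * real (Suc k)^2 * (t/pi)))) = (\<lambda>k. exp (- (pi * real (Suc k)^2 * t)))"
    by (simp add: power2_eq_square mult_ac)
  also have "(\<lambda>k. exp (- (real (Suc k)^2 / (t/pi)))) = (\<lambda>k. exp (- (pi * real (Suc k)^2 * (1/t))))"
    by (simp add: mult_ac)
  finally have "1 + 2 * (\<Sum>k. exp (- (pi * real (Suc k)^2 * t))) = (1 + 2 * (\<Sum>k. exp (- (pi * real (Suc k)^2 * (1/t))))) / sqrt t"
    by simp
  hence "1 + 2 * (\<Sum>k. exp (- (pi * real (Suc k)^2 * (1/t)))) = sqrt t * (1 + 2 * (\<Sum>k. exp (- (pi * real (Suc k)^2 * t))))"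
    using t by (simp add: field_simps)
  thus ?thesis using t by (simp only: th3_real zero_less_divide_1_iff of_real_mult)
qed

lemma uhp_facts: "open uhp" "connected uhp"
  by (simp_all add: open_halfspace_Im_gt convex_halfspace_Im_gt convex_connected)

lemma Im_minus_inverse: "Im \<tau> > 0 \<Longrightarrow> Im (- 1 / \<tau>) > 0"
  by (simp add: Im_divide power2_eq_square) (auto intro!: divide_pos_pos add_nonneg_pos simp: sum_power2_gt_zero_iff zero_less_mult_iff)

lemma ev_nome_holomorphic:
  assumes "conv1 f" "g holomorphic_on S" "\<And>z. z \<in> S \<Longrightarrow> Im (g z) > 0"
  shows "(\<lambda>\<tau>. ev f (nome (g \<tau>))) holomorphic_on S"
proof -
  have "(\<lambda>\<tau>. nome (g \<tau>)) holomorphic_on S" unfolding nome_def by (intro holomorphic_intros assms)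
  moreover have "(\<lambda>\<tau>. nome (g \<tau>)) ` S \<subseteq> ball 0 1" using norm_nome assms by auto
  ultimately show ?thesis using holomorphic_on_compose_gen[OF _ ev_holomorphic[OF assms(1)]] by (auto simp: o_def)
qed

text \<open>Both sides are holomorphic on the upper half-plane, because -i \<tau> has positive real
  part there and avoids the cut of the square root. They agree on the imaginary axis by the real
  case, and the identity theorem extends this.\<close>

theorem th3_transform:
  assumes "Im \<tau> > 0"
  shows "th3 (- 1 / \<tau>) = csqrt (- \<i> * \<tau>) * th3 \<tau>"
proof -
  define F where "F = (\<lambda>\<tau>. th3 (- 1 / \<tau>) - csqrt (- \<i> * \<tau>) * th3 \<tau>)"
  have "F \<tau> = 0"
  proof (rule analytic_continuation[of F uhp "(\<lambda>t. \<i> * of_real t) ` {0<..}" \<i>])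
    have nz: "\<tau> \<noteq> 0" if "\<tau> \<in> uhp" for \<tau> using that by auto
    have 1: "(\<lambda>\<tau>. th3 (- 1 / \<tau>)) holomorphic_on uhp" unfolding th3_def
      by (intro ev_nome_holomorphic holomorphic_intros) (use Im_minus_inverse nz in blast)+
    have 2: "th3 holomorphic_on uhp" unfolding th3_def
      by (rule ev_nome_holomorphic[where g = "\<lambda>x. x"]) (auto intro!: holomorphic_intros)
    have 3: "(\<lambda>\<tau>. csqrt (- \<i> * \<tau>)) holomorphic_on uhp"
    proof (rule holomorphic_on_csqrt')
      fix z assume "z \<in> uhp"
      thus "- \<i> * z \<notin> \<real>\<^sub>\<le>\<^sub>0" by (auto simp: complex_nonpos_Reals_iff)
    qed (intro holomorphic_intros)
    show "F holomorphic_on uhp" unfolding F_def by (intro holomorphic_on_diff holomorphic_on_mult 1 2 3)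
    show "\<i> islimpt (\<lambda>t. \<i> * of_real t) ` {0<..}"
    proof -
      have "(\<lambda>n. \<i> * of_real (1 + 1 / real (Suc n))) \<longlonglongrightarrow> \<i> * of_real (1 + 0)"
        by (intro tendsto_intros) (use LIMSEQ_inverse_real_of_nat in \<open>simp add: inverse_eq_divide\<close>)
      thus ?thesis unfolding islimpt_sequential
        by (intro exI[of _ "\<lambda>n. \<i> * of_real (1 + 1 / real (Suc n))"]) (auto simp: complex_eq_iff intro!: imageI add_pos_nonneg)
    qed
    fix z assume "z \<in> (\<lambda>t. \<i> * of_real t) ` {0<..}"
    then obtain t where t: "t > 0" "z = \<i> * of_real t" by auto
    have a: "- 1 / z = \<i> * of_real (1 / t)" using t by (simp add: field_simps complex_eq_iff Im_divide Re_divide power2_eq_square)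
    have "- \<i> * z = of_real t" using t by simp
    hence b: "csqrt (- \<i> * z) = of_real (sqrt t)" using t csqrt_of_real_nonneg[of "complex_of_real t"] by simp
    show "F z = 0" unfolding F_def a b unfolding t(2) th3_real_transform[OF t(1)] by simp
  qed (use assms uhp_facts in auto)
  thus ?thesis by (simp add: F_def)
qed

lemma csqrt_4: "csqrt (4 * z) = 2 * csqrt z"
proof (rule csqrt_unique)
  show "(2 * csqrt z)\<^sup>2 = 4 * z" by (simp add: power_mult_distrib)
  show "0 < Re (2 * csqrt z) \<or> Re (2 * csqrt z) = 0 \<and> 0 \<le> Im (2 * csqrt z)" using csqrt_principal[of z] by simp
qed

text \<open>The principal square root of -i \<tau> has positive real part, and so has its
  reciprocal, which is therefore again the principal root; no sign ambiguity arises.\<close>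

lemma csqrt_inverse_uhp:
  assumes "Im \<tau> > 0"
  shows "csqrt (- \<i> * (- 1 / \<tau>)) * csqrt (- \<i> * \<tau>) = 1"
proof -
  have nz: "\<tau> \<noteq> 0" using assms by auto
  define s where "s = csqrt (- \<i> * \<tau>)"
  have s2: "s\<^sup>2 = - \<i> * \<tau>" unfolding s_def by simp
  have s0: "s \<noteq> 0" using s2 nz by auto
  have "Re s > 0"
  proof (rule ccontr)
    assume "\<not> Re s > 0"
    hence "Re s = 0" using csqrt_principal[of "- \<i> * \<tau>"] unfolding s_def by auto
    hence "Re (s\<^sup>2) \<le> 0" by (simp add: power2_eq_square)
    thus False unfolding s2 using assms by simp
  qed
  hence "Re (1 / s) > 0" using s0 by (simp add: Re_divide power2_eq_square) (auto intro!: divide_pos_pos add_pos_nonneg)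
  moreover have "(1 / s)\<^sup>2 = - \<i> * (- 1 / \<tau>)" unfolding power_divide s2 using nz by (simp add: field_simps)
  ultimately have "csqrt (- \<i> * (- 1 / \<tau>)) = 1 / s" by (intro csqrt_unique) auto
  thus ?thesis using s0 unfolding s_def[symmetric] by simp
qed

text \<open>By the splitting of the theta series, th2(-1/\<tau>) is th3(-1/(4\<tau>)) -
  th3(-1/\<tau>). The law at 4\<tau> yields a factor 2 = sqrt 4, and 2 th3(4\<tau>) - th3(\<tau>) is
  th4(\<tau>).\<close>

theorem th2_transform:
  assumes "Im \<tau> > 0"
  shows "th2 (- 1 / \<tau>) = csqrt (- \<i> * \<tau>) * th4 \<tau>"
proof -
  have nz: "\<tau> \<noteq> 0" using assms by auto
  have 1: "Im (- 1 / (4 * \<tau>)) > 0" using assms by (intro Im_minus_inverse) simp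
  have 2: "4 * (- 1 / (4 * \<tau>)) = - 1 / \<tau>" using nz by simp
  have "th2 (- 1 / \<tau>) = th3 (- 1 / (4 * \<tau>)) - th3 (- 1 / \<tau>)"
    using th3_split[OF 1] unfolding 2 by simp
  also have "th3 (- 1 / (4 * \<tau>)) = csqrt (- \<i> * (4 * \<tau>)) * th3 (4 * \<tau>)"
    by (rule th3_transform) (use assms in simp)
  also have "- \<i> * (4 * \<tau>) = 4 * (- \<i> * \<tau>)" by simp
  also have "csqrt (4 * (- \<i> * \<tau>)) = 2 * csqrt (- \<i> * \<tau>)" by (rule csqrt_4)
  also have "th3 (- 1 / \<tau>) = csqrt (- \<i> * \<tau>) * th3 \<tau>" by (rule th3_transform[OF assms])
  also have "2 * csqrt (- \<i> * \<tau>) * th3 (4 * \<tau>) - csqrt (- \<i> * \<tau>) * th3 \<tau> = csqrt (- \<i> * \<tau>) * (2 * th3 (4 * \<tau>) - th3 \<tau>)"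
    by (simp only: right_diff_distrib mult_ac)
  also have "2 * th3 (4 * \<tau>) - th3 \<tau> = th4 \<tau>" using th3_split[OF assms] th4_split[OF assms] by simp
  finally show ?thesis .
qed

theorem th4_transform:
  assumes "Im \<tau> > 0"
  shows "th4 (- 1 / \<tau>) = csqrt (- \<i> * \<tau>) * th2 \<tau>"
proof -
  have nz: "\<tau> \<noteq> 0" using assms by auto
  have "th2 (- 1 / (- 1 / \<tau>)) = csqrt (- \<i> * (- 1 / \<tau>)) * th4 (- 1 / \<tau>)"
    by (rule th2_transform[OF Im_minus_inverse[OF assms]])
  also have "- 1 / (- 1 / \<tau>) = \<tau>" using nz by simp
  finally have "csqrt (- \<i> * \<tau>) * th2 \<tau> = (csqrt (- \<i> * (- 1 / \<tau>)) * csqrt (- \<i> * \<tau>)) * th4 (- 1 / \<tau>)"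
    by (simp only: mult_ac)
  thus ?thesis unfolding csqrt_inverse_uhp[OF assms] by simp
qed

lemma th4_double: "Im \<tau> > 0 \<Longrightarrow> th4 (2 * \<tau>) ^ 2 = th3 \<tau> * th4 \<tau>"
  using phi_duplication[OF norm_nome, of \<tau>] by (simp add: th4_def th3_def nome_numeral)

lemma theta_squared_transform:
  assumes "Im \<tau> > 0"
  shows "th2 (- 1 / \<tau>) ^ 2 = - \<i> * \<tau> * th4 \<tau> ^ 2" "th3 (- 1 / \<tau>) ^ 2 = - \<i> * \<tau> * th3 \<tau> ^ 2"
    "th4 (- 1 / \<tau>) ^ 2 = - \<i> * \<tau> * th2 \<tau> ^ 2"
  by (simp_all only: th2_transform[OF assms] th3_transform[OF assms] th4_transform[OF assms] power_mult_distrib power2_csqrt)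

text \<open>The remaining identities follow from the duplication formula for the fourth theta function by
  alternating the transformation law with the splitting of the theta series by parity.\<close>
lemma th2_double:
  assumes "Im \<tau> > 0"
  shows "th2 \<tau> ^ 2 = 2 * th2 (2 * \<tau>) * th3 (2 * \<tau>)"
proof -
  define s where "s = 2 * \<tau>"
  have s: "Im s > 0" and \<tau>: "\<tau> = s / 2" using assms by (simp_all add: s_def)
  have nz: "s \<noteq> 0" using s by auto
  have e: "2 * (- 1 / s) = - 1 / (s / 2)" using nz by simp
  have "th4 (- 1 / (s / 2)) ^ 2 = th3 (- 1 / s) * th4 (- 1 / s)"
    using th4_double[OF Im_minus_inverse[OF s]] unfolding e .
  also have "th4 (- 1 / (s / 2)) ^ 2 = - \<i> * (s / 2) * th2 (s / 2) ^ 2"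
    by (rule theta_squared_transform) (use s in simp)
  also have "th3 (- 1 / s) * th4 (- 1 / s) = csqrt (- \<i> * s) ^ 2 * (th3 s * th2 s)"
    unfolding th3_transform[OF s] th4_transform[OF s] power2_eq_square by (simp only: mult_ac)
  finally have "s * (\<i> * th2 (s / 2) ^ 2) = s * (\<i> * (2 * th3 s * th2 s))" by (simp add: field_simps)
  thus ?thesis using nz unfolding \<tau> by (simp add: mult_ac)
qed

lemma th34_diff:
  assumes "Im \<tau> > 0"
  shows "th3 \<tau> ^ 2 - th4 \<tau> ^ 2 = 2 * th2 (2 * \<tau>) ^ 2"
proof -
  have "th3 \<tau> ^ 2 - th4 \<tau> ^ 2 = (th3 \<tau> - th4 \<tau>) * (th3 \<tau> + th4 \<tau>)" by (simp add: power2_eq_square algebra_simps)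
  also have "\<dots> = 2 * (2 * th2 (2 * (2 * \<tau>)) * th3 (2 * (2 * \<tau>)))"
    unfolding th3_split[OF assms] th4_split[OF assms] by simp
  also have "\<dots> = 2 * th2 (2 * \<tau>) ^ 2" by (subst th2_double[symmetric]) (use assms in auto)
  finally show ?thesis .
qed

lemma th4_square:
  assumes "Im \<tau> > 0"
  shows "th4 \<tau> ^ 2 = th3 (2 * \<tau>) ^ 2 - th2 (2 * \<tau>) ^ 2"
proof -
  define s where "s = 2 * \<tau>"
  have s: "Im s > 0" and \<tau>: "\<tau> = s / 2" using assms by (simp_all add: s_def)
  have nz: "s \<noteq> 0" using s by auto
  have e: "2 * (- 1 / s) = - 1 / (s / 2)" using nz by simp
  have "th3 (- 1 / s) ^ 2 - th4 (- 1 / s) ^ 2 = 2 * th2 (- 1 / (s / 2)) ^ 2"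
    using th34_diff[OF Im_minus_inverse[OF s]] unfolding e .
  moreover have "th2 (- 1 / (s / 2)) ^ 2 = - \<i> * (s / 2) * th4 (s / 2) ^ 2"
    by (rule theta_squared_transform) (use s in simp)
  ultimately have "s * (\<i> * (th3 s ^ 2 - th2 s ^ 2)) = s * (\<i> * th4 (s / 2) ^ 2)"
    unfolding theta_squared_transform[OF s] by (simp add: algebra_simps)
  thus ?thesis using nz unfolding \<tau> by simp
qed

text \<open>th3^2 + th4^2 and th3^2 - th4^2 equal 2 th3(2\<tau>)^2 and 2 th2(2\<tau>)^2. Their
  product is the square of 2 th2(2\<tau>) th3(2\<tau>), and the latter is th2(\<tau>)^2 by
  \<open>th2_double\<close>.\<close>

theorem jacobi_identity:
  assumes "Im \<tau> > 0"
  shows "th3 \<tau> ^ 4 = th2 \<tau> ^ 4 + th4 \<tau> ^ 4"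
proof -
  have "th3 \<tau> ^ 4 - th4 \<tau> ^ 4 = (th3 \<tau> ^ 2 - th4 \<tau> ^ 2) * (th3 \<tau> ^ 2 - th4 \<tau> ^ 2 + 2 * th4 \<tau> ^ 2)"
    by algebra
  also have "\<dots> = (2 * th2 (2 * \<tau>) * th3 (2 * \<tau>)) ^ 2"
    unfolding th34_diff[OF assms] unfolding th4_square[OF assms] by algebra
  also have "\<dots> = (th2 \<tau> ^ 2) ^ 2" unfolding th2_double[OF assms] ..
  finally show ?thesis by (simp add: algebra_simps)
qed

text \<open>The nome maps the upper half-plane onto the punctured unit disc, so the evaluations
  agree there and, by continuity, at 0. This turns theta identities on the half-plane back into
  identities of integer power series.\<close>

lemma ev_nome_eqD:
  assumes "conv1 f" "conv1 g" "\<And>\<tau>. Im \<tau> > 0 \<Longrightarrow> ev f (nome \<tau>) = ev g (nome \<tau>)"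
  shows "f = g"
proof -
  have "ev f q = ev g q" if q: "q \<noteq> 0" "norm q < 1" for q
  proof -
    define \<tau> where "\<tau> = Ln q / (\<i> * pi)"
    have "nome \<tau> = q" using q by (simp add: nome_def \<tau>_def)
    moreover have "Im \<tau> = - ln (norm q) / pi" using q by (simp add: \<tau>_def Im_divide power2_eq_square)
    hence "Im \<tau> > 0" using q by (simp add: ln_less_zero divide_neg_pos)
    ultimately show ?thesis using assms(3)[of \<tau>] by simp
  qed
  hence "ev (f - g) q = 0" if "q \<noteq> 0" "norm q < 1" for q using that assms by (simp add: ev_diff)
  hence ev: "eventually (\<lambda>q. eval_fps (cfps (f - g)) q = 0) (at 0)"
    unfolding ev_def eventually_at by (intro exI[of _ 1]) auto
  have "cfps (f - g) = 0"
  proof -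
    have h: "eval_fps (cfps (f - g)) has_fps_expansion cfps (f - g)"
      using conv1_diff[OF assms(1,2)] unfolding conv1_def
      by (intro eval_fps_has_fps_expansion) (meson less_le_trans ereal_less(3) zero_less_one ereal_0_less_1)
    have "eval_fps (cfps (f - g)) 0 = 0"
    proof (rule ccontr)
      assume "eval_fps (cfps (f - g)) 0 \<noteq> 0"
      moreover have "isCont (eval_fps (cfps (f - g))) 0"
        using has_fps_expansion_imp_continuous[OF h] by simp
      hence "eval_fps (cfps (f - g)) \<midarrow>0\<rightarrow> eval_fps (cfps (f - g)) 0" by (simp add: isCont_def)
      moreover have "eval_fps (cfps (f - g)) \<midarrow>0\<rightarrow> 0" by (rule tendsto_eventually[OF ev])
      ultimately show False using LIM_unique by blast
    qed
    hence "eventually (\<lambda>q. eval_fps (cfps (f - g)) q = 0) (nhds 0)"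
      using ev by (simp add: eventually_nhds_conv_at)
    hence "eval_fps (cfps (f - g)) has_fps_expansion 0 \<longleftrightarrow> (\<lambda>_. 0 :: complex) has_fps_expansion 0"
      by (intro has_fps_expansion_cong refl)
    hence "eval_fps (cfps (f - g)) has_fps_expansion 0" by simp
    thus ?thesis by (rule fps_expansion_unique_complex[OF h])
  qed
  hence "cfps f = cfps g" by simp
  thus ?thesis by simp
qed

text \<open>This is \<open>th2_double\<close> at \<tau>/2; the exponential prefactors of
  \<open>th2\<close> match and cancel.\<close>

lemma psi_square: "psi ^ 2 = dil 2 psi * phi"
proof (rule ev_nome_eqD)
  fix \<tau> :: complex assume t: "Im \<tau> > 0"
  define s where "s = \<tau> / 2"
  have s: "Im s > 0" "2 * s = \<tau>" using t by (simp_all add: s_def)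
  have e: "exp (\<i> * pi * \<tau> / 4) = exp (\<i> * pi * s / 4) ^ 2"
    unfolding exp_double[symmetric] by (rule arg_cong[where f = exp]) (simp add: s_def)
  have n: "nome s ^ 2 = nome \<tau>" using nome_numeral[of "num.Bit0 num.One" s] s by simp
  have "4 * exp (\<i> * pi * s / 4) ^ 2 * ev psi (nome \<tau>) ^ 2 = 4 * exp (\<i> * pi * s / 4) ^ 2 * (ev psi (nome \<tau> ^ 2) * ev phi (nome \<tau>))"
    using th2_double[OF s(1)] unfolding s(2) th2_def th3_def e n power_mult_distrib by (simp add: mult_ac)
  hence "ev psi (nome \<tau>) ^ 2 = ev psi (nome \<tau> ^ 2) * ev phi (nome \<tau>)" by simp
  thus "ev (psi ^ 2) (nome \<tau>) = ev (dil 2 psi * phi) (nome \<tau>)"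
    using norm_nome[OF t] by (simp add: ev_mult ev_power ev_dil conv1_dil)
qed (auto intro!: conv1_add conv1_mult conv1_power conv1_dil conv1_alt)

lemma jacobi_fps: "phi ^ 4 = alt phi ^ 4 + 16 * (fps_X * dil 2 psi ^ 4)"
proof (rule ev_nome_eqD)
  fix \<tau> :: complex assume t: "Im \<tau> > 0"
  have e: "exp (\<i> * pi * \<tau> / 4) ^ 4 = nome \<tau>"
    unfolding nome_def using exp_of_nat_mult[of 4 "\<i> * pi * \<tau> / 4"] by simp
  have "ev phi (nome \<tau>) ^ 4 = 16 * (nome \<tau> * ev psi (nome \<tau> ^ 2) ^ 4) + ev phi (- nome \<tau>) ^ 4"
    using jacobi_identity[OF t] unfolding th2_def th3_def th4_def power_mult_distrib e by (simp add: mult_ac)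
  thus "ev (phi ^ 4) (nome \<tau>) = ev (alt phi ^ 4 + 16 * (fps_X * dil 2 psi ^ 4)) (nome \<tau>)"
    using norm_nome[OF t] by (simp add: ev_mult ev_power ev_dil conv1_dil ev_add ev_alt conv1_alt conv1_mult conv1_power)
qed (auto intro!: conv1_add conv1_mult conv1_power conv1_dil conv1_alt)

lemma phi_duplication_fps: "dil 2 (alt phi) ^ 2 = alt phi * phi"
proof (rule ev_nome_eqD)
  fix \<tau> :: complex assume t: "Im \<tau> > 0"
  have n2: "norm (nome \<tau> ^ 2) < 1" using norm_nome[OF t] by (simp add: norm_power power_less_one_iff)
  show "ev (dil 2 (alt phi) ^ 2) (nome \<tau>) = ev (alt phi * phi) (nome \<tau>)"
    using norm_nome[OF t] n2 phi_duplication[OF norm_nome[OF t]] by (simp add: ev_mult ev_power ev_dil conv1_dil ev_alt conv1_alt)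
qed (auto intro!: conv1_add conv1_mult conv1_power conv1_dil conv1_alt)

section \<open>Modular forms of level one\<close>

text \<open>The second form equals q f_1^24; the first one is the Eisenstein series of weight 4.\<close>
definition E4 :: "int fps" where "E4 = alt phi ^ 8 + 256 * (fps_X * psi ^ 8)"
definition Dl :: "int fps" where "Dl = fps_X * psi ^ 8 * alt phi ^ 16"

lemma conv1_E4 [simp, intro]: "conv1 E4" and conv1_Dl [simp, intro]: "conv1 Dl"
  unfolding E4_def Dl_def by (auto intro!: conv1_add conv1_mult conv1_power conv1_alt)

text \<open>The parameter at the cusp for level one: it is invariant under \<tau> + 1, whereas its
  square root \<open>nome\<close> is invariant only under \<tau> + 2.\<close>

definition qexp :: "complex \<Rightarrow> complex" where "qexp \<tau> = exp (2 * \<i> * pi * \<tau>)"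

lemma qexp_nome: "qexp \<tau> = nome \<tau> ^ 2" "qexp \<tau> = nome (2 * \<tau>)"
  by (simp_all add: qexp_def nome_def exp_double[symmetric] mult_ac)

lemma norm_qexp: "Im \<tau> > 0 \<Longrightarrow> norm (qexp \<tau>) < 1"
  by (simp add: qexp_def)

lemma th2_power8: "th2 \<tau> ^ 8 = 256 * (qexp \<tau> * ev psi (qexp \<tau>) ^ 8)"
proof -
  have "exp (\<i> * pi * \<tau> / 4) ^ 8 = qexp \<tau>"
    unfolding qexp_def using exp_of_nat_mult[of 8 "\<i> * pi * \<tau> / 4"] by (simp add: mult_ac)
  thus ?thesis unfolding th2_def power_mult_distrib qexp_nome(1)[symmetric] by simp
qed

lemma ev_alt_phi_qexp: "Im \<tau> > 0 \<Longrightarrow> ev (alt phi) (qexp \<tau>) = th4 (2 * \<tau>)"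
  using norm_qexp[of \<tau>] by (simp add: ev_alt th4_def qexp_nome(2))

lemma ev_E4:
  assumes "Im \<tau> > 0"
  shows "ev E4 (qexp \<tau>) = th3 \<tau> ^ 4 * th4 \<tau> ^ 4 + th2 \<tau> ^ 8"
proof -
  have "ev E4 (qexp \<tau>) = th4 (2 * \<tau>) ^ 8 + th2 \<tau> ^ 8"
    unfolding E4_def th2_power8 using norm_qexp[OF assms] ev_alt_phi_qexp[OF assms]
    by (simp add: ev_add ev_mult ev_power conv1_mult conv1_power conv1_alt)
  also have "th4 (2 * \<tau>) ^ 8 = (th4 (2 * \<tau>) ^ 2) ^ 4" by simp
  finally show ?thesis unfolding th4_double[OF assms] power_mult_distrib .
qed

lemma ev_Dl:
  assumes "Im \<tau> > 0"
  shows "256 * ev Dl (qexp \<tau>) = (th2 \<tau> * th3 \<tau> * th4 \<tau>) ^ 8"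
proof -
  have "256 * ev Dl (qexp \<tau>) = th2 \<tau> ^ 8 * th4 (2 * \<tau>) ^ 16"
    unfolding Dl_def th2_power8 using norm_qexp[OF assms] ev_alt_phi_qexp[OF assms]
    by (simp add: ev_add ev_mult ev_power conv1_mult conv1_power conv1_alt)
  also have "th4 (2 * \<tau>) ^ 16 = (th4 (2 * \<tau>) ^ 2) ^ 8" by simp
  finally show ?thesis unfolding th4_double[OF assms] power_mult_distrib by simp
qed

theorem E4_transform:
  assumes "Im \<tau> > 0"
  shows "ev E4 (qexp (- 1 / \<tau>)) = \<tau> ^ 4 * ev E4 (qexp \<tau>)"
proof -
  have p4: "x ^ 4 = (x ^ 2) ^ 2" and p8: "x ^ 8 = (x ^ 2) ^ 4" for x :: complex by simp_all
  have i4: "(- \<i> * \<tau>) ^ 4 = \<tau> ^ 4" by (simp add: power_mult_distrib)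
  have i2: "(- \<i> * \<tau>) ^ 2 = - (\<tau> ^ 2)" by (simp add: power_mult_distrib)
  have "ev E4 (qexp (- 1 / \<tau>)) = (th3 (- 1 / \<tau>) ^ 2) ^ 2 * (th4 (- 1 / \<tau>) ^ 2) ^ 2 + (th2 (- 1 / \<tau>) ^ 2) ^ 4"
    unfolding ev_E4[OF Im_minus_inverse[OF assms]] by simp
  also have "\<dots> = \<tau> ^ 4 * (th3 \<tau> ^ 4 * th2 \<tau> ^ 4 + th4 \<tau> ^ 8)"
    unfolding theta_squared_transform[OF assms] power_mult_distrib[of "- \<i> * \<tau>"] i4 i2 by (simp add: algebra_simps)
  \<comment> \<open>With a = th2^4 and b = th4^4, hence th3^4 = a + b, both sides are a^2 + a b +
    b^2.\<close>
  also have "th3 \<tau> ^ 4 * th2 \<tau> ^ 4 + th4 \<tau> ^ 8 = th3 \<tau> ^ 4 * th4 \<tau> ^ 4 + th2 \<tau> ^ 8"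
    unfolding jacobi_identity[OF assms] by algebra
  finally show ?thesis unfolding ev_E4[OF assms] .
qed

theorem Dl_transform:
  assumes "Im \<tau> > 0"
  shows "ev Dl (qexp (- 1 / \<tau>)) = \<tau> ^ 12 * ev Dl (qexp \<tau>)"
proof -
  define P where "P = (\<lambda>\<tau>. th2 \<tau> ^ 2 * th3 \<tau> ^ 2 * th4 \<tau> ^ 2)"
  have e: "(th2 \<tau> * th3 \<tau> * th4 \<tau>) ^ 8 = P \<tau> ^ 4" for \<tau> unfolding P_def by (simp add: power_mult_distrib)
  have i12: "(- \<i> * \<tau>) ^ 12 = \<tau> ^ 12"
  proof -
    have "(- \<i> * \<tau>) ^ 12 = ((- \<i> * \<tau>) ^ 4) ^ 3" by simp
    also have "(- \<i> * \<tau>) ^ 4 = \<tau> ^ 4" by (simp add: power_mult_distrib)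
    finally show ?thesis by simp
  qed
  have "256 * ev Dl (qexp (- 1 / \<tau>)) = P (- 1 / \<tau>) ^ 4"
    unfolding ev_Dl[OF Im_minus_inverse[OF assms]] e ..
  also have "P (- 1 / \<tau>) = (- \<i> * \<tau>) ^ 3 * P \<tau>"
    unfolding P_def theta_squared_transform[OF assms] by (simp add: power3_eq_cube algebra_simps)
  also have "((- \<i> * \<tau>) ^ 3 * P \<tau>) ^ 4 = (- \<i> * \<tau>) ^ 12 * P \<tau> ^ 4"
    by (simp add: power_mult_distrib)
  also have "\<dots> = \<tau> ^ 12 * (256 * ev Dl (qexp \<tau>))"
    unfolding i12 ev_Dl[OF assms] e ..
  finally show ?thesis by simp
qed

section \<open>Nonvanishing on the disc, and functions invariant under the modular group\<close>

lemma th4_nonzero: "Im \<tau> > 0 \<Longrightarrow> th4 \<tau> \<noteq> 0"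
  unfolding th4_def by (rule gauss_product(2)[OF norm_nome])

lemma th2_nonzero:
  assumes "Im \<tau> > 0"
  shows "th2 \<tau> \<noteq> 0"
proof
  assume "th2 \<tau> = 0"
  hence "th4 (- 1 / \<tau>) = 0" using th4_transform[OF assms] by simp
  thus False using th4_nonzero[OF Im_minus_inverse[OF assms]] by simp
qed

text \<open>The product formula gives th4 \<noteq> 0, the transformation law carries this over to
  th2, and th2 is \<open>psi\<close> up to an exponential factor. Only q = 0 is not a value of
  \<open>qexp\<close>.\<close>

lemma ev_psi_nonzero:
  assumes "norm q < 1"
  shows "ev psi q \<noteq> 0"
proof (cases "q = 0")
  case True
  have "ev psi 0 = of_int (fps_nth psi 0)" by (simp add: ev_def eval_fps_at_0)
  thus ?thesis using True by (simp add: psi_def)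
next
  case False
  define \<tau> where "\<tau> = Ln q / (2 * \<i> * pi)"
  have q: "qexp \<tau> = q" using False by (simp add: qexp_def \<tau>_def)
  have "Im \<tau> = - ln (norm q) / (2 * pi)" using False by (simp add: \<tau>_def Im_divide power2_eq_square)
  hence t: "Im \<tau> > 0" using False assms by (simp add: ln_less_zero divide_neg_pos)
  show ?thesis
  proof
    assume "ev psi q = 0"
    hence "th2 \<tau> ^ 8 = 0" unfolding th2_power8 q by simp
    thus False using th2_nonzero[OF t] by simp
  qed
qed

lemma ev_alt_phi_nonzero: "norm q < 1 \<Longrightarrow> ev (alt phi) q \<noteq> 0"
  using gauss_product(2)[of q] by (simp add: ev_alt)

lemma qexp_add_int: "qexp (\<tau> + of_int k) = qexp \<tau>"
proof -
  have "exp (2 * \<i> * pi * of_int k) = 1"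
    unfolding exp_eq_1 by (auto intro!: exI[of _ k])
  thus ?thesis by (simp add: qexp_def distrib_left exp_add)
qed

lemma qexp_mult_nat: "qexp (of_nat n * \<tau>) = qexp \<tau> ^ n"
  by (simp add: qexp_def exp_of_nat_mult[symmetric] mult_ac)

lemma qexp_surj:
  assumes "q \<noteq> 0" "norm q < 1"
  obtains \<tau> where "Im \<tau> > 0" "qexp \<tau> = q"
proof -
  define \<tau> where "\<tau> = Ln q / (2 * \<i> * pi)"
  have q: "qexp \<tau> = q" using assms by (simp add: qexp_def \<tau>_def)
  have "Im \<tau> = - ln (norm q) / (2 * pi)" using assms by (simp add: \<tau>_def Im_divide power2_eq_square)
  hence t: "Im \<tau> > 0" using assms by (simp add: ln_less_zero divide_neg_pos)
  show ?thesis using that q t by blast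
qed

text \<open>A weak form of reduction to the fundamental domain. If Im \<tau> < 1/2, and |Re \<tau>|
  \<le> 1/2 after a translation, then |\<tau>|^2 < 1/2, so the inversion at least doubles the
  imaginary part. The induction is on the number of doublings.\<close>

lemma reduce_to_half:
  fixes h :: "complex \<Rightarrow> complex"
  assumes inv: "\<And>\<tau>. Im \<tau> > 0 \<Longrightarrow> h (qexp (- 1 / \<tau>)) = h (qexp \<tau>)"
  assumes "Im \<tau> > 0"
  shows "\<exists>\<tau>'. Im \<tau>' \<ge> 1/2 \<and> h (qexp \<tau>') = h (qexp \<tau>)"
proof -
  have "\<exists>\<tau>'. Im \<tau>' \<ge> 1/2 \<and> h (qexp \<tau>') = h (qexp \<tau>)" if "Im \<tau> > 0" "Im \<tau> * 2 ^ n \<ge> 1/2" for n \<tau>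
    using that
  proof (induction n arbitrary: \<tau>)
    case (Suc n)
    show ?case
    proof (cases "Im \<tau> \<ge> 1/2")
      case False
      define s where "s = \<tau> + of_int (- round (Re \<tau>))"
      have qs: "qexp s = qexp \<tau>" unfolding s_def by (rule qexp_add_int)
      have Is: "Im s = Im \<tau>" unfolding s_def by simp
      have "\<bar>Re s\<bar> \<le> 1/2" unfolding s_def using of_int_round_abs_le[of "Re \<tau>"] by (simp add: abs_minus_commute)
      hence "(Re s)\<^sup>2 \<le> (1/2)\<^sup>2" by (metis abs_le_square_iff abs_of_nonneg divide_nonneg_nonneg zero_le_numeral zero_le_one)
      moreover have "(Im s)\<^sup>2 < (1/2)\<^sup>2" using False Suc.prems Is by (intro power_strict_mono) auto
      ultimately have d: "(Re s)\<^sup>2 + (Im s)\<^sup>2 < 1/2" by (simp add: power2_eq_square)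
      have dpos: "(Re s)\<^sup>2 + (Im s)\<^sup>2 > 0" using Suc.prems Is by (simp add: sum_power2_gt_zero_iff)
      have "Im (- 1 / s) = Im s / ((Re s)\<^sup>2 + (Im s)\<^sup>2)" by (simp add: Im_divide)
      also have "\<dots> \<ge> 2 * Im \<tau>"
      proof -
        have "2 * Im s * ((Re s)\<^sup>2 + (Im s)\<^sup>2) \<le> 2 * Im s * (1/2)"
          using d Suc.prems Is by (intro mult_left_mono) auto
        thus ?thesis using dpos Is by (simp add: pos_le_divide_eq)
      qed
      finally have ge: "Im (- 1 / s) \<ge> 2 * Im \<tau>" .
      have "1/2 \<le> 2 * Im \<tau> * 2 ^ n" using Suc.prems by simp
      also have "\<dots> \<le> Im (- 1 / s) * 2 ^ n" using ge by (intro mult_right_mono) auto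
      finally have "\<exists>\<tau>'. Im \<tau>' \<ge> 1/2 \<and> h (qexp \<tau>') = h (qexp (- 1 / s))"
        using ge Suc.prems by (intro Suc.IH) auto
      moreover have "h (qexp (- 1 / s)) = h (qexp \<tau>)" using inv[of s] Is Suc.prems qs by simp
      ultimately show ?thesis by simp
    qed auto
  qed auto
  moreover obtain n where "1 / (2 * Im \<tau>) < 2 ^ n" using real_arch_pow[of 2 "1 / (2 * Im \<tau>)"] by auto
  hence "Im \<tau> * 2 ^ n \<ge> 1/2" using assms by (simp add: field_simps)
  ultimately show ?thesis using assms by blast
qed

text \<open>Im \<tau> \<ge> 1/2 corresponds to |q| \<le> exp(-pi) < 1. By
  \<open>reduce_to_half\<close> this compact disc already carries all values of h, so |h| attains
  its maximum over the open unit disc and the maximum modulus principle applies.\<close>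

lemma modular_function_constant:
  assumes hol: "h holomorphic_on ball 0 1"
    and inv: "\<And>\<tau>. Im \<tau> > 0 \<Longrightarrow> h (qexp (- 1 / \<tau>)) = h (qexp \<tau>)"
    and q: "norm q < 1"
  shows "h q = h 0"
proof -
  define r where "r = exp (- pi)"
  have r: "0 < r" "r < 1" unfolding r_def by auto
  have sub: "cball 0 r \<subseteq> ball (0::complex) 1" using r by auto
  have "\<exists>x\<in>cball 0 r. \<forall>y\<in>cball 0 r. norm (h y) \<le> norm (h x)"
  proof (rule continuous_attains_sup)
    show "continuous_on (cball 0 r) (\<lambda>x. norm (h x))"
      using holomorphic_on_imp_continuous_on[OF hol] sub by (intro continuous_on_norm) (rule continuous_on_subset)
  qed (use r in auto)
  then obtain q0 where q0: "q0 \<in> cball 0 r" "\<And>y. y \<in> cball 0 r \<Longrightarrow> norm (h y) \<le> norm (h q0)" by blast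
  have "norm (h y) \<le> norm (h q0)" if y: "y \<in> ball 0 1" for y
  proof (cases "y = 0")
    case True
    thus ?thesis using q0(2)[of 0] r by simp
  next
    case False
    then obtain \<tau> where t: "Im \<tau> > 0" "qexp \<tau> = y" using y by (auto intro: qexp_surj[of y])
    then obtain \<tau>' where t': "Im \<tau>' \<ge> 1/2" "h (qexp \<tau>') = h y" using reduce_to_half[of h \<tau>] inv by auto
    have "norm (qexp \<tau>') = exp (- (2 * pi * Im \<tau>'))" by (simp add: qexp_def)
    also have "\<dots> \<le> r" unfolding r_def using t'(1) by simp
    finally have "norm (h (qexp \<tau>')) \<le> norm (h q0)" by (intro q0(2)) simp
    thus ?thesis using t' by simp
  qed
  hence "h constant_on ball 0 1"
    using q0(1) sub by (intro maximum_modulus_principle[OF hol, of "ball 0 1" q0]) auto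
  thus ?thesis using q unfolding constant_on_def by (metis centre_in_ball mem_ball_0 zero_less_one)
qed

text \<open>Only the inversion is required: translation invariance is automatic for a function of
  \<open>qexp \<tau>\<close>, and being a power series in it expresses holomorphy at the
  cusp.\<close>

definition modular :: "nat \<Rightarrow> int fps \<Rightarrow> bool" where
  "modular k f \<longleftrightarrow> conv1 f \<and> (\<forall>\<tau>. Im \<tau> > 0 \<longrightarrow> ev f (qexp (- 1 / \<tau>)) = \<tau> ^ k * ev f (qexp \<tau>))"

lemma modular_E4: "modular 4 E4" and modular_Dl: "modular 12 Dl"
  unfolding modular_def using E4_transform Dl_transform conv1_E4 conv1_Dl by blast+

lemma modular_mult: "modular k f \<Longrightarrow> modular l g \<Longrightarrow> modular (k + l) (f * g)"
  unfolding modular_def using norm_qexp Im_minus_inverse by (auto simp: ev_mult power_add conv1_mult simp del: minus_divide_left)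

lemma modular_power: "modular k f \<Longrightarrow> modular (k * n) (f ^ n)"
proof (induction n)
  case 0
  show ?case by (simp add: modular_def)
next
  case (Suc n)
  thus ?case using modular_mult[of k f "k * n" "f ^ n"] by simp
qed

lemma modular_add: "modular k f \<Longrightarrow> modular k g \<Longrightarrow> modular k (f + g)"
  unfolding modular_def using norm_qexp Im_minus_inverse by (auto simp: ev_add conv1_add distrib_left simp del: minus_divide_left)

lemma modular_diff: "modular k f \<Longrightarrow> modular k g \<Longrightarrow> modular k (f - g)"
  unfolding modular_def using norm_qexp Im_minus_inverse by (auto simp: ev_diff conv1_diff right_diff_distrib simp del: minus_divide_left)

lemma modular_0: "modular k 0" by (simp add: modular_def)

lemma modular_cmult: "modular k f \<Longrightarrow> modular k (of_int c * f)"
  unfolding modular_def using norm_qexp Im_minus_inverse by (auto simp: ev_mult conv1_mult simp del: minus_divide_left)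

lemma modular_sum: "(\<And>i. i \<in> I \<Longrightarrow> modular k (f i)) \<Longrightarrow> modular k (\<Sum>i\<in>I. f i)"
  by (induction I rule: infinite_finite_induct) (auto simp: modular_add modular_0)

text \<open>The quotient f^3/\<Delta>^m has weight zero and vanishes at infinity.\<close>
lemma modular_vanishing:
  assumes f: "modular (4 * m) f" and van: "\<And>n. n \<le> m div 3 \<Longrightarrow> fps_nth f n = 0"
  shows "f = 0"
proof -
  define M where "M = m div 3"
  \<comment> \<open>f^3 vanishes at q = 0 to order at least 3(M+1), and \<Delta>^m to order m, as
    \<Delta> = q d with d free of zeros on the disc. Hence f^3/\<Delta>^m extends over 0 with a zero
    of order at least e > 0.\<close>
  define e where "e = 3 * Suc M - m"
  have e: "m + e = 3 * Suc M" "e > 0" unfolding e_def M_def by auto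
  define g where "g = fps_shift (Suc M) f"
  have fg: "f = fps_X ^ Suc M * g"
    unfolding g_def using van by (intro fps_ext) (auto simp: fps_X_power_mult_nth M_def simp del: power_Suc)
  have c1: "conv1 f" using f by (simp add: modular_def)
  have g1: "conv1 g"
  proof -
    have "cfps g = fps_shift (Suc M) (cfps f)" by (simp add: fps_eq_iff g_def)
    thus ?thesis using c1 unfolding conv1_def by simp
  qed
  define d where "d = psi ^ 8 * alt phi ^ 16"
  have d1: "conv1 d" unfolding d_def by (auto intro!: conv1_mult conv1_power conv1_alt)
  have dnz: "ev d q \<noteq> 0" if "norm q < 1" for q
    unfolding d_def using that ev_psi_nonzero ev_alt_phi_nonzero by (simp add: ev_mult ev_power conv1_power conv1_alt)
  have Dd: "ev Dl q = q * ev d q" if "norm q < 1" for q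
    using that unfolding Dl_def d_def by (simp add: ev_mult ev_power conv1_power conv1_mult conv1_alt)
  have fq: "ev f q = q ^ Suc M * ev g q" if "norm q < 1" for q
    using that g1 by (simp add: fg ev_mult ev_power conv1_mult conv1_power)
  define h where "h = (\<lambda>q. q ^ e * ev g q ^ 3 / ev d q ^ m)"
  have hq: "h q = ev f q ^ 3 / ev Dl q ^ m" if "norm q < 1" "q \<noteq> 0" for q
  proof -
    have "ev f q ^ 3 = q ^ (m + e) * ev g q ^ 3"
      unfolding fq[OF that(1)] e(1) by (simp only: power_mult_distrib power_mult[symmetric] mult.commute)
    thus ?thesis using that dnz[OF that(1)] unfolding h_def Dd[OF that(1)] by (simp add: power_mult_distrib power_add)
  qed
  have "h q = h 0" if "norm q < 1" for q
  proof (rule modular_function_constant[OF _ _ that])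
    show "h holomorphic_on ball 0 1"
      unfolding h_def using dnz by (intro holomorphic_intros ev_holomorphic g1 d1) auto
    fix \<tau> :: complex assume t: "Im \<tau> > 0"
    have t': "Im (- 1 / \<tau>) > 0" by (rule Im_minus_inverse[OF t])
    have nz: "\<tau> \<noteq> 0" using t by auto
    have q0: "qexp x \<noteq> 0" for x by (simp add: qexp_def)
    have a: "ev f (qexp (- 1 / \<tau>)) = \<tau> ^ (4 * m) * ev f (qexp \<tau>)" using f t unfolding modular_def by blast
    have "h (qexp (- 1 / \<tau>)) = (\<tau> ^ (4 * m)) ^ 3 * ev f (qexp \<tau>) ^ 3 / ((\<tau> ^ 12) ^ m * ev Dl (qexp \<tau>) ^ m)"
      unfolding hq[OF norm_qexp[OF t'] q0] a Dl_transform[OF t] power_mult_distrib ..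
    also have "(\<tau> ^ (4 * m)) ^ 3 = (\<tau> ^ 12) ^ m" unfolding power_mult[symmetric] by (simp add: mult_ac)
    also have "(\<tau> ^ 12) ^ m * ev f (qexp \<tau>) ^ 3 / ((\<tau> ^ 12) ^ m * ev Dl (qexp \<tau>) ^ m) = ev f (qexp \<tau>) ^ 3 / ev Dl (qexp \<tau>) ^ m"
      using nz by simp
    finally show "h (qexp (- 1 / \<tau>)) = h (qexp \<tau>)" unfolding hq[OF norm_qexp[OF t] q0] .
  qed
  moreover have "h 0 = 0" using e(2) by (simp add: h_def)
  ultimately have h0: "h q = 0" if "norm q < 1" for q using that by simp
  show ?thesis
  proof (rule ev_nome_eqD[OF c1])
    fix \<tau> :: complex assume t: "Im \<tau> > 0"
    have n: "norm (nome \<tau>) < 1" "nome \<tau> \<noteq> 0" using norm_nome[OF t] by (simp_all add: nome_def)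
    have "ev f (nome \<tau>) ^ 3 / ev Dl (nome \<tau>) ^ m = 0" using hq[OF n] h0[OF n(1)] by simp
    moreover have "ev Dl (nome \<tau>) \<noteq> 0" using Dd[OF n(1)] dnz[OF n(1)] n(2) by simp
    ultimately show "ev f (nome \<tau>) = ev 0 (nome \<tau>)" by simp
  qed auto
qed

section \<open>The full modular group and the Hecke operators\<close>

lemma Im_moebius:
  fixes a b c d :: int
  assumes "a * d - b * c = 1" "Im \<tau> > 0"
  shows "of_int c * \<tau> + of_int d \<noteq> 0" "Im ((of_int a * \<tau> + of_int b) / (of_int c * \<tau> + of_int d)) > 0"
proof -
  show nz: "of_int c * \<tau> + of_int d \<noteq> 0"
  proof
    assume 0: "of_int c * \<tau> + of_int d = 0"
    hence "Im (of_int c * \<tau> + of_int d) = 0" by simp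
    hence "c = 0" using assms by simp
    moreover from this 0 have "d = 0" by simp
    ultimately show False using assms by simp
  qed
  have "Im ((of_int a * \<tau> + of_int b) / (of_int c * \<tau> + of_int d)) = of_int (a * d - b * c) * Im \<tau> / (norm (of_int c * \<tau> + of_int d))\<^sup>2"
    by (simp add: Im_divide cmod_power2 algebra_simps)
  thus "Im ((of_int a * \<tau> + of_int b) / (of_int c * \<tau> + of_int d)) > 0" using assms nz by simp
qed

text \<open>Euclidean algorithm on the first column: subtracting \<open>a div c\<close> translations
  and inverting replaces c by a mod c. The base case c = 0 includes minus the identity matrix, whose
  sign disappears in even weight.\<close>

lemma modular_SL2:
  fixes a b c d :: int
  assumes f: "modular k f" and "even k" and "a * d - b * c = 1" and "Im \<tau> > 0"
  shows "ev f (qexp ((of_int a * \<tau> + of_int b) / (of_int c * \<tau> + of_int d))) = (of_int c * \<tau> + of_int d) ^ k * ev f (qexp \<tau>)"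
  using assms(3)
proof (induction "nat \<bar>c\<bar>" arbitrary: a b c d rule: less_induct)
  case less
  show ?case
  proof (cases "c = 0")
    case True
    hence ad: "a * d = 1" using less.prems by simp
    hence "(a = 1 \<and> d = 1) \<or> (a = -1 \<and> d = -1)" by (metis zmult_eq_1_iff)
    thus ?thesis
    proof
      assume "a = 1 \<and> d = 1"
      thus ?thesis using True by (simp add: qexp_add_int)
    next
      assume ad: "a = -1 \<and> d = -1"
      have "(of_int a * \<tau> + of_int b) / (of_int c * \<tau> + of_int d) = \<tau> + of_int (- b)"
        using True ad by simp
      hence "qexp ((of_int a * \<tau> + of_int b) / (of_int c * \<tau> + of_int d)) = qexp \<tau>" by (simp only: qexp_add_int)
      thus ?thesis using True ad \<open>even k\<close> by simp
    qed
  next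
    case False
    define u where "u = a div c"
    define a' where "a' = a - u * c"
    define b' where "b' = b - u * d"
    have a': "a' = a mod c" unfolding a'_def u_def by (simp add: minus_div_mult_eq_mod)
    have less': "nat \<bar>a'\<bar> < nat \<bar>c\<bar>" unfolding a' using False by (simp add: abs_mod_less)
    have det: "(- c) * b' - (- d) * a' = 1" using less.prems unfolding a'_def b'_def by (simp add: algebra_simps)
    note M = Im_moebius[OF det \<open>Im \<tau> > 0\<close>]
    define w where "w = (of_int (- c) * \<tau> + of_int (- d)) / (of_int a' * \<tau> + of_int b')"
    have IH: "ev f (qexp w) = (of_int a' * \<tau> + of_int b') ^ k * ev f (qexp \<tau>)"
      unfolding w_def by (rule less.hyps[OF less' det])
    have cd: "of_int c * \<tau> + of_int d \<noteq> 0" by (rule Im_moebius(1)[OF less.prems \<open>Im \<tau> > 0\<close>])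
    have "(of_int a * \<tau> + of_int b) / (of_int c * \<tau> + of_int d) = - 1 / w + of_int u"
    proof -
      have "- 1 / w = (of_int a' * \<tau> + of_int b') / (of_int c * \<tau> + of_int d)"
      proof -
        have wn: "of_int (- c) * \<tau> + of_int (- d) = - (of_int c * \<tau> + of_int d)" by simp
        have "- 1 / (- x / y) = y / x" for x y :: complex by simp
        thus ?thesis unfolding w_def wn .
      qed
      also have "of_int a' * \<tau> + of_int b' = of_int a * \<tau> + of_int b - of_int u * (of_int c * \<tau> + of_int d)"
        unfolding a'_def b'_def by (simp add: algebra_simps)
      also have "\<dots> / (of_int c * \<tau> + of_int d) = (of_int a * \<tau> + of_int b) / (of_int c * \<tau> + of_int d) - of_int u"
        using cd by (simp add: diff_divide_distrib)
      finally show ?thesis by simp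
    qed
    hence "ev f (qexp ((of_int a * \<tau> + of_int b) / (of_int c * \<tau> + of_int d))) = ev f (qexp (- 1 / w))"
      by (simp only: qexp_add_int)
    also have "\<dots> = w ^ k * ev f (qexp w)" using f M(2) unfolding modular_def w_def by blast
    also have "\<dots> = (w * (of_int a' * \<tau> + of_int b')) ^ k * ev f (qexp \<tau>)" unfolding IH power_mult_distrib by simp
    also have "w * (of_int a' * \<tau> + of_int b') = - (of_int c * \<tau> + of_int d)"
    proof -
      have "(- x / y) * y = - x" if "y \<noteq> 0" for x y :: complex using that by simp
      from this[OF M(1), of "of_int c * \<tau> + of_int d"] show ?thesis unfolding w_def by simp
    qed
    finally show ?thesis using \<open>even k\<close> by (simp only: power_minus_even)
  qed
qed

text \<open>For k = 0 the truncated exponent does not give the Hecke operator of weight zero.\<close>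
definition hecke :: "nat \<Rightarrow> nat \<Rightarrow> int fps \<Rightarrow> int fps" where
  "hecke p k f = Abs_fps (\<lambda>n. fps_nth f (p * n)) + of_int (int p ^ (k - 1)) * dil p f"

text \<open>The p translates multiply the p-th root of \<open>qexp \<tau>\<close> by all p-th roots
  of unity, whose sum removes the exponents not divisible by p.\<close>

lemma U_sums:
  assumes f: "conv1 f" and p: "p > 0" and t: "Im \<tau> > 0"
  shows "(\<lambda>n. of_int (fps_nth f (p * n)) * qexp \<tau> ^ n) sums ((\<Sum>j<p. ev f (qexp ((\<tau> + of_nat j) / of_nat p))) / of_nat p)"
proof -
  define Q where "Q = qexp (\<tau> / of_nat p)"
  have Qp: "Q ^ p = qexp \<tau>" unfolding Q_def qexp_mult_nat[symmetric] using p by simp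
  have qj: "qexp ((\<tau> + of_nat j) / of_nat p) = Q * cis (2 * pi * real j / real p)" for j
    unfolding Q_def qexp_def cis_conv_exp exp_add[symmetric] by (rule arg_cong[where f = exp]) (simp add: add_divide_distrib distrib_left mult_ac)
  have Imj: "Im ((\<tau> + of_nat j) / of_nat p) > 0" for j using t p by simp
  have "(\<lambda>n. \<Sum>j<p. of_int (fps_nth f n) * qexp ((\<tau> + of_nat j) / of_nat p) ^ n) sums (\<Sum>j<p. ev f (qexp ((\<tau> + of_nat j) / of_nat p)))"
    by (intro sums_sum ev_sums f norm_qexp Imj)
  also have "(\<lambda>n. \<Sum>j<p. of_int (fps_nth f n) * qexp ((\<tau> + of_nat j) / of_nat p) ^ n)
     = (\<lambda>n. if p dvd n then of_int (fps_nth f n) * Q ^ n * of_nat p else 0)"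
  proof
    fix n
    have "(\<Sum>j<p. of_int (fps_nth f n) * qexp ((\<tau> + of_nat j) / of_nat p) ^ n) = of_int (fps_nth f n) * Q ^ n * (\<Sum>j<p. cis (2 * pi * of_int (int n) * real j / real p))"
      unfolding qj power_mult_distrib Complex.DeMoivre sum_distrib_left by (simp add: mult_ac)
    also have "\<dots> = (if p dvd n then of_int (fps_nth f n) * Q ^ n * of_nat p else 0)"
      unfolding sum_roots_unity_power[OF p] by simp
    finally show "(\<Sum>j<p. of_int (fps_nth f n) * qexp ((\<tau> + of_nat j) / of_nat p) ^ n) = (if p dvd n then of_int (fps_nth f n) * Q ^ n * of_nat p else 0)" .
  qed
  finally have "(\<lambda>n. (\<lambda>n. if p dvd n then of_int (fps_nth f n) * Q ^ n * of_nat p else 0) (p * n)) sums (\<Sum>j<p. ev f (qexp ((\<tau> + of_nat j) / of_nat p)))"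
    by (subst sums_mono_reindex) (use p in \<open>auto simp: strict_mono_def elim!: dvdE\<close>)
  hence "(\<lambda>n. of_int (fps_nth f (p * n)) * qexp \<tau> ^ n * of_nat p) sums (\<Sum>j<p. ev f (qexp ((\<tau> + of_nat j) / of_nat p)))"
    by (simp add: power_mult Qp)
  from sums_divide[OF this, of "of_nat p"] show ?thesis using p by simp
qed

lemma conv1_U:
  assumes "conv1 f" "p > 0"
  shows "conv1 (Abs_fps (\<lambda>n. fps_nth f (p * n)))"
  unfolding conv1_def fps_conv_radius_def
proof (rule conv_radius_geI_ex')
  fix r :: real assume r: "0 < r" "ereal r < 1"
  then obtain \<tau> where t: "Im \<tau> > 0" "qexp \<tau> = of_real r" by (auto intro: qexp_surj[of "of_real r"])
  from U_sums[OF assms t(1)] show "summable (\<lambda>n. fps_nth (cfps (Abs_fps (\<lambda>n. fps_nth f (p * n)))) n * of_real r ^ n)"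
    unfolding t(2) by (auto simp: sums_iff)
qed

lemma ev_hecke:
  assumes f: "conv1 f" and p: "p > 0" and t: "Im \<tau> > 0"
  shows "ev (hecke p k f) (qexp \<tau>) = (\<Sum>j<p. ev f (qexp ((\<tau> + of_nat j) / of_nat p))) / of_nat p + of_nat p ^ (k - 1) * ev f (qexp (of_nat p * \<tau>))"
proof -
  have U: "ev (Abs_fps (\<lambda>n. fps_nth f (p * n))) (qexp \<tau>) = (\<Sum>j<p. ev f (qexp ((\<tau> + of_nat j) / of_nat p))) / of_nat p"
    using ev_sums[OF conv1_U[OF f p] norm_qexp[OF t]] U_sums[OF f p t] by (simp add: sums_iff)
  have "ev (hecke p k f) (qexp \<tau>) = ev (Abs_fps (\<lambda>n. fps_nth f (p * n))) (qexp \<tau>) + ev (of_int (int p ^ (k - 1)) * dil p f) (qexp \<tau>)"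
    unfolding hecke_def by (rule ev_add[OF conv1_U[OF f p] conv1_mult[OF conv1_const(4) conv1_dil[OF f p]] norm_qexp[OF t]])
  also have "ev (of_int (int p ^ (k - 1)) * dil p f) (qexp \<tau>) = ev (of_int (int p ^ (k - 1))) (qexp \<tau>) * ev (dil p f) (qexp \<tau>)"
    by (rule ev_mult[OF conv1_const(4) conv1_dil[OF f p] norm_qexp[OF t]])
  also have "ev (of_int (int p ^ (k - 1))) (qexp \<tau>) = of_nat p ^ (k - 1)" unfolding ev_const by simp
  also have "ev (dil p f) (qexp \<tau>) = ev f (qexp (of_nat p * \<tau>))" unfolding qexp_mult_nat by (rule ev_dil[OF f p norm_qexp[OF t]])
  finally show ?thesis unfolding U .
qed

lemma conv1_hecke: "conv1 f \<Longrightarrow> p > 0 \<Longrightarrow> conv1 (hecke p k f)"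
  unfolding hecke_def by (intro conv1_add conv1_mult conv1_U conv1_dil conv1_const)

text \<open>The inversion permutes the Hecke terms at (\<tau>+j)/p with j \<noteq> 0 by sending j to
  -1/j modulo p; \<sigma> is this involution on representatives.\<close>

lemma neg_inverse_mod_prime:
  fixes p :: nat
  assumes "prime p"
  obtains \<sigma> where "\<And>j. j \<in> {1..<p} \<Longrightarrow> \<sigma> j \<in> {1..<p} \<and> p dvd j * \<sigma> j + 1 \<and> \<sigma> (\<sigma> j) = j"
proof -
  have ex: "\<exists>j'\<in>{1..<p}. p dvd j * j' + 1" if j: "j \<in> {1..<p}" for j
  proof -
    have "\<not> p dvd j" using j by (auto dest: dvd_imp_le)
    hence "coprime p j" using assms by (rule prime_imp_coprime[rotated])
    hence "coprime j p" by (simp add: coprime_commute)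
    from cong_solve_coprime_nat[OF this] obtain x where x: "[j * x = 1] (mod p)" unfolding One_nat_def by (rule exE)
    define j' where "j' = ((p - 1) * x) mod p"
    have p2: "p \<ge> 2" using assms prime_ge_2_nat by blast
    have "[j * j' + 1 = j * ((p - 1) * x) + 1] (mod p)" unfolding j'_def
      by (intro cong_add cong_mult cong_refl cong_mod_left) auto
    also have "j * ((p - 1) * x) + 1 = (p - 1) * (j * x) + 1" by simp
    also have "[(p - 1) * (j * x) + 1 = (p - 1) * 1 + 1] (mod p)" by (intro cong_add cong_mult cong_refl x)
    also have "(p - 1) * 1 + 1 = p" using p2 by simp
    finally have d: "p dvd j * j' + 1" by (simp add: cong_0_iff cong_def mod_0_imp_dvd)
    have "j' \<noteq> 0"
    proof
      assume "j' = 0"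
      hence "p dvd 1" using d by simp
      thus False using p2 by simp
    qed
    moreover have "j' < p" unfolding j'_def using p2 by simp
    ultimately show ?thesis using d by (intro bexI[of _ j']) auto
  qed
  have uniq: "x = y" if "j \<in> {1..<p}" "x \<in> {1..<p}" "y \<in> {1..<p}" "p dvd j * x + 1" "p dvd j * y + 1" for j x y
  proof -
    have "int p dvd int (j * x + 1) - int (j * y + 1)" using that by (intro dvd_diff) (simp_all only: of_nat_dvd_iff)
    hence "int p dvd int j * (int x - int y)" by (simp add: algebra_simps)
    moreover have "\<not> p dvd j" using that(1) by (auto dest: dvd_imp_le)
    hence "\<not> int p dvd int j" by simp
    moreover have "prime (int p)" using assms by simp
    ultimately have "int p dvd int x - int y" using prime_dvd_mult_iff by blast
    moreover have "\<bar>int x - int y\<bar> < int p" using that by auto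
    ultimately have "\<not> 0 < \<bar>int x - int y\<bar>" using zdvd_not_zless[of "\<bar>int x - int y\<bar>" "int p"] by (simp only: dvd_abs_iff) blast
    thus ?thesis by simp
  qed
  have "\<exists>\<sigma>. \<forall>j\<in>{1..<p}. \<sigma> j \<in> {1..<p} \<and> p dvd j * \<sigma> j + 1"
    using ex by (intro bchoice) blast
  then obtain \<sigma> where \<sigma>: "\<And>j. j \<in> {1..<p} \<Longrightarrow> \<sigma> j \<in> {1..<p} \<and> p dvd j * \<sigma> j + 1" by blast
  have "\<sigma> (\<sigma> j) = j" if "j \<in> {1..<p}" for j
  proof (rule uniq)
    show "\<sigma> j \<in> {1..<p}" "j \<in> {1..<p}" using \<sigma>[OF that] that by blast+
    thus "\<sigma> (\<sigma> j) \<in> {1..<p}" "p dvd \<sigma> j * \<sigma> (\<sigma> j) + 1" using \<sigma>[of "\<sigma> j"] by blast+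
    show "p dvd \<sigma> j * j + 1" using \<sigma>[OF that] by (simp only: mult.commute)
  qed
  thus ?thesis using that \<sigma> by blast
qed

text \<open>The inversion exchanges the term j = 0 with the term at p\<tau>. For j \<noteq> 0 the
  matrix with rows (j, -b) and (p, -\<sigma> j), where j * \<sigma> j + 1 = p * b, has determinant 1
  and carries the term j at -1/\<tau> to the term \<sigma> j at \<tau>.\<close>

theorem modular_hecke:
  assumes f: "modular k f" and k: "even k" "k > 0" and p: "prime p"
  shows "modular k (hecke p k f)"
  unfolding modular_def
proof (intro conjI allI impI)
  have p0: "p > 0" using p prime_gt_0_nat by blast
  have c1: "conv1 f" using f by (simp add: modular_def)
  show "conv1 (hecke p k f)" by (rule conv1_hecke[OF c1 p0])
  fix \<tau> :: complex assume t: "Im \<tau> > 0"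
  have nz: "\<tau> \<noteq> 0" using t by auto
  have S: "ev f (qexp (- 1 / s)) = s ^ k * ev f (qexp s)" if "Im s > 0" for s using f that unfolding modular_def by blast
  define A where "A = (\<lambda>\<tau> j. ev f (qexp ((\<tau> + of_nat j) / of_nat p)))"
  have A0: "A (- 1 / \<tau>) 0 = of_nat p ^ k * \<tau> ^ k * ev f (qexp (of_nat p * \<tau>))"
  proof -
    have "(- 1 / \<tau> + of_nat 0) / of_nat p = - 1 / (of_nat p * \<tau>)" by simp
    thus ?thesis unfolding A_def using S[of "of_nat p * \<tau>"] t p0 by (simp only: power_mult_distrib) simp
  qed
  have B0: "of_nat p ^ k * ev f (qexp (of_nat p * (- 1 / \<tau>))) = \<tau> ^ k * A \<tau> 0"
  proof -
    have e: "of_nat p * (- 1 / \<tau>) = - 1 / (\<tau> / of_nat p)" using p0 nz by simp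
    have "ev f (qexp (- 1 / (\<tau> / of_nat p))) = (\<tau> / of_nat p) ^ k * ev f (qexp (\<tau> / of_nat p))"
      using t p0 by (intro S) simp
    thus ?thesis unfolding e A_def using p0 by (simp add: power_divide)
  qed
  obtain \<sigma> where \<sigma>: "\<And>j. j \<in> {1..<p} \<Longrightarrow> \<sigma> j \<in> {1..<p} \<and> p dvd j * \<sigma> j + 1 \<and> \<sigma> (\<sigma> j) = j"
    using neg_inverse_mod_prime[OF p] by blast
  have Aj: "A (- 1 / \<tau>) j = \<tau> ^ k * A \<tau> (\<sigma> j)" if j: "j \<in> {1..<p}" for j
  proof -
    from \<sigma>[OF j] obtain b where b: "j * \<sigma> j + 1 = p * b" by (auto elim: dvdE)
    define s where "s = (\<tau> + of_nat (\<sigma> j)) / of_nat p"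
    have s: "Im s > 0" unfolding s_def using t p0 by simp
    have "int (j * \<sigma> j + 1) = int (p * b)" unfolding b ..
    hence det: "int j * (- int (\<sigma> j)) - (- int b) * int p = 1" by (simp add: algebra_simps)
    have ps: "of_nat p * s = \<tau> + of_nat (\<sigma> j)" unfolding s_def using p0 by simp
    have den: "of_int (int p) * s + of_int (- int (\<sigma> j)) = \<tau>" using ps by simp
    have "complex_of_nat (j * \<sigma> j + 1) = of_nat (p * b)" unfolding b ..
    hence b': "of_nat j * of_nat (\<sigma> j) + 1 = (of_nat p * of_nat b :: complex)" by (simp only: of_nat_add of_nat_mult of_nat_1)
    have "of_nat p * (of_int (int j) * s + of_int (- int b)) = of_nat j * (of_nat p * s) - of_nat p * of_nat b"
      by (simp add: algebra_simps)
    also have "\<dots> = of_nat j * \<tau> - 1" unfolding ps b'[symmetric] by (simp add: algebra_simps)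
    finally have num: "of_int (int j) * s + of_int (- int b) = (of_nat j * \<tau> - 1) / of_nat p"
      using p0 by (simp add: field_simps)
    have "(- 1 / \<tau> + of_nat j) / of_nat p = (of_int (int j) * s + of_int (- int b)) / (of_int (int p) * s + of_int (- int (\<sigma> j)))"
      unfolding num den using nz p0 by (simp add: field_simps)
    hence "A (- 1 / \<tau>) j = ev f (qexp ((of_int (int j) * s + of_int (- int b)) / (of_int (int p) * s + of_int (- int (\<sigma> j)))))"
      unfolding A_def by (simp only:)
    also have "\<dots> = (of_int (int p) * s + of_int (- int (\<sigma> j))) ^ k * ev f (qexp s)"
      by (rule modular_SL2[OF f k(1) det s])
    also have "\<dots> = \<tau> ^ k * ev f (qexp s)" by (simp only: den)
    also have "ev f (qexp s) = A \<tau> (\<sigma> j)" by (simp only: A_def s_def)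
    finally show ?thesis .
  qed
  have split: "(\<Sum>j<p. g j) = g 0 + (\<Sum>j=1..<p. g j)" for g :: "nat \<Rightarrow> complex"
    using p0 by (metis One_nat_def atLeast0LessThan sum.atLeast_Suc_lessThan)
  have sumA: "(\<Sum>j=1..<p. A (- 1 / \<tau>) j) = \<tau> ^ k * (\<Sum>j=1..<p. A \<tau> j)"
  proof -
    have "(\<Sum>j=1..<p. A (- 1 / \<tau>) j) = (\<Sum>j=1..<p. \<tau> ^ k * A \<tau> (\<sigma> j))" by (intro sum.cong refl Aj)
    also have "\<dots> = (\<Sum>j=1..<p. \<tau> ^ k * A \<tau> j)"
      by (rule sum.reindex_bij_witness[of _ \<sigma> \<sigma>]) (use \<sigma> in auto)
    finally show ?thesis by (simp add: sum_distrib_left)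
  qed
  have pk: "of_nat p ^ k = of_nat p * (of_nat p ^ (k - 1) :: complex)" using k by (simp add: power_eq_if)
  have "of_nat p * ev (hecke p k f) (qexp (- 1 / \<tau>)) = (\<Sum>j<p. A (- 1 / \<tau>) j) + of_nat p ^ k * ev f (qexp (of_nat p * (- 1 / \<tau>)))"
    unfolding ev_hecke[OF c1 p0 Im_minus_inverse[OF t]] A_def pk using p0 by (simp add: distrib_left)
  also have "\<dots> = \<tau> ^ k * ((\<Sum>j<p. A \<tau> j) + of_nat p ^ k * ev f (qexp (of_nat p * \<tau>)))"
    unfolding split A0 B0 sumA by (simp add: algebra_simps)
  also have "\<dots> = of_nat p * (\<tau> ^ k * ev (hecke p k f) (qexp \<tau>))"
    unfolding ev_hecke[OF c1 p0 t] A_def pk using p0 by (simp add: distrib_left)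
  finally show "ev (hecke p k f) (qexp (- 1 / \<tau>)) = \<tau> ^ k * ev (hecke p k f) (qexp \<tau>)" using p0 by simp
qed

section \<open>An integral basis in weights divisible by 4\<close>

lemma triangular_expansion:
  fixes g :: "nat \<Rightarrow> int fps"
  assumes g: "\<And>c n. n < c \<Longrightarrow> fps_nth (g c) n = 0" "\<And>c. fps_nth (g c) c = 1"
  shows "\<exists>l. \<forall>n<N. fps_nth (f - (\<Sum>c<N. of_int (l c) * g c)) n = 0"
proof (induction N)
  case (Suc N)
  have nth: "fps_nth (of_int a * h) n = a * fps_nth h n" for a n and h :: "int fps" by (simp add: fps_of_int[symmetric])
  from Suc obtain l where l: "\<And>n. n < N \<Longrightarrow> fps_nth (f - (\<Sum>c<N. of_int (l c) * g c)) n = 0" by blast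
  define a where "a = fps_nth (f - (\<Sum>c<N. of_int (l c) * g c)) N"
  define l' where "l' = l(N := a)"
  have eq: "f - (\<Sum>c<Suc N. of_int (l' c) * g c) = (f - (\<Sum>c<N. of_int (l c) * g c)) - of_int a * g N"
  proof -
    have "(\<Sum>c<N. of_int (l' c) * g c) = (\<Sum>c<N. of_int (l c) * g c)" unfolding l'_def by (intro sum.cong) auto
    thus ?thesis by (simp add: l'_def)
  qed
  have "fps_nth (f - (\<Sum>c<Suc N. of_int (l' c) * g c)) n = 0" if "n < Suc N" for n
    unfolding eq fps_sub_nth[of "f - _"] nth using that l[of n] g(1)[of n N] g(2)[of N] by (cases "n = N") (auto simp: a_def)
  thus ?case by blast
qed auto

text \<open>Of weight 4m when 3c \<le> m, with leading term q^c. E4 and \<Delta> generate only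
  weights divisible by 4, hence the parametrization by m.\<close>

definition basis_form :: "nat \<Rightarrow> nat \<Rightarrow> int fps" where "basis_form m c = E4 ^ (m - 3 * c) * Dl ^ c"

lemma basis_form_factor: "basis_form m c = fps_X ^ c * (E4 ^ (m - 3 * c) * (psi ^ 8 * alt phi ^ 16) ^ c)"
  unfolding basis_form_def Dl_def by (simp only: power_mult_distrib mult_ac)

lemma basis_form_nth_less: "n < c \<Longrightarrow> fps_nth (basis_form m c) n = 0"
  unfolding basis_form_factor by (simp add: fps_X_power_mult_nth)

lemma basis_form_nth_same: "fps_nth (basis_form m c) c = 1"
  unfolding basis_form_factor by (simp add: fps_X_power_mult_nth fps_nth_power_0 E4_def psi_def phi_def)

lemma modular_bas:
  assumes "3 * c \<le> m"
  shows "modular (4 * m) (basis_form m c)"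
proof -
  have "4 * (m - 3 * c) + 12 * c = 4 * m" using assms by simp
  thus ?thesis using modular_mult[OF modular_power[OF modular_E4, of "m - 3 * c"] modular_power[OF modular_Dl, of c]] unfolding basis_form_def by simp
qed

text \<open>Since the leading coefficients are 1, an integral combination cancels the first m div 3
  + 1 coefficients of f, and \<open>modular_vanishing\<close> kills the difference. Integrality of
  the coordinates is what permits reduction modulo 2.\<close>

theorem modular_expansion:
  assumes f: "modular (4 * m) f"
  shows "\<exists>l. f = (\<Sum>c\<le>m div 3. of_int (l c) * basis_form m c)"
proof -
  obtain l where l: "\<And>n. n < Suc (m div 3) \<Longrightarrow> fps_nth (f - (\<Sum>c<Suc (m div 3). of_int (l c) * basis_form m c)) n = 0"
    using triangular_expansion[of "basis_form m" "Suc (m div 3)" f] basis_form_nth_less basis_form_nth_same by blast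
  have "modular (4 * m) (f - (\<Sum>c<Suc (m div 3). of_int (l c) * basis_form m c))"
    by (intro modular_diff f modular_sum modular_cmult modular_bas) auto
  hence "f - (\<Sum>c<Suc (m div 3). of_int (l c) * basis_form m c) = 0"
    by (rule modular_vanishing) (use l in \<open>simp add: less_Suc_eq_le\<close>)
  thus ?thesis by (intro exI[of _ l]) (simp add: lessThan_Suc_atMost)
qed

section \<open>Nilpotency of the Hecke operators modulo 2\<close>

definition ceq :: "int \<Rightarrow> int fps \<Rightarrow> int fps \<Rightarrow> bool" where
  "ceq N f g \<longleftrightarrow> (\<forall>n. N dvd fps_nth f n - fps_nth g n)"

lemma of_int_mult_nth [simp]: "fps_nth (of_int a * h) n = a * fps_nth h n" for a :: int and h :: "int fps"
  by (simp add: fps_of_int[symmetric])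

lemma ceq_iff: "ceq N f g \<longleftrightarrow> (\<exists>d. f - g = of_int N * d)"
proof
  assume "ceq N f g"
  hence "f - g = of_int N * Abs_fps (\<lambda>n. (fps_nth f n - fps_nth g n) div N)"
    by (intro fps_ext) (auto simp: ceq_def)
  thus "\<exists>d. f - g = of_int N * d" by blast
next
  assume "\<exists>d. f - g = of_int N * d"
  then obtain d where d: "f - g = of_int N * d" by blast
  have "fps_nth f n - fps_nth g n = N * fps_nth d n" for n
    using arg_cong[OF d, of "\<lambda>h. fps_nth h n"] by simp
  thus "ceq N f g" by (simp add: ceq_def)
qed

lemma ceq_refl [simp]: "ceq N f f" by (simp add: ceq_def)
lemma ceq_sym: "ceq N f g \<Longrightarrow> ceq N g f" unfolding ceq_def by (metis dvd_diff_commute)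
lemma ceq_trans: "ceq N f g \<Longrightarrow> ceq N g h \<Longrightarrow> ceq N f h"
  unfolding ceq_def by (metis (no_types, opaque_lifting) dvd_add diff_add_cancel add_diff_eq)
lemma ceq_add: "ceq N f f' \<Longrightarrow> ceq N g g' \<Longrightarrow> ceq N (f + g) (f' + g')"
  unfolding ceq_def by (simp add: add_diff_add)
lemma ceq_mult:
  assumes "ceq N f f'" "ceq N g g'"
  shows "ceq N (f * g) (f' * g')"
proof -
  obtain d e where d: "f = f' + of_int N * d" "g = g' + of_int N * e"
    using assms unfolding ceq_iff by (metis add.commute diff_add_cancel)
  have "f * g - f' * g' = of_int N * (f' * e + d * g' + of_int N * d * e)"
    unfolding d by (simp add: algebra_simps)
  thus ?thesis unfolding ceq_iff by blast
qed
lemma ceq_power: "ceq N f g \<Longrightarrow> ceq N (f ^ n) (g ^ n)"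
  by (induction n) (auto intro: ceq_mult)
lemma ceq_sum: "(\<And>i. i \<in> I \<Longrightarrow> ceq N (f i) (g i)) \<Longrightarrow> ceq N (\<Sum>i\<in>I. f i) (\<Sum>i\<in>I. g i)"
  by (induction I rule: infinite_finite_induct) (auto intro: ceq_add)
lemma ceq_dvd: "ceq N f g \<Longrightarrow> M dvd N \<Longrightarrow> ceq M f g"
  unfolding ceq_def using dvd_trans by blast
lemma ceq_dil: "k > 0 \<Longrightarrow> ceq N f g \<Longrightarrow> ceq N (dil k f) (dil k g)"
  by (simp add: ceq_def dil_nth)
lemma ceq_2_iff: "ceq 2 f g \<longleftrightarrow> (\<forall>n. odd (fps_nth f n) \<longleftrightarrow> odd (fps_nth g n))"
  unfolding ceq_def by (auto simp: even_diff_iff)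

text \<open>In the convolution for the coefficient of q^n the terms i and n - i are equal, so modulo
  2 only i = n/2 remains, and an integer has the parity of its square.\<close>

lemma square_ceq_dil: "ceq 2 (f ^ 2) (dil 2 f)"
  unfolding ceq_def
proof
  fix n
  define a where "a = (\<lambda>i. fps_nth f i * fps_nth f (n - i))"
  define A where "A = {i\<in>{0..n}. i < n - i}"
  define B where "B = {i\<in>{0..n}. i > n - i}"
  define C where "C = {i\<in>{0..n}. 2 * i = n}"
  have un: "{0..n} = A \<union> B \<union> C" unfolding A_def B_def C_def by auto
  have AB: "sum a A = sum a B"
    by (rule sum.reindex_bij_witness[of _ "\<lambda>i. n - i" "\<lambda>i. n - i"]) (auto simp: A_def B_def a_def)
  have "fps_nth (f ^ 2) n = sum a {0..n}" by (simp add: power2_eq_square fps_mult_nth a_def)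
  also have "\<dots> = sum a (A \<union> B) + sum a C"
    unfolding un by (rule sum.union_disjoint) (auto simp: A_def B_def C_def)
  also have "sum a (A \<union> B) = sum a A + sum a B"
    by (rule sum.union_disjoint) (auto simp: A_def B_def)
  finally have s: "fps_nth (f ^ 2) n = 2 * sum a A + sum a C" using AB by simp
  show "2 dvd fps_nth (f ^ 2) n - fps_nth (dil 2 f) n"
  proof (cases "even n")
    case True
    then obtain j where j: "n = 2 * j" by auto
    have "C = {j}" unfolding C_def j by auto
    hence "fps_nth (f ^ 2) n = 2 * sum a A + fps_nth f j * fps_nth f j" using s by (simp add: a_def j)
    moreover have "fps_nth (dil 2 f) n = fps_nth f j" using j by (simp add: dil_nth)
    ultimately show ?thesis by simp
  next
    case False
    hence "C = {}" unfolding C_def by auto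
    thus ?thesis using s False by (simp add: dil_nth)
  qed
qed

lemma dil_dil: "a > 0 \<Longrightarrow> b > 0 \<Longrightarrow> dil a (dil b f) = dil (a * b) f"
proof (rule fps_ext)
  fix n assume ab: "a > 0" "b > 0"
  show "fps_nth (dil a (dil b f)) n = fps_nth (dil (a * b) f) n"
  proof (cases "a dvd n")
    case True
    then obtain j where "n = a * j" by auto
    thus ?thesis using ab by (simp add: dil_nth)
  next
    case False
    hence "\<not> a * b dvd n" using dvd_mult_left by blast
    thus ?thesis using False ab by (simp add: dil_nth)
  qed
qed

lemma power2_power_ceq_dil: "ceq 2 (f ^ (2 ^ k)) (dil (2 ^ k) f)"
proof (induction k)
  case 0
  show ?case by (simp add: ceq_def dil_nth)
next
  case (Suc k)
  have "ceq 2 ((f ^ (2 ^ k)) ^ 2) (dil 2 (f ^ (2 ^ k)))" by (rule square_ceq_dil)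
  moreover have "ceq 2 (dil 2 (f ^ (2 ^ k))) (dil 2 (dil (2 ^ k) f))" by (rule ceq_dil[OF _ Suc.IH]) simp
  ultimately show ?case using ceq_trans by (simp add: dil_dil power_mult[symmetric] mult.commute)
qed

lemma alt_phi_ceq: "ceq 2 (alt phi) 1"
  by (auto simp: ceq_def phi_def fps_one_nth)

lemma E4_ceq: "ceq 2 E4 1"
proof -
  have "ceq 2 (alt phi ^ 8) (1 ^ 8)" by (rule ceq_power[OF alt_phi_ceq])
  moreover have "ceq 2 (256 * (fps_X * psi ^ 8)) 0"
    unfolding ceq_iff by (rule exI[of _ "128 * (fps_X * psi ^ 8)"]) simp
  ultimately have "ceq 2 (alt phi ^ 8 + 256 * (fps_X * psi ^ 8)) (1 ^ 8 + 0)" by (rule ceq_add)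
  thus ?thesis by (simp add: E4_def)
qed

lemma Dl_power_ceq: "ceq 2 (Dl ^ u) (fps_X ^ u * dil 8 (psi ^ u))"
proof -
  have p8: "ceq 2 (psi ^ 8) (dil 8 psi)" using power2_power_ceq_dil[of psi 3] by simp
  have "ceq 2 (alt phi ^ 16) (1 ^ 16)" by (rule ceq_power[OF alt_phi_ceq])
  hence "ceq 2 Dl (fps_X * dil 8 psi * 1 ^ 16)" unfolding Dl_def
    by (intro ceq_mult ceq_refl p8)
  hence "ceq 2 (Dl ^ u) ((fps_X * dil 8 psi * 1 ^ 16) ^ u)" by (rule ceq_power)
  thus ?thesis by (simp add: power_mult_distrib dil_power)
qed

text \<open>Modulo 2, \<Delta>^u is q^u times a series in q^8, because psi^8 = psi(q^8); raising to
  the power 2^v then replaces q by q^(2^v).\<close>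

lemma Dl_odd_coeff:
  assumes "odd (fps_nth (Dl ^ (2 ^ v * u)) n)"
  shows "(2::int) ^ (v + 3) dvd int n - int (2 ^ v * u)"
proof -
  have "ceq 2 ((Dl ^ u) ^ (2 ^ v)) (dil (2 ^ v) (Dl ^ u))" by (rule power2_power_ceq_dil)
  hence "odd (fps_nth (dil (2 ^ v) (Dl ^ u)) n)" using assms by (simp add: ceq_2_iff power_mult[symmetric] mult.commute)
  hence "2 ^ v dvd n" and o: "odd (fps_nth (Dl ^ u) (n div 2 ^ v))" by (auto simp: dil_nth split: if_splits)
  then obtain j where j: "n = 2 ^ v * j" by auto
  have "odd (fps_nth (fps_X ^ u * dil 8 (psi ^ u)) j)" using o Dl_power_ceq[of u] j by (simp add: ceq_2_iff)
  hence "u \<le> j" "8 dvd j - u" by (auto simp: fps_X_power_mult_nth dil_nth split: if_splits)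
  then obtain i where i: "j = u + 8 * i" by (metis dvdE le_add_diff_inverse)
  have "int n - int (2 ^ v * u) = 2 ^ (v + 3) * int i" unfolding j i by (simp add: algebra_simps power_add)
  thus ?thesis by simp
qed

lemma hecke_nth: "p > 0 \<Longrightarrow> fps_nth (hecke p k f) n = fps_nth f (p * n) + int p ^ (k - 1) * (if p dvd n then fps_nth f (n div p) else 0)"
proof -
  assume p: "p > 0"
  have "fps_nth (hecke p k f) n = fps_nth f (p * n) + fps_nth (of_int (int p ^ (k - 1)) * dil p f) n"
    unfolding hecke_def by (simp only: fps_add_nth fps_nth_Abs_fps)
  thus ?thesis using p by (simp only: of_int_mult_nth dil_nth)
qed

text \<open>For odd p the factor p^(k-1) is odd whatever k is, so modulo 2 the operator forgets the
  weight. Forms of different weights with the same reduction can therefore be compared.\<close>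

lemma hecke_ceq:
  assumes "p > 0" "odd p" "ceq 2 f g"
  shows "ceq 2 (hecke p k f) (hecke p l g)"
  using assms unfolding ceq_2_iff by (simp add: hecke_nth)

text \<open>T_p multiplies the exponents of \<Delta>^c modulo 2 by p in the relevant residue ring, so excluding p = 1 modulo 8
  removes \<Delta>^c itself from T_p \<Delta>^c.\<close>
definition Pset :: "nat set" where "Pset = {p. prime p \<and> odd p \<and> p mod 8 \<noteq> 1}"

text \<open>An odd coefficient would make p*n or n/p congruent to c = 2^v u modulo 2^(v+3). As n is
  congruent to c as well, 2^(v+3) would divide c(p-1), hence 8 would divide p-1.\<close>

lemma hecke_Dl_even:
  assumes p: "p \<in> Pset" and u: "odd u" and n: "(2::int) ^ (v + 3) dvd int n - int (2 ^ v * u)"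
  shows "even (fps_nth (hecke p k (Dl ^ (2 ^ v * u))) n)"
proof (rule ccontr)
  assume "odd (fps_nth (hecke p k (Dl ^ (2 ^ v * u))) n)"
  moreover have p0: "p > 0" "odd p" "p mod 8 \<noteq> 1" using p by (auto simp: Pset_def prime_gt_0_nat)
  ultimately have "odd (fps_nth (Dl ^ (2 ^ v * u)) (p * n)) \<or> (p dvd n \<and> odd (fps_nth (Dl ^ (2 ^ v * u)) (n div p)))"
    by (auto simp: hecke_nth split: if_splits)
  hence main: "(2::int) ^ (v + 3) dvd int (2 ^ v * u) * (int p - 1)"
  proof
    assume "odd (fps_nth (Dl ^ (2 ^ v * u)) (p * n))"
    from Dl_odd_coeff[OF this] have 1: "(2::int) ^ (v + 3) dvd int (p * n) - int (2 ^ v * u)" .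
    have "(2::int) ^ (v + 3) dvd int p * (int n - int (2 ^ v * u))" using n by simp
    hence "(2::int) ^ (v + 3) dvd (int (p * n) - int (2 ^ v * u)) - int p * (int n - int (2 ^ v * u))" using 1 by (rule dvd_diff[rotated])
    also have "(int (p * n) - int (2 ^ v * u)) - int p * (int n - int (2 ^ v * u)) = int (2 ^ v * u) * (int p - 1)"
      by (simp add: algebra_simps)
    finally show ?thesis .
  next
    assume a: "p dvd n \<and> odd (fps_nth (Dl ^ (2 ^ v * u)) (n div p))"
    then obtain j where j: "n = p * j" by auto
    have "(2::int) ^ (v + 3) dvd int j - int (2 ^ v * u)" using Dl_odd_coeff[of v u j] a j p0 by simp
    hence "(2::int) ^ (v + 3) dvd int p * (int j - int (2 ^ v * u))" by simp
    hence "(2::int) ^ (v + 3) dvd (int n - int (2 ^ v * u)) - int p * (int j - int (2 ^ v * u))" using n by (rule dvd_diff[rotated])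
    also have "(int n - int (2 ^ v * u)) - int p * (int j - int (2 ^ v * u)) = int (2 ^ v * u) * (int p - 1)"
      unfolding j by (simp add: algebra_simps)
    finally show ?thesis .
  qed
  have "(2::int) ^ v * 8 dvd 2 ^ v * (int u * (int p - 1))" using main by (simp add: power_add mult_ac)
  hence "8 dvd int u * (int p - 1)" by simp
  moreover have "coprime (8::int) (int u)"
  proof -
    have "coprime (2 ^ 3) (int u)" using u by (intro coprime_power_left_iff[THEN iffD2]) auto
    thus ?thesis by simp
  qed
  ultimately have "8 dvd int p - 1" by (simp add: coprime_dvd_mult_right_iff)
  hence "int p mod 8 = 1" by presburger
  thus False using p0 by (metis nat_int_comparison(1) of_nat_1 of_nat_mod of_nat_numeral)
qed

lemma basis_form_ceq: "ceq 2 (basis_form m c) (Dl ^ c)"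
proof -
  have "ceq 2 (E4 ^ (m - 3 * c) * Dl ^ c) (1 ^ (m - 3 * c) * Dl ^ c)"
    by (intro ceq_mult ceq_power E4_ceq ceq_refl)
  thus ?thesis by (simp add: basis_form_def)
qed

lemma Dl_nth: "n < c \<Longrightarrow> fps_nth (Dl ^ c) n = 0" "fps_nth (Dl ^ c) c = 1"
  using basis_form_nth_less[of n c "3 * c"] basis_form_nth_same[of "3 * c" c] by (simp_all add: basis_form_def)

lemma sum_nth_top:
  assumes "c \<le> M"
  shows "fps_nth (\<Sum>i\<le>M. of_int (a i) * Dl ^ i) c = (\<Sum>i<c. a i * fps_nth (Dl ^ i) c) + a c"
proof -
  have "fps_nth (\<Sum>i\<le>M. of_int (a i) * Dl ^ i) c = (\<Sum>i\<le>M. a i * fps_nth (Dl ^ i) c)" by (simp add: fps_sum_nth)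
  also have "\<dots> = (\<Sum>i\<in>{..<Suc c}. a i * fps_nth (Dl ^ i) c)"
    by (rule sum.mono_neutral_right) (use assms in \<open>auto simp: Dl_nth\<close>)
  finally show ?thesis by (simp add: Dl_nth)
qed

lemma Dl_independent:
  assumes "ceq 2 (\<Sum>i\<le>M. of_int (a i) * Dl ^ i) 0" "c \<le> M"
  shows "even (a c)"
  using assms(2)
proof (induction c rule: less_induct)
  case (less c)
  have "even (fps_nth (\<Sum>i\<le>M. of_int (a i) * Dl ^ i) c)" using assms(1) by (simp add: ceq_2_iff)
  moreover have "even (\<Sum>i<c. a i * fps_nth (Dl ^ i) c)" using less by (intro dvd_sum) auto
  ultimately show ?case unfolding sum_nth_top[OF less.prems] by simp
qed

lemma pow2_odd_eq:
  fixes x y :: int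
  assumes "2 ^ v * x = 2 ^ w * y" "odd x" "odd y"
  shows "v = w"
proof -
  have "multiplicity 2 (2 ^ v * x) = v" "multiplicity 2 (2 ^ w * y) = w"
    using assms(2,3) by (auto simp: multiplicity_eqI)
  thus ?thesis using assms(1) by simp
qed

lemma odd_decompose:
  fixes c :: nat
  assumes "c > 0"
  obtains v u where "c = 2 ^ v * u" "odd u"
  using assms
proof (induction c arbitrary: thesis rule: less_induct)
  case (less c)
  show ?case
  proof (cases "even c")
    case True
    then obtain d where d: "c = 2 * d" by auto
    with less.prems have "d < c" "d > 0" by auto
    from less.IH[OF this(1) _ this(2)] obtain v u where "d = 2 ^ v * u" "odd u" by blast
    thus ?thesis using less.prems(1)[of "Suc v" u] d by simp
  next
    case False
    thus ?thesis using less.prems(1)[of 0 c] by simp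
  qed
qed

text \<open>\<open>a c\<close> cannot be read off at q^c, because lower powers of \<Delta>
  contribute there. Instead, with 2^v the exact power of 2 in c, take the least index c0 in the
  class of c modulo 2^(v+3) whose coefficient is odd. At q^c0 a lower \<Delta>^i contributes only if
  i and c0 agree modulo 8 times the power of 2 in i; then i and c0 have the same 2-adic valuation
  and lie in the same class, against minimality. So the coefficient at q^c0 is odd, which
  contradicts \<open>hecke_Dl_even\<close>.\<close>

lemma hecke_top_even:
  assumes p: "p \<in> Pset" and c: "c > 0" and eq: "ceq 2 (hecke p k (Dl ^ c)) (\<Sum>i\<le>c. of_int (a i) * Dl ^ i)"
  shows "even (a c)"
proof (rule ccontr)
  assume odd: "odd (a c)"
  obtain v u where uv: "c = 2 ^ v * u" "odd u" using odd_decompose[OF c] by blast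
  define J where "J = {i. i \<le> c \<and> odd (a i) \<and> (2::int) ^ (v + 3) dvd int i - int c}"
  have "c \<in> J" using odd by (simp add: J_def)
  define c0 where "c0 = (LEAST i. i \<in> J)"
  have c0: "c0 \<in> J" unfolding c0_def using \<open>c \<in> J\<close> by (rule LeastI)
  have min: "i \<notin> J" if "i < c0" for i using that not_less_Least unfolding c0_def by blast
  obtain s where "int c0 - int c = 2 ^ (v + 3) * s" using c0 unfolding J_def by (auto elim: dvdE)
  hence c0v: "int c0 = 2 ^ v * (int u + 8 * s)" using uv by (simp add: algebra_simps power_add)
  have o1: "odd (int u + 8 * s)" using uv by simp
  have "even (fps_nth (hecke p k (Dl ^ c)) c0)"
    unfolding uv(1) by (rule hecke_Dl_even[OF p uv(2)]) (use c0 uv in \<open>simp add: J_def\<close>)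
  hence "even (fps_nth (\<Sum>i\<le>c. of_int (a i) * Dl ^ i) c0)" using eq by (simp add: ceq_2_iff)
  moreover have "c0 \<le> c" "odd (a c0)" using c0 by (auto simp: J_def)
  moreover have "even (\<Sum>i<c0. a i * fps_nth (Dl ^ i) c0)"
  proof (rule dvd_sum)
    fix i assume "i \<in> {..<c0}"
    hence i: "i < c0" by simp
    show "even (a i * fps_nth (Dl ^ i) c0)"
    proof (rule ccontr)
      assume "odd (a i * fps_nth (Dl ^ i) c0)"
      hence o: "odd (a i)" "odd (fps_nth (Dl ^ i) c0)" by auto
      have "i \<noteq> 0" using o(2) i by (cases "i = 0") auto
      then obtain v' u' where uv': "i = 2 ^ v' * u'" "odd u'" using odd_decompose[of i] by blast
      from Dl_odd_coeff[of v' u' c0] o(2) have d: "(2::int) ^ (v' + 3) dvd int c0 - int i" unfolding uv'(1) .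
      then obtain s' where "int c0 - int i = 2 ^ (v' + 3) * s'" by (auto elim: dvdE)
      hence "int c0 = 2 ^ v' * (int u' + 8 * s')" using uv' by (simp add: algebra_simps power_add)
      moreover have "odd (int u' + 8 * s')" using uv' by simp
      ultimately have "v = v'" using pow2_odd_eq[of v "int u + 8 * s" v'] c0v o1 by simp
      hence d2: "(2::int) ^ (v + 3) dvd int c0 - int i" using d by simp
      have d1: "(2::int) ^ (v + 3) dvd int c0 - int c" using c0 by (simp add: J_def)
      have "(2::int) ^ (v + 3) dvd int i - int c"
      proof -
        have e: "(int c0 - int c) - (int c0 - int i) = int i - int c" by linarith
        show ?thesis using dvd_diff[OF d1 d2] unfolding e .
      qed
      hence "i \<in> J" using o i \<open>c0 \<le> c\<close> by (simp add: J_def)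
      thus False using min[OF i] by simp
    qed
  qed
  ultimately show False using sum_nth_top[of c0 c a] by simp
qed

text \<open>Modulo 2 the image of \<open>basis_form m c\<close> is that of \<Delta>^c. Taken in its
  own weight 12c, the latter is a combination of the \<Delta>^i with i \<le> c only, and its top
  coefficient is even. Independence of the powers of \<Delta> modulo 2 identifies the two
  expansions.\<close>

theorem hecke_triangular:
  assumes p: "p \<in> Pset" and m: "m > 0" and c: "3 * c \<le> m"
  shows "\<exists>l. hecke p (4 * m) (basis_form m c) = (\<Sum>i\<le>m div 3. of_int (l i) * basis_form m i) \<and> (\<forall>i\<ge>c. i \<le> m div 3 \<longrightarrow> even (l i))"
proof -
  have pp: "prime p" "odd p" "p > 0" using p by (auto simp: Pset_def prime_gt_0_nat)
  have "modular (4 * m) (hecke p (4 * m) (basis_form m c))" using m by (intro modular_hecke modular_bas c pp) auto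
  then obtain l where l: "hecke p (4 * m) (basis_form m c) = (\<Sum>i\<le>m div 3. of_int (l i) * basis_form m i)"
    using modular_expansion by blast
  have "ceq 2 (\<Sum>i\<le>m div 3. of_int (l i) * basis_form m i) (\<Sum>i\<le>m div 3. of_int (l i) * Dl ^ i)"
    by (intro ceq_sum ceq_mult basis_form_ceq ceq_refl)
  moreover have "ceq 2 (hecke p (4 * m) (basis_form m c)) (hecke p (12 * c) (Dl ^ c))"
    using pp by (intro hecke_ceq basis_form_ceq) auto
  ultimately have hl: "ceq 2 (\<Sum>i\<le>m div 3. of_int (l i) * Dl ^ i) (hecke p (12 * c) (Dl ^ c))"
    unfolding l using ceq_sym ceq_trans by blast
  have "even (l i)" if i: "c \<le> i" "i \<le> m div 3" for i
  proof (cases "c = 0")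
    \<comment> \<open>For c = 0 the image of the constant 1 is the constant 1 + p^(k-1), which is
      even as p is odd.\<close>
    case True
    have "ceq 2 (hecke p (12 * c) (Dl ^ c)) 0"
    proof -
      have "even (fps_nth (hecke p (12 * c) (Dl ^ c)) n)" for n
      proof -
        have "fps_nth (hecke p (12 * c) (Dl ^ c)) n = (if p * n = 0 then 1 else 0) + int p ^ (12 * c - 1) * (if p dvd n then (if n div p = 0 then 1 else 0) else 0)"
          using True pp by (simp add: hecke_nth fps_one_nth)
        moreover have "p dvd n \<Longrightarrow> n div p = 0 \<longleftrightarrow> n = 0" using pp by (auto elim!: dvdE)
        ultimately show ?thesis using pp by auto
      qed
      thus ?thesis by (simp add: ceq_2_iff)
    qed
    hence "ceq 2 (\<Sum>i\<le>m div 3. of_int (l i) * Dl ^ i) 0" using hl ceq_trans by blast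
    thus ?thesis using i(2) by (rule Dl_independent)
  next
    case False
    have b: "basis_form (3 * c) c = Dl ^ c" by (simp add: basis_form_def)
    have "modular (4 * (3 * c)) (hecke p (4 * (3 * c)) (basis_form (3 * c) c))" using False by (intro modular_hecke modular_bas pp) auto
    then obtain a where "hecke p (4 * (3 * c)) (basis_form (3 * c) c) = (\<Sum>i\<le>(3 * c) div 3. of_int (a i) * basis_form (3 * c) i)"
      using modular_expansion by blast
    hence "hecke p (12 * c) (Dl ^ c) = (\<Sum>i\<le>c. of_int (a i) * basis_form (3 * c) i)" using b by simp
    hence a: "ceq 2 (hecke p (12 * c) (Dl ^ c)) (\<Sum>i\<le>c. of_int (a i) * Dl ^ i)"
      by (simp only:) (intro ceq_sum ceq_mult basis_form_ceq ceq_refl)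
    have ac: "even (a c)" by (rule hecke_top_even[OF p _ a]) (use False in simp)
    define a' where "a' = (\<lambda>i. if i \<le> c then a i else 0)"
    have cm: "c \<le> m div 3" using c by simp
    have "(\<Sum>i\<le>m div 3. of_int (a' i) * Dl ^ i) = (\<Sum>i\<le>c. of_int (a' i) * Dl ^ i)"
      by (rule sum.mono_neutral_right) (use cm in \<open>auto simp: a'_def\<close>)
    also have "\<dots> = (\<Sum>i\<le>c. of_int (a i) * Dl ^ i)" by (intro sum.cong) (auto simp: a'_def)
    finally have "ceq 2 (\<Sum>i\<le>m div 3. of_int (l i) * Dl ^ i) (\<Sum>i\<le>m div 3. of_int (a' i) * Dl ^ i)"
      using hl a ceq_trans by simp
    hence "ceq 2 ((\<Sum>i\<le>m div 3. of_int (l i) * Dl ^ i) - (\<Sum>i\<le>m div 3. of_int (a' i) * Dl ^ i)) 0"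
      by (simp add: ceq_def)
    also have "(\<Sum>i\<le>m div 3. of_int (l i) * Dl ^ i) - (\<Sum>i\<le>m div 3. of_int (a' i) * Dl ^ i) = (\<Sum>i\<le>m div 3. of_int (l i - a' i) * Dl ^ i)"
      by (simp add: sum_subtractf left_diff_distrib)
    finally have "even (l i - a' i)" using i(2) by (rule Dl_independent[where a = "\<lambda>i. l i - a' i"])
    moreover have "even (a' i)" using i(1) ac unfolding a'_def by (cases "i = c") auto
    ultimately show ?thesis by simp
  qed
  thus ?thesis using l by blast
qed

lemma prime_dvd_prod_listD: "prime p \<Longrightarrow> p dvd prod_list ps \<Longrightarrow> \<exists>r\<in>set ps. p dvd r" for p :: nat
  by (induction ps) (auto simp: prime_dvd_mult_iff)

text \<open>As p divides the index exactly once, the coefficient is that of the Hecke image at the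
  index divided by p. In the triangular expansion each term either has a smaller index or gains a
  factor 2, after which the index may be as large as m div 3. So c + 1 primes secure the first
  factor 2, and m div 3 + 1 more secure each further one.\<close>

theorem basis_form_coeff_divisible:
  assumes "m > 0" "3 * c \<le> m" "distinct ps" "set ps \<subseteq> Pset" "\<forall>p\<in>set ps. \<not> p dvd n"
    "K = 0 \<or> length ps \<ge> c + 1 + (K - 1) * (m div 3 + 1)"
  shows "(2::int) ^ K dvd fps_nth (basis_form m c) (prod_list ps * n)"
  using assms(2-)
proof (induction ps arbitrary: c K)
  case Nil
  hence "K = 0" by auto
  thus ?case by simp
next
  case (Cons p ps)
  show ?case
  proof (cases "K = 0")
    case False
    define N where "N = prod_list ps * n"
    have p: "p \<in> Pset" "prime p" "p > 0" using Cons.prems by (auto simp: Pset_def prime_gt_0_nat)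
    have "\<not> p dvd prod_list ps"
    proof
      assume "p dvd prod_list ps"
      then obtain r where r: "r \<in> set ps" "p dvd r" using prime_dvd_prod_listD[OF p(2)] by blast
      hence "prime r" using Cons.prems by (auto simp: Pset_def)
      hence "p = r" using r p(2) primes_dvd_imp_eq by blast
      thus False using r Cons.prems by auto
    qed
    hence pN: "\<not> p dvd N" using p Cons.prems unfolding N_def by (simp add: prime_dvd_mult_iff)
    obtain l where l: "hecke p (4 * m) (basis_form m c) = (\<Sum>i\<le>m div 3. of_int (l i) * basis_form m i)" "\<And>i. i \<ge> c \<Longrightarrow> i \<le> m div 3 \<Longrightarrow> even (l i)"
      using hecke_triangular[OF p(1) assms(1) Cons.prems(1)] by blast
    have "fps_nth (basis_form m c) (prod_list (p # ps) * n) = fps_nth (hecke p (4 * m) (basis_form m c)) N"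
      using pN p by (simp add: hecke_nth N_def mult.assoc)
    also have "\<dots> = (\<Sum>i\<le>m div 3. l i * fps_nth (basis_form m i) N)" unfolding l(1) by (simp add: fps_sum_nth)
    also have "(2::int) ^ K dvd \<dots>"
    proof (rule dvd_sum)
      fix i assume "i \<in> {..m div 3}"
      hence i: "i \<le> m div 3" by simp
      have i3: "3 * i \<le> m" using i by linarith
      have len: "length ps \<ge> c + (K - 1) * (m div 3 + 1)" using Cons.prems False by simp
      have pr: "distinct ps" "set ps \<subseteq> Pset" "\<forall>p\<in>set ps. \<not> p dvd n" using Cons.prems by auto
      show "(2::int) ^ K dvd l i * fps_nth (basis_form m i) N"
      proof (cases "i < c")
        case True
        hence "length ps \<ge> i + 1 + (K - 1) * (m div 3 + 1)" using len by linarith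
        hence "(2::int) ^ K dvd fps_nth (basis_form m i) N" unfolding N_def using i3 pr by (intro Cons.IH) auto
        thus ?thesis by simp
      next
        case nlt: False
        have "K - 1 = 0 \<or> length ps \<ge> i + 1 + (K - 1 - 1) * (m div 3 + 1)"
        proof (cases "K - 1")
          case (Suc r)
          hence "(K - 1) * (m div 3 + 1) = (m div 3 + 1) + (K - 1 - 1) * (m div 3 + 1)" by simp
          thus ?thesis using len i by linarith
        qed auto
        hence "(2::int) ^ (K - 1) dvd fps_nth (basis_form m i) N" unfolding N_def using i3 pr by (intro Cons.IH) auto
        moreover have "2 dvd l i" using l(2) nlt i by auto
        ultimately have "2 * (2::int) ^ (K - 1) dvd l i * fps_nth (basis_form m i) N" by (rule mult_dvd_mono[rotated])
        moreover have "(2::int) ^ K = 2 * 2 ^ (K - 1)" using False by (cases K) auto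
        ultimately show ?thesis by (simp only:)
      qed
    qed
    finally show ?thesis .
  qed auto
qed

section \<open>The 2-adic closure of the ring of level one forms\<close>

text \<open>Mixed weights are allowed, because the approximants to inverses and square roots are not
  homogeneous.\<close>

inductive_set level_one :: "int fps set" where
  monom: "of_int c * (E4 ^ a * Dl ^ b) \<in> level_one"
| add: "f \<in> level_one \<Longrightarrow> g \<in> level_one \<Longrightarrow> f + g \<in> level_one"

lemma level_one_of_int: "of_int c \<in> level_one" using level_one.monom[of c 0 0] by simp

lemma level_one_mult:
  assumes "f \<in> level_one" "g \<in> level_one"
  shows "f * g \<in> level_one"
  using assms
proof (induction f rule: level_one.induct)
  case (monom c a b)
  show ?case using monom
  proof (induction g rule: level_one.induct)
    case (monom c' a' b')
    have "of_int c * (E4 ^ a * Dl ^ b) * (of_int c' * (E4 ^ a' * Dl ^ b')) = of_int (c * c') * (E4 ^ (a + a') * Dl ^ (b + b'))"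
      by (simp add: power_add mult_ac)
    thus ?case using level_one.monom[of "c * c'" "a + a'" "b + b'"] by (simp only:)
  next
    case (add f g)
    thus ?case by (simp only: distrib_left level_one.add)
  qed
next
  case (add f g')
  thus ?case by (simp only: distrib_right level_one.add)
qed

text \<open>Such a series has integer coefficients, but its coordinates on the monomials may have a
  power of 2 in the denominator.\<close>

definition saturated :: "int fps \<Rightarrow> bool" where "saturated g \<longleftrightarrow> (\<exists>s. of_int (2 ^ s) * g \<in> level_one)"

lemma saturated_poly: "g \<in> level_one \<Longrightarrow> saturated g" unfolding saturated_def by (intro exI[of _ 0]) simp

lemma saturated_mult: "saturated f \<Longrightarrow> saturated g \<Longrightarrow> saturated (f * g)"
proof -
  assume "saturated f" "saturated g"
  then obtain s t where s: "of_int (2 ^ s) * f \<in> level_one" "of_int (2 ^ t) * g \<in> level_one" unfolding saturated_def by blast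
  have "of_int (2 ^ (s + t)) * (f * g) = (of_int (2 ^ s) * f) * (of_int (2 ^ t) * g)" by (simp add: power_add mult_ac)
  thus ?thesis unfolding saturated_def using level_one_mult[OF s] by (intro exI[of _ "s + t"]) (simp only:)
qed

lemma saturated_add: "saturated f \<Longrightarrow> saturated g \<Longrightarrow> saturated (f + g)"
proof -
  assume "saturated f" "saturated g"
  then obtain s t where s: "of_int (2 ^ s) * f \<in> level_one" "of_int (2 ^ t) * g \<in> level_one" unfolding saturated_def by blast
  have "of_int (2 ^ (s + t)) * (f + g) = of_int (2 ^ t) * (of_int (2 ^ s) * f) + of_int (2 ^ s) * (of_int (2 ^ t) * g)"
    by (simp add: power_add algebra_simps)
  moreover have "\<dots> \<in> level_one" by (rule level_one.add[OF level_one_mult[OF level_one_of_int s(1)] level_one_mult[OF level_one_of_int s(2)]])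
  ultimately show ?thesis unfolding saturated_def by (intro exI[of _ "s + t"]) (simp only:)
qed

definition two_adic :: "int fps \<Rightarrow> bool" where
  "two_adic g \<longleftrightarrow> (\<forall>k. \<exists>h. saturated h \<and> ceq (2 ^ k) g h)"

lemma two_adic_if_saturated: "saturated g \<Longrightarrow> two_adic g" unfolding two_adic_def using ceq_refl by blast

lemma two_adic_of_int [simp]: "two_adic (of_int c)" by (intro two_adic_if_saturated saturated_poly level_one_of_int)

lemma two_adic_numeral [simp]: "two_adic (numeral c)" "two_adic 1" "two_adic 0"
  using two_adic_of_int[of "numeral c"] two_adic_of_int[of 1] two_adic_of_int[of 0] by simp_all

lemma two_adic_E4: "two_adic E4" and two_adic_Dl: "two_adic Dl"
  using two_adic_if_saturated[OF saturated_poly[OF level_one.monom[of 1 1 0]]] two_adic_if_saturated[OF saturated_poly[OF level_one.monom[of 1 0 1]]] by simp_all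

lemma two_adic_mult: "two_adic f \<Longrightarrow> two_adic g \<Longrightarrow> two_adic (f * g)"
  unfolding two_adic_def using saturated_mult ceq_mult by meson

lemma two_adic_add: "two_adic f \<Longrightarrow> two_adic g \<Longrightarrow> two_adic (f + g)"
  unfolding two_adic_def using saturated_add ceq_add by meson

lemma two_adic_diff: "two_adic f \<Longrightarrow> two_adic g \<Longrightarrow> two_adic (f - g)"
  using two_adic_add[OF _ two_adic_mult[OF two_adic_of_int[of "-1"]], of f g] by simp

lemma two_adic_power: "two_adic f \<Longrightarrow> two_adic (f ^ n)"
  by (induction n) (auto intro: two_adic_mult)

lemma two_adic_limit:
  assumes "\<And>k. \<exists>h. two_adic h \<and> ceq (2 ^ k) g h"
  shows "two_adic g"
  unfolding two_adic_def using assms ceq_trans unfolding two_adic_def by meson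

text \<open>Hensel-type lifting: a map that halves the 2-adic distance to its fixed point.\<close>
lemma two_adic_iterate:
  assumes "\<And>h. two_adic h \<Longrightarrow> two_adic (F h)" and "\<And>h. \<exists>r. g - F h = 2 * (g - h) * r"
  shows "two_adic g"
proof (rule two_adic_limit)
  fix k
  show "\<exists>h. two_adic h \<and> ceq (2 ^ k) g h"
  proof (induction k)
    case 0
    show ?case by (intro exI[of _ 0]) (auto simp: ceq_def)
  next
    case (Suc k)
    then obtain h where h: "two_adic h" "ceq (2 ^ k) g h" by blast
    then obtain d where d: "g - h = of_int (2 ^ k) * d" unfolding ceq_iff by blast
    obtain r where r: "g - F h = 2 * (g - h) * r" using assms(2) by blast
    have "g - F h = of_int (2 ^ Suc k) * (d * r)" unfolding r d by (simp add: mult_ac)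
    thus ?case using assms(1)[OF h(1)] unfolding ceq_iff by blast
  qed
qed

text \<open>An approximant h to 2g modulo 2^(k+1) has even coefficients, so h/2 is integral and
  again saturated. Closure under exact division by 2 is the purpose of the denominators in
  \<open>saturated\<close>.\<close>

lemma two_adic_half:
  assumes "two_adic (2 * g)"
  shows "two_adic g"
  unfolding two_adic_def
proof
  fix k
  obtain h where h: "saturated h" "ceq (2 ^ Suc k) (2 * g) h" using assms unfolding two_adic_def by blast
  then obtain d where d: "2 * g - h = of_int (2 ^ Suc k) * d" unfolding ceq_iff by blast
  define h' where "h' = g - of_int (2 ^ k) * d"
  have "2 * h' = h" unfolding h'_def using d by (simp add: algebra_simps)
  then obtain s where "of_int (2 ^ s) * (2 * h') \<in> level_one" using h unfolding saturated_def by blast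
  hence "of_int (2 ^ Suc s) * h' \<in> level_one" by (simp add: mult_ac)
  hence "saturated h'" unfolding saturated_def by blast
  moreover have "ceq (2 ^ k) g h'" unfolding ceq_iff h'_def by (intro exI[of _ d]) simp
  ultimately show "\<exists>h. saturated h \<and> ceq (2 ^ k) g h" by blast
qed

lemma two_adic_eighth: "two_adic (8 * g) \<Longrightarrow> two_adic g"
proof -
  assume "two_adic (8 * g)"
  moreover have "8 * g = 2 * (2 * (2 * g))" by simp
  ultimately show "two_adic g" using two_adic_half by metis
qed

lemma two_adic_quarter: "two_adic (4 * g) \<Longrightarrow> two_adic g"
proof -
  assume "two_adic (4 * g)"
  moreover have "4 * g = 2 * (2 * g)" by simp
  ultimately show "two_adic g" using two_adic_half by metis
qed

lemma ceq_numD: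
  assumes "ceq (numeral N) f g"
  obtains d where "f = g + numeral N * d"
  using assms unfolding ceq_iff by (metis add.commute diff_add_cancel of_int_numeral)

lemma ceq_numI: "f = g + numeral N * d \<Longrightarrow> ceq (numeral N) f g"
  unfolding ceq_iff by (intro exI[of _ d]) simp

lemma two_adic_inverse:
  assumes "two_adic u" "ceq 2 u 1" "u * w = 1"
  shows "two_adic w"
proof (rule two_adic_iterate[where F = "\<lambda>h. h + (1 - u * h)"])
  fix h assume "two_adic h"
  thus "two_adic (h + (1 - u * h))" using assms by (intro two_adic_add two_adic_diff two_adic_mult) auto
next
  fix h
  obtain d where d: "u = 1 + 2 * d" using assms(2) by (rule ceq_numD)
  have "w - (h + (1 - u * h)) = 2 * (w - h) * (- d)"
    unfolding assms(3)[symmetric] unfolding d by (simp add: algebra_simps)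
  thus "\<exists>r. w - (h + (1 - u * h)) = 2 * (w - h) * r" by blast
qed

text \<open>With g = g' + 4D, D solves g' D + 2 D^2 = (g^2 - g'^2)/8. The linear coefficient is 1
  modulo 2 and the quadratic one is even, which makes the iteration contract. Knowing g only modulo
  2 would leave the quadratic coefficient 1 instead.\<close>

lemma two_adic_sqrt:
  assumes "two_adic g'" "ceq 2 g' 1" "ceq 4 g g'" "two_adic (g ^ 2)"
  shows "two_adic g"
proof -
  obtain r where r: "g' = 1 + 2 * r" using assms(2) by (rule ceq_numD)
  obtain D where D: "g = g' + 4 * D" using assms(3) by (rule ceq_numD)
  define y where "y = g' * D + 2 * D ^ 2"
  have "8 * y = g ^ 2 - g' ^ 2" unfolding y_def D by (simp add: power2_eq_square algebra_simps)
  hence "two_adic (8 * y)" using assms by (simp add: two_adic_diff two_adic_power)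
  hence y: "two_adic y" by (rule two_adic_eighth)
  have "two_adic D"
  proof (rule two_adic_iterate[where F = "\<lambda>h. h + (y - g' * h - 2 * h ^ 2)"])
    fix h assume "two_adic h"
    thus "two_adic (h + (y - g' * h - 2 * h ^ 2))" using assms y by (intro two_adic_add two_adic_diff two_adic_mult two_adic_power) auto
  next
    fix h
    have "D - (h + (y - g' * h - 2 * h ^ 2)) = 2 * (D - h) * (- r - D - h)"
      unfolding y_def r by (simp add: power2_eq_square algebra_simps)
    thus "\<exists>r. D - (h + (y - g' * h - 2 * h ^ 2)) = 2 * (D - h) * r" by blast
  qed
  thus ?thesis unfolding D using assms by (intro two_adic_add two_adic_mult) auto
qed

text \<open>Eliminating X^8 = E4 - 256 z from \<Delta> = z X^16 gives \<Delta> = z (E4 - 256 z)^2,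
  an equation for z = q psi^8 whose derivative in z is 1 modulo 2.\<close>

lemma two_adic_z: "two_adic (fps_X * psi ^ 8)"
proof -
  define z where "z = fps_X * psi ^ 8"
  obtain e where e: "E4 = 1 + 2 * e" using E4_ceq by (rule ceq_numD)
  have x: "alt phi ^ 8 = E4 - 256 * z" by (simp add: E4_def z_def)
  have "alt phi ^ 16 = (alt phi ^ 8) ^ 2" by (simp only: power_mult[symmetric]) simp
  hence D: "Dl = z * (E4 - 256 * z) ^ 2" unfolding Dl_def z_def[symmetric] x by simp
  have "two_adic z"
  proof (rule two_adic_iterate[where F = "\<lambda>h. h + (Dl - h * (E4 - 256 * h) ^ 2)"])
    fix h assume "two_adic h"
    thus "two_adic (h + (Dl - h * (E4 - 256 * h) ^ 2))" by (intro two_adic_add two_adic_diff two_adic_mult two_adic_power two_adic_E4 two_adic_Dl) auto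
  next
    fix h
    have "z - (h + (Dl - h * (E4 - 256 * h) ^ 2)) = 2 * (z - h) * (- 2 * ((e + e ^ 2) - 128 * (1 + 2 * e) * (z + h) + 16384 * (z ^ 2 + z * h + h ^ 2)))"
      unfolding D e by (simp add: power2_eq_square algebra_simps)
    thus "\<exists>r. z - (h + (Dl - h * (E4 - 256 * h) ^ 2)) = 2 * (z - h) * r" by blast
  qed
  thus ?thesis by (simp add: z_def)
qed

lemma ceq_square: "ceq 2 X 1 \<Longrightarrow> ceq 4 (X ^ 2) 1"
proof -
  assume "ceq 2 X 1"
  then obtain S where S: "X = 1 + 2 * S" by (rule ceq_numD)
  show ?thesis unfolding S by (rule ceq_numI[where d = "S + S ^ 2"]) (simp add: power2_eq_square algebra_simps)
qed

lemma two_adic_sqrt_one: "ceq 4 g 1 \<Longrightarrow> two_adic (g ^ 2) \<Longrightarrow> two_adic g"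
  by (rule two_adic_sqrt[of 1]) auto

text \<open>X^4 and X^2 are 1 modulo 4, so two square roots can be extracted. The descent stops at
  X^2, since X is known only modulo 2.\<close>

lemma two_adic_descend:
  assumes "ceq 2 X 1" "two_adic (X ^ 8)"
  shows "two_adic (X ^ 4)" "two_adic (X ^ 2)"
proof -
  have 2: "ceq 4 (X ^ 2) 1" by (rule ceq_square[OF assms(1)])
  have 4: "ceq 4 (X ^ 4) 1" using ceq_power[OF 2, of 2] by (simp flip: power_mult)
  show "two_adic (X ^ 4)" by (rule two_adic_sqrt_one[OF 4]) (use assms in \<open>simp flip: power_mult\<close>)
  thus "two_adic (X ^ 2)" by (intro two_adic_sqrt_one[OF 2]) (simp flip: power_mult)
qed

abbreviation "XX \<equiv> alt phi"
abbreviation "YY \<equiv> dil 2 (alt phi)"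

lemma YY_ceq: "ceq 2 YY 1"
proof -
  have "dil 2 1 = 1" by (simp add: dil_def)
  thus ?thesis using ceq_dil[OF _ alt_phi_ceq, of 2] by simp
qed

lemma two_adic_X: "two_adic (XX ^ 4)" "two_adic (XX ^ 2)"
proof -
  have "XX ^ 8 = E4 - 256 * (fps_X * psi ^ 8)" by (simp add: E4_def)
  hence "two_adic (XX ^ 8)" by (simp only:) (intro two_adic_diff two_adic_mult two_adic_E4 two_adic_z, simp)
  thus "two_adic (XX ^ 4)" "two_adic (XX ^ 2)" using two_adic_descend[OF alt_phi_ceq] by blast+
qed

text \<open>Put w = q psi(q^2)^4. Jacobi's identity reads phi^4 = X^4 + 16 w, and the fourth power
  of psi^2 = psi(q^2) phi gives q psi^8 = w (X^4 + 16 w), which determines w 2-adically.\<close>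

lemma two_adic_phi4: "two_adic (phi ^ 4)"
proof -
  define w where "w = fps_X * dil 2 psi ^ 4"
  have p4: "phi ^ 4 = XX ^ 4 + 16 * w" unfolding w_def by (rule jacobi_fps)
  obtain r where r: "XX ^ 4 = 1 + 2 * r" using ceq_power[OF alt_phi_ceq, of 4] by (auto intro: ceq_numD)
  define z where "z = fps_X * psi ^ 8"
  have "psi ^ 8 = (psi ^ 2) ^ 4" by (simp flip: power_mult)
  hence z: "z = w * (XX ^ 4 + 16 * w)" unfolding p4[symmetric] z_def unfolding w_def psi_square by (simp add: power_mult_distrib mult_ac)
  have "two_adic w"
  proof (rule two_adic_iterate[where F = "\<lambda>h. h + (z - h * (XX ^ 4 + 16 * h))"])
    fix h assume "two_adic h"
    moreover have "two_adic z" unfolding z_def by (rule two_adic_z)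
    ultimately show "two_adic (h + (z - h * (XX ^ 4 + 16 * h)))" by (intro two_adic_add two_adic_diff two_adic_mult two_adic_X two_adic_numeral)
  next
    fix h
    have "w - (h + (z - h * (XX ^ 4 + 16 * h))) = 2 * (w - h) * (- r - 8 * (w + h))"
      unfolding z r by (simp add: algebra_simps)
    thus "\<exists>r. w - (h + (z - h * (XX ^ 4 + 16 * h))) = 2 * (w - h) * r" by blast
  qed
  thus ?thesis unfolding p4 by (intro two_adic_add two_adic_mult two_adic_X) auto
qed

lemma two_adic_Y2: "two_adic (YY ^ 2)"
proof (rule two_adic_descend(2)[OF YY_ceq])
  have "YY ^ 8 = (YY ^ 2) ^ 4" by (simp flip: power_mult)
  also have "\<dots> = XX ^ 4 * phi ^ 4" unfolding phi_duplication_fps by (rule power_mult_distrib)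
  finally show "two_adic (YY ^ 8)" by (simp only: two_adic_mult two_adic_X two_adic_phi4)
qed

text \<open>The value modulo 4 needed for the square root comes from Frobenius. With X = 1 + 2S one
  has Y = 1 + 2S(q^2), and S(q^2) = S^2 modulo 2, so X Y is 1 + 2(S + S^2) modulo 4; here S + S^2 =
  (X^2 - 1)/4 is already available.\<close>

lemma two_adic_XY: "two_adic (XX * YY)"
proof -
  obtain S where S: "XX = 1 + 2 * S" using alt_phi_ceq by (rule ceq_numD)
  have d2: "YY = 1 + 2 * dil 2 S"
  proof (rule fps_ext)
    fix n show "fps_nth YY n = fps_nth (1 + 2 * dil 2 S) n"
    proof -
      have n2: "fps_nth (2 * h) n = 2 * fps_nth h n" for h :: "int fps" and n by (rule fps_mult_numeral_left)
      show ?thesis unfolding S by (auto simp: dil_nth n2 fps_one_nth)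
    qed
  qed
  obtain d where d: "dil 2 S = S ^ 2 + 2 * d" using ceq_sym[OF square_ceq_dil] by (rule ceq_numD)
  define a where "a = S + S ^ 2"
  have "4 * a = XX ^ 2 - 1" unfolding S a_def by (simp add: power2_eq_square algebra_simps)
  hence "two_adic (4 * a)" by (simp only:) (intro two_adic_diff two_adic_X two_adic_numeral)
  hence a: "two_adic a" by (rule two_adic_quarter)
  show ?thesis
  proof (rule two_adic_sqrt[where g' = "1 + 2 * a"])
    show "two_adic (1 + 2 * a)" using a by (intro two_adic_add two_adic_mult) auto
    show "ceq 2 (1 + 2 * a) 1" by (rule ceq_numI) simp
    show "ceq 4 (XX * YY) (1 + 2 * a)"
    proof (rule ceq_numI[where d = "d + S * dil 2 S"])
      have "YY = 1 + 2 * (S ^ 2 + 2 * d)" unfolding d2 d ..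
      hence "XX * YY = XX * (1 + 2 * (S ^ 2 + 2 * d))" by (rule arg_cong)
      also have "\<dots> = (1 + 2 * S) * (1 + 2 * (S ^ 2 + 2 * d))" by (simp only: S)
      also have "\<dots> = 1 + 2 * a + 4 * (d + S * (S ^ 2 + 2 * d))" unfolding a_def by (simp add: algebra_simps)
      finally show "XX * YY = 1 + 2 * a + 4 * (d + S * dil 2 S)" unfolding d .
    qed
    show "two_adic ((XX * YY) ^ 2)" unfolding power_mult_distrib by (intro two_adic_mult two_adic_X two_adic_Y2)
  qed
qed

theorem two_adic_generating:
  assumes "even c" "c > 0" "G * (XX * YY ^ (c - 1)) = 1"
  shows "two_adic G"
proof -
  obtain d where d: "c = 2 * d" "d > 0" using assms by auto
  \<comment> \<open>Since c - 1 is odd, one factor Y can be paired with X and the others with each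
    other.\<close>
  have "c - 1 = Suc (2 * (d - 1))" using d by simp
  hence Y: "YY ^ (c - 1) = YY * (YY ^ 2) ^ (d - 1)" by (simp add: power_mult)
  have e: "XX * YY ^ (c - 1) = (XX * YY) * (YY ^ 2) ^ (d - 1)" unfolding Y by (simp only: mult.assoc)
  have "two_adic (XX * YY ^ (c - 1))" unfolding e by (intro two_adic_mult two_adic_XY two_adic_power two_adic_Y2)
  moreover have "ceq 2 (XX * YY ^ (c - 1)) (1 * 1 ^ (c - 1))" by (intro ceq_mult ceq_power alt_phi_ceq YY_ceq)
  hence "ceq 2 (XX * YY ^ (c - 1)) 1" by (simp only: power_one mult_1_left)
  moreover have "XX * YY ^ (c - 1) * G = 1" using assms(3) by (simp only: mult.commute)
  ultimately show ?thesis by (rule two_adic_inverse)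
qed

section \<open>From 2-adic limits to divisibility of coefficients\<close>

definition many_exact :: "nat \<Rightarrow> nat \<Rightarrow> bool" where
  "many_exact N n \<longleftrightarrow> (\<exists>ps n'. distinct ps \<and> set ps \<subseteq> Pset \<and> length ps \<ge> N \<and> n' > 0 \<and> n = prod_list ps * n' \<and> (\<forall>p\<in>set ps. \<not> p dvd n'))"

lemma level_one_coeff_dvd:
  assumes "f \<in> level_one"
  shows "\<exists>N. \<forall>n. many_exact N n \<longrightarrow> (2::int) ^ K dvd fps_nth f n"
  using assms
proof (induction f rule: level_one.induct)
  case (monom c a b)
  show ?case
  proof (cases "a = 0 \<and> b = 0")
    \<comment> \<open>Constants have weight 0, which \<open>basis_form_coeff_divisible\<close> does
      not cover. They affect only the coefficient at n = 0, and \<open>many_exact\<close> forces n >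
      0.\<close>
    case True
    have "fps_nth (of_int c * (E4 ^ a * Dl ^ b)) n = 0" if "many_exact 0 n" for n
    proof -
      have "n > 0" using that unfolding many_exact_def Pset_def by (auto simp: prime_gt_0_nat subset_iff prod_list_zero_iff intro!: Nat.gr0I)
      thus ?thesis using True by (simp add: fps_one_nth)
    qed
    thus ?thesis by (metis dvd_0_right)
  next
    case False
    define m where "m = a + 3 * b"
    have m: "m > 0" "3 * b \<le> m" using False by (auto simp: m_def)
    have basis_form: "basis_form m b = E4 ^ a * Dl ^ b" by (simp add: basis_form_def m_def)
    have "(2::int) ^ K dvd fps_nth (of_int c * (E4 ^ a * Dl ^ b)) n" if "many_exact (b + 1 + (K - 1) * (m div 3 + 1)) n" for n
    proof -
      from that obtain ps n' where ps: "distinct ps" "set ps \<subseteq> Pset" "length ps \<ge> b + 1 + (K - 1) * (m div 3 + 1)"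
         "n = prod_list ps * n'" "\<forall>p\<in>set ps. \<not> p dvd n'" unfolding many_exact_def by blast
      have "(2::int) ^ K dvd fps_nth (basis_form m b) n" unfolding ps(4)
        by (rule basis_form_coeff_divisible[OF m ps(1,2,5)]) (use ps(3) in blast)
      thus ?thesis unfolding basis_form by simp
    qed
    thus ?thesis by blast
  qed
next
  case (add f g)
  then obtain N M where N: "\<And>n. many_exact N n \<Longrightarrow> (2::int) ^ K dvd fps_nth f n" "\<And>n. many_exact M n \<Longrightarrow> (2::int) ^ K dvd fps_nth g n" by blast
  have mono: "many_exact N n" "many_exact M n" if "many_exact (max N M) n" for n
    using that unfolding many_exact_def by auto
  show ?case using N mono by (intro exI[of _ "max N M"]) (auto intro: dvd_add)
qed

theorem two_adic_coeff_dvd: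
  assumes "two_adic g"
  shows "\<exists>N. \<forall>n. many_exact N n \<longrightarrow> (2::int) ^ k dvd fps_nth g n"
proof -
  obtain h where h: "saturated h" "ceq (2 ^ k) g h" using assms unfolding two_adic_def by blast
  obtain s where s: "of_int (2 ^ s) * h \<in> level_one" using h unfolding saturated_def by blast
  \<comment> \<open>The exponent s + k leaves k factors of 2 once the denominator 2^s is
    cancelled.\<close>
  obtain N where N: "\<And>n. many_exact N n \<Longrightarrow> (2::int) ^ (s + k) dvd fps_nth (of_int (2 ^ s) * h) n"
    using level_one_coeff_dvd[OF s] by blast
  have "(2::int) ^ k dvd fps_nth g n" if "many_exact N n" for n
  proof -
    have "(2::int) ^ s * 2 ^ k dvd 2 ^ s * fps_nth h n" using N[OF that] unfolding of_int_mult_nth by (simp only: power_add)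
    hence "(2::int) ^ k dvd fps_nth h n" by simp
    moreover have "(2::int) ^ k dvd fps_nth g n - fps_nth h n" using h(2) by (simp add: ceq_def)
    ultimately show ?thesis by (metis dvd_add diff_add_cancel)
  qed
  thus ?thesis by blast
qed

section \<open>The generating function\<close>

lemma geom_inverse: "d > 0 \<Longrightarrow> geom d * (1 - fps_X ^ d) = 1"
proof (rule fps_ext)
  fix n assume d: "d > 0"
  have "fps_nth (geom d * (1 - fps_X ^ d)) n = fps_nth (geom d) n - fps_nth (geom d * fps_X ^ d) n"
    by (simp add: right_diff_distrib)
  also have "\<dots> = fps_nth 1 n"
  proof (cases "n < d")
    case True
    thus ?thesis by (auto simp: geom_def fps_X_power_mult_right_nth dest: dvd_imp_le)
  next
    case False
    hence "d dvd n \<longleftrightarrow> d dvd n - d" by (metis dvd_minus_self not_less_iff_gr_or_eq linorder_not_less)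
    thus ?thesis using False d by (auto simp: geom_def fps_X_power_mult_right_nth)
  qed
  finally show "fps_nth (geom d * (1 - fps_X ^ d)) n = fps_nth 1 n" .
qed

lemma finv_trunc_inverse: "k > 0 \<Longrightarrow> finv_trunc k N * f_trunc k N = 1"
  unfolding finv_trunc_def f_trunc_def prod.distrib[symmetric]
  by (rule prod.neutral) (auto intro!: geom_inverse)

lemma finv_trunc_feq:
  assumes "k > 0" "N \<le> N'"
  shows "feq N (finv_trunc k N') (finv_trunc k N)"
proof -
  have "feq N (finv_trunc k N' * (f_trunc k N * finv_trunc k N)) (finv_trunc k N' * (f_trunc k N' * finv_trunc k N))"
    using assms by (intro feq_mult feq_refl feq_sym[OF f_trunc_feq]) auto
  moreover have "finv_trunc k N' * (f_trunc k N * finv_trunc k N) = finv_trunc k N'"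
    using finv_trunc_inverse[OF assms(1), of N] by (simp add: mult.commute)
  moreover have "finv_trunc k N' * (f_trunc k N' * finv_trunc k N) = finv_trunc k N"
    using finv_trunc_inverse[OF assms(1), of N'] by (simp add: mult.assoc[symmetric])
  ultimately show ?thesis by simp
qed

definition gen_trunc :: "nat \<Rightarrow> nat \<Rightarrow> int fps" where
  "gen_trunc c n = f_trunc 4 n ^ (c - 1) * finv_trunc 1 n ^ 2 * finv_trunc 2 n ^ (2 * c - 3)"

lemma gen_feq:
  assumes "c \<ge> 2"
  shows "feq n (Abs_fps (overcubic c)) (gen_trunc c n)"
  unfolding feq_def
proof (intro allI impI)
  fix i assume i: "i \<le> n"
  have "feq i (gen_trunc c n) (gen_trunc c i)" unfolding gen_trunc_def
    using i by (intro feq_mult feq_power f_trunc_feq finv_trunc_feq) auto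
  moreover have "overcubic c i = fps_nth (gen_trunc c i) i" using assms by (simp add: overcubic_def gen_trunc_def)
  ultimately show "fps_nth (Abs_fps (overcubic c)) i = fps_nth (gen_trunc c n) i" by (simp add: feq_def)
qed

lemma gen_euler:
  assumes "c \<ge> 2"
  shows "Abs_fps (overcubic c) * (eulerf 1 ^ 2 * eulerf 2 ^ (2 * c - 3)) = eulerf 4 ^ (c - 1)"
proof (rule fps_ext)
  fix n
  have "feq n (Abs_fps (overcubic c) * (eulerf 1 ^ 2 * eulerf 2 ^ (2 * c - 3))) (gen_trunc c n * (f_trunc 1 n ^ 2 * f_trunc 2 n ^ (2 * c - 3)))"
    using assms by (intro feq_mult feq_power gen_feq eulerf_feq) auto
  also have "gen_trunc c n * (f_trunc 1 n ^ 2 * f_trunc 2 n ^ (2 * c - 3))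
      = f_trunc 4 n ^ (c - 1) * (finv_trunc 1 n * f_trunc 1 n) ^ 2 * (finv_trunc 2 n * f_trunc 2 n) ^ (2 * c - 3)"
    unfolding gen_trunc_def power_mult_distrib by (simp only: mult_ac)
  also have "\<dots> = f_trunc 4 n ^ (c - 1)" by (simp only: finv_trunc_inverse zero_less_one zero_less_numeral power_one mult_1_right)
  also have "feq n (f_trunc 4 n ^ (c - 1)) (eulerf 4 ^ (c - 1))" by (intro feq_power feq_sym[OF eulerf_feq]) simp
  finally show "fps_nth (Abs_fps (overcubic c) * (eulerf 1 ^ 2 * eulerf 2 ^ (2 * c - 3))) n = fps_nth (eulerf 4 ^ (c - 1)) n"
    by (simp only: feq_def order_refl)
qed

lemma dil_one_minus: "k > 0 \<Longrightarrow> dil k (1 - fps_X ^ j) = 1 - fps_X ^ (k * j)"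
  unfolding dil_def by (simp add: fps_compose_sub_distrib fps_X_power_compose power_mult)

lemma dil_f_trunc: "dil 2 (f_trunc k N) = f_trunc (2 * k) N"
proof (induction N)
  case 0
  show ?case by (simp add: f_trunc_def dil_def)
next
  case (Suc N)
  have "f_trunc k (Suc N) = f_trunc k N * (1 - fps_X ^ (k * Suc N))" for k by (simp add: f_trunc_def)
  thus ?case using Suc by (simp only: dil_mult dil_one_minus zero_less_numeral mult.assoc)
qed

lemma dil_eulerf:
  assumes "k > 0"
  shows "dil 2 (eulerf k) = eulerf (2 * k)"
proof (rule fps_ext)
  fix n
  have "feq n (eulerf k) (f_trunc k n)" using assms by (intro eulerf_feq) simp
  hence "feq n (dil 2 (eulerf k)) (dil 2 (f_trunc k n))" by (auto simp: feq_def dil_nth)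
  also have "dil 2 (f_trunc k n) = f_trunc (2 * k) n" by (rule dil_f_trunc)
  also have "feq n (f_trunc (2 * k) n) (eulerf (2 * k))" using assms by (intro feq_sym[OF eulerf_feq]) simp
  finally show "fps_nth (dil 2 (eulerf k)) n = fps_nth (eulerf (2 * k)) n" by (simp add: feq_def)
qed

lemma eulerf_nonzero: "k > 0 \<Longrightarrow> eulerf k \<noteq> 0"
proof
  assume "k > 0" "eulerf k = 0"
  moreover have "fps_nth (eulerf k) 0 = 1" by (simp add: eulerf_def f_trunc_def)
  ultimately show False by simp
qed

text \<open>Gauss's formula at q and at q^2 shows that, multiplied by f_2 f_4^(c-1), the left side
  is G f_1^2 f_2^(2c-2) with G the generating function. By \<open>gen_euler\<close> this is again
  f_2 f_4^(c-1), which can be cancelled.\<close>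

theorem gen_theta:
  assumes "c \<ge> 2"
  shows "Abs_fps (overcubic c) * (alt phi * dil 2 (alt phi) ^ (c - 1)) = 1"
proof -
  define G where "G = Abs_fps (overcubic c)"
  have g1: "alt phi * eulerf 2 = eulerf 1 ^ 2" by (rule gauss_phi)
  have g2: "dil 2 (alt phi) * eulerf 4 = eulerf 2 ^ 2"
    using arg_cong[OF g1, of "dil 2"] by (simp add: dil_mult dil_power dil_eulerf)
  have e: "2 * (c - 1) = (2 * c - 3) + 1" using assms by simp
  have "G * (alt phi * dil 2 (alt phi) ^ (c - 1)) * (eulerf 2 * eulerf 4 ^ (c - 1))
     = G * ((alt phi * eulerf 2) * (dil 2 (alt phi) * eulerf 4) ^ (c - 1))"
    unfolding power_mult_distrib by (simp only: mult_ac)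
  also have "\<dots> = G * (eulerf 1 ^ 2 * eulerf 2 ^ (2 * c - 3)) * eulerf 2"
    unfolding g1 g2 power_mult[symmetric] e power_add by (simp only: mult_ac power_one_right)
  also have "\<dots> = 1 * (eulerf 2 * eulerf 4 ^ (c - 1))"
    unfolding G_def gen_euler[OF assms] by (simp only: mult_ac mult_1_left)
  finally show ?thesis unfolding G_def by (rule mult_right_cancel[THEN iffD1, rotated]) (simp add: eulerf_nonzero)
qed

section \<open>Density of the integers with many exact prime divisors\<close>

lemma sum_crt:
  fixes f g :: "nat \<Rightarrow> real"
  assumes "coprime L q" "L > 0" "q > 0"
  shows "(\<Sum>n<L * q. f (n mod L) * g (n mod q)) = (\<Sum>a<L. f a) * (\<Sum>b<q. g b)"
proof -
  have inj: "inj_on (\<lambda>n. (n mod L, n mod q)) {..<L * q}"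
  proof (rule inj_onI)
    fix x y assume xy: "x \<in> {..<L * q}" "y \<in> {..<L * q}" "(x mod L, x mod q) = (y mod L, y mod q)"
    hence "[x = y] (mod L)" "[x = y] (mod q)" by (auto simp: cong_def)
    hence "[x = y] (mod (L * q))" using assms(1) by (rule coprime_cong_mult_nat)
    thus "x = y" using xy by (simp add: cong_def)
  qed
  have sub: "(\<lambda>n. (n mod L, n mod q)) ` {..<L * q} \<subseteq> {..<L} \<times> {..<q}" using assms by auto
  have "card ((\<lambda>n. (n mod L, n mod q)) ` {..<L * q}) = card ({..<L} \<times> {..<q})"
    by (simp add: card_image[OF inj] card_cartesian_product)
  hence im: "(\<lambda>n. (n mod L, n mod q)) ` {..<L * q} = {..<L} \<times> {..<q}" using sub by (intro card_subset_eq) auto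
  have "(\<Sum>a<L. f a) * (\<Sum>b<q. g b) = (\<Sum>(a,b)\<in>{..<L} \<times> {..<q}. f a * g b)"
    by (simp add: sum_product sum.cartesian_product)
  also have "\<dots> = (\<Sum>n<L * q. f (n mod L) * g (n mod q))"
    unfolding im[symmetric] by (subst sum.reindex[OF inj]) (simp add: o_def)
  finally show ?thesis ..
qed

text \<open>The Chinese remainder theorem turns a sum over a full period into a product of local
  sums. The modulus L is kept apart to carry an additional condition: the residue 3 modulo 8 in the
  sieve, and none (L = 1) in the density estimate.\<close>

lemma sum_crt_prod:
  fixes f :: "nat \<Rightarrow> real" and g :: "nat \<Rightarrow> nat \<Rightarrow> real" and Q :: "nat \<Rightarrow> nat"
  assumes "finite F" "L > 0" "\<And>p. p \<in> F \<Longrightarrow> Q p > 0" "\<And>p. p \<in> F \<Longrightarrow> coprime L (Q p)"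
    "\<And>p r. p \<in> F \<Longrightarrow> r \<in> F \<Longrightarrow> p \<noteq> r \<Longrightarrow> coprime (Q p) (Q r)"
  shows "(\<Sum>n<L * (\<Prod>p\<in>F. Q p). f (n mod L) * (\<Prod>p\<in>F. g p (n mod Q p))) = (\<Sum>a<L. f a) * (\<Prod>p\<in>F. \<Sum>b<Q p. g p b)"
  using assms
proof (induction F rule: finite_induct)
  case empty
  show ?case by simp
next
  case (insert r F)
  define M where "M = L * (\<Prod>p\<in>F. Q p)"
  have M: "M > 0" unfolding M_def using insert.prems by (auto intro!: prod_pos)
  have co: "coprime M (Q r)" unfolding M_def using insert.prems insert.hyps
    by (intro coprime_mult_left_iff[THEN iffD2] conjI prod_coprime_left) auto
  define h where "h = (\<lambda>n. f (n mod L) * (\<Prod>p\<in>F. g p (n mod Q p)))"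
  have hM: "h (n mod M) = h n" for n
  proof -
    have "n mod M mod L = n mod L" unfolding M_def by (simp add: mod_mod_cancel)
    moreover have "n mod M mod Q p = n mod Q p" if "p \<in> F" for p
      unfolding M_def using that insert.hyps by (intro mod_mod_cancel dvd_mult dvd_prodI)
    ultimately show ?thesis unfolding h_def by simp
  qed
  have "(\<Sum>n<L * (\<Prod>p\<in>insert r F. Q p). f (n mod L) * (\<Prod>p\<in>insert r F. g p (n mod Q p)))
     = (\<Sum>n<M * Q r. h (n mod M) * g r (n mod Q r))"
  proof -
    have "L * (\<Prod>p\<in>insert r F. Q p) = M * Q r" unfolding M_def using insert.hyps by (simp add: mult_ac)
    moreover have "f (n mod L) * (\<Prod>p\<in>insert r F. g p (n mod Q p)) = h (n mod M) * g r (n mod Q r)" for n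
      unfolding hM using insert.hyps by (simp add: h_def mult_ac)
    ultimately show ?thesis by simp
  qed
  also have "\<dots> = (\<Sum>a<M. h a) * (\<Sum>b<Q r. g r b)"
    using insert.prems by (intro sum_crt co M) auto
  also have "(\<Sum>a<M. h a) = (\<Sum>a<L. f a) * (\<Prod>p\<in>F. \<Sum>b<Q p. g p b)"
    unfolding h_def M_def using insert.prems by (intro insert.IH) auto
  finally show ?case using insert.hyps by (simp add: mult_ac)
qed

lemma sum_blocks:
  fixes f :: "nat \<Rightarrow> real"
  assumes "\<And>n. f (n + L) = f n"
  shows "(\<Sum>n<L * T. f n) = real T * (\<Sum>n<L. f n)"
proof (induction T)
  case (Suc T)
  have per: "f (n + L * t) = f n" for n t
  proof (induction t)
    case (Suc t)
    have "f (n + L * Suc t) = f ((n + L * t) + L)" by (simp add: algebra_simps)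
    thus ?case using assms Suc by simp
  qed simp
  have "(\<Sum>n<L * Suc T. f n) = (\<Sum>n<L * T. f n) + (\<Sum>n\<in>{L * T..<L * T + L}. f n)"
  proof -
    have "{..<L * Suc T} = {..<L * T} \<union> {L * T..<L * T + L}" by auto
    moreover have "sum f ({..<L * T} \<union> {L * T..<L * T + L}) = sum f {..<L * T} + sum f {L * T..<L * T + L}"
      by (rule sum.union_disjoint) auto
    ultimately show ?thesis by (rule ssubst)
  qed
  also have "(\<Sum>n\<in>{L * T..<L * T + L}. f n) = (\<Sum>n<L. f n)"
  proof (rule sum.reindex_bij_witness[of _ "\<lambda>n. n + L * T" "\<lambda>n. n - L * T"])
    fix a assume "a \<in> {L * T..<L * T + L}"
    hence "a - L * T + L * T = a" by simp
    thus "f (a - L * T) = f a" using per[of "a - L * T" T] by simp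
  qed auto
  finally show ?case using Suc.IH by (simp add: algebra_simps)
qed simp

lemma sum_if_card: "finite A \<Longrightarrow> (\<Sum>n\<in>A. if P n then 1 else 0 :: real) = real (card {n \<in> A. P n})"
  using sum.inter_filter[of A "\<lambda>_. 1 :: real" P] by simp

section \<open>Divergence of the sum of reciprocals over \<open>Pset\<close>\<close>

lemma one_minus_ge_exp:
  fixes x :: real
  assumes "0 \<le> x" "x \<le> 1/2"
  shows "exp (- 2 * x) \<le> 1 - x"
proof -
  have "1 / (1 - x) \<le> 1 + 2 * x"
  proof -
    have "1 \<le> (1 + 2 * x) * (1 - x)" using assms mult_nonneg_nonneg[of x "1 - 2 * x"] by (simp add: algebra_simps)
    thus ?thesis using assms by (simp add: divide_le_eq)
  qed
  also have "\<dots> \<le> exp (2 * x)" by simp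
  finally have "1 \<le> exp (2 * x) * (1 - x)" using assms by (simp add: divide_le_eq)
  thus ?thesis by (simp add: exp_minus field_simps)
qed

lemma Pset_prime: "p \<in> Pset \<Longrightarrow> prime p" "p \<in> Pset \<Longrightarrow> p \<ge> 3"
proof -
  assume p: "p \<in> Pset"
  thus "prime p" by (simp add: Pset_def)
  hence "p \<ge> 2" by (rule prime_ge_2_nat)
  moreover have "p \<noteq> 2" using p by (auto simp: Pset_def)
  ultimately show "p \<ge> 3" by simp
qed

text \<open>A number whose prime factors are all 1 modulo 8 is itself 1 modulo 8, and the residue 3
  excludes this as well as the prime 2.\<close>

lemma has_Pset_factor:
  fixes n :: nat
  assumes "n mod 8 = 3"
  shows "\<exists>p\<in>Pset. p dvd n"
proof (rule ccontr)
  assume neg: "\<not> (\<exists>p\<in>Pset. p dvd n)"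
  have n0: "n > 0" "odd n" using assms by (auto intro!: Nat.gr0I) presburger
  have m: "\<forall>p\<in>#prime_factorization n. p mod 8 = 1"
  proof
    fix p assume "p \<in># prime_factorization n"
    hence "prime p" "p dvd n" by (auto simp: in_prime_factors_iff)
    moreover have "odd p" using \<open>p dvd n\<close> n0 by auto
    ultimately show "p mod 8 = 1" using neg by (auto simp: Pset_def)
  qed
  have "prod_mset M mod 8 = (1::nat)" if "\<forall>p\<in>#M. p mod 8 = 1" for M
    using that
  proof (induction M)
    case (add x M)
    have "(x * prod_mset M) mod 8 = ((x mod 8) * (prod_mset M mod 8)) mod 8" by (simp add: mod_mult_eq)
    thus ?case using add by simp
  qed simp
  hence "prod_mset (prime_factorization n) mod 8 = 1" using m by blast
  hence "n mod 8 = 1" using n0 by (simp add: prod_mset_prime_factorization_nat)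
  thus False using assms by simp
qed

lemma sieve_count:
  assumes "finite F" "\<And>p. p \<in> F \<Longrightarrow> prime p" "\<And>p. p \<in> F \<Longrightarrow> odd p"
  shows "(\<Sum>n<8 * (\<Prod>p\<in>F. p). (if n mod 8 = 3 then 1 else 0) * (\<Prod>p\<in>F. if n mod p = 0 then 0 else 1)) = (\<Prod>p\<in>F. real p - 1)"
proof -
  have c8: "coprime 8 p" if "p \<in> F" for p
  proof -
    have "coprime (2 ^ 3) p" using assms(3)[OF that] by (intro coprime_power_left_iff[THEN iffD2]) auto
    thus ?thesis by simp
  qed
  have cpr: "coprime p r" if "p \<in> F" "r \<in> F" "p \<noteq> r" for p r
    by (rule primes_coprime[OF assms(2)[OF that(1)] assms(2)[OF that(2)] that(3)])
  have pos: "p > 0" if "p \<in> F" for p using assms(2)[OF that] by (rule prime_gt_0_nat)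
  have L8: "(0::nat) < 8" by simp
  note S = sum_crt_prod[of F 8 "\<lambda>p. p" "\<lambda>a. if a = 3 then 1 else 0" "\<lambda>_ b. if b = 0 then 0 else 1"]
  have one: "(\<Sum>a<8::nat. if a = 3 then 1 else 0 :: real) = 1" by (simp add: sum.delta)
  have each: "(\<Sum>b<p. if b = 0 then 0 else 1 :: real) = real p - 1" if "p \<in> F" for p
  proof -
    have "(\<Sum>b<p. if b = 0 then 0 else 1 :: real) = (\<Sum>b<p. 1 - (if b = 0 then 1 else 0))" by (intro sum.cong) auto
    also have "\<dots> = real p - 1" using pos[OF that] by (simp add: sum_subtractf sum.delta)
    finally show ?thesis .
  qed
  have "(\<Sum>n<8 * (\<Prod>p\<in>F. p). (if n mod 8 = 3 then 1 else 0) * (\<Prod>p\<in>F. if n mod p = 0 then 0 else 1))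
      = (\<Sum>a<8::nat. if a = 3 then 1 else 0) * (\<Prod>p\<in>F. \<Sum>b<p. if b = 0 then 0 else 1 :: real)"
    by (rule S[OF assms(1) L8]) (fact pos c8 cpr)+
  also have "(\<Prod>p\<in>F. \<Sum>b<p. if b = 0 then 0 else 1 :: real) = (\<Prod>p\<in>F. real p - 1)"
    by (rule prod.cong[OF refl each])
  finally show ?thesis unfolding one by simp
qed

text \<open>Every n = 3 modulo 8 has a prime factor in the set. If the reciprocals were summable, sieving by finitely
  many of these primes would leave more such n than the remaining primes can account for.\<close>
lemma Pset_divergent: "\<exists>F. finite F \<and> F \<subseteq> Pset \<and> (\<Sum>p\<in>F. 1 / real p) > B"
proof (rule ccontr)
  assume "\<not> ?thesis"
  hence bd: "(\<Sum>p\<in>F. 1 / real p) \<le> B" if "finite F" "F \<subseteq> Pset" for F using that by (meson not_less)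
  define S where "S = {(\<Sum>p\<in>F. 1 / real p) | F. finite F \<and> F \<subseteq> Pset}"
  have S: "S \<noteq> {}" "bdd_above S" unfolding S_def using bd by (auto intro!: bdd_aboveI[of _ B])
  \<comment> \<open>A lower bound for the sieve product of the 1 - 1/p, since 1 - x \<ge> exp(-2x)
    for 0 \<le> x \<le> 1/2 and the reciprocals sum to at most B. In \<delta>/16 a factor 8
    compensates the density of one residue class modulo 8, and the remaining 2 leads to the
    contradiction \<delta> \<le> \<delta>/2.\<close>
  define \<delta> where "\<delta> = exp (- 2 * B)"
  have "\<delta> > 0" by (simp add: \<delta>_def)
  hence "Sup S - \<delta> / 16 < Sup S" by simp
  then obtain F where F: "finite F" "F \<subseteq> Pset" "(\<Sum>p\<in>F. 1 / real p) > Sup S - \<delta> / 16"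
    using less_cSup_iff[OF S] unfolding S_def by auto
  have tail: "(\<Sum>p\<in>E. 1 / real p) \<le> \<delta> / 16" if E: "finite E" "E \<subseteq> Pset - F" for E
  proof -
    have "(\<Sum>p\<in>F \<union> E. 1 / real p) \<in> S" unfolding S_def using E F by auto
    hence "(\<Sum>p\<in>F \<union> E. 1 / real p) \<le> Sup S" using S by (intro cSup_upper)
    moreover have "(\<Sum>p\<in>F \<union> E. 1 / real p) = (\<Sum>p\<in>F. 1 / real p) + (\<Sum>p\<in>E. 1 / real p)"
      using E F by (intro sum.union_disjoint) auto
    ultimately show ?thesis using F by simp
  qed
  define L where "L = 8 * (\<Prod>p\<in>F. p)"
  have Fp: "prime p" "p \<ge> 3" "odd p" if "p \<in> F" for p
  proof -
    have P: "p \<in> Pset" using that F(2) by blast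
    show "prime p" "p \<ge> 3" by (rule Pset_prime[OF P])+
    show "odd p" using P unfolding Pset_def by blast
  qed
  have "(\<Prod>p\<in>F. p) > 0" using Fp(1) prime_gt_0_nat by (intro prod_pos) blast
  hence L0: "L > 0" unfolding L_def by simp
  define W where "W = (\<lambda>n. (if n mod 8 = 3 then 1 else 0) * (\<Prod>p\<in>F. if n mod p = 0 then 0 else 1 :: real))"
  have sumW: "(\<Sum>n<L. W n) = (\<Prod>p\<in>F. real p - 1)"
    unfolding L_def W_def by (rule sieve_count) (use F(1) Fp in blast)+
  have prod_ge: "(\<Prod>p\<in>F. 1 - 1 / real p) \<ge> \<delta>"
  proof -
    have "\<delta> \<le> exp (- 2 * (\<Sum>p\<in>F. 1 / real p))" unfolding \<delta>_def using bd[OF F(1,2)] by simp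
    also have "\<dots> = (\<Prod>p\<in>F. exp (- 2 * (1 / real p)))" using F by (simp add: exp_sum[symmetric] sum_distrib_left)
    also have "\<dots> \<le> (\<Prod>p\<in>F. 1 - 1 / real p)"
    proof (intro prod_mono conjI one_minus_ge_exp)
      fix p assume "p \<in> F"
      thus "1 / real p \<le> 1 / 2" using Fp(2)[of p] by (simp add: field_simps)
    qed auto
    finally show ?thesis .
  qed
  have "real (L) * (\<delta> / 16) \<ge> (\<Sum>n<L. W n)"
  proof -
    \<comment> \<open>Every n < L that survives the sieve has a prime factor in \<open>Pset\<close>
      outside F, and this factor is at most n; so these finitely many primes account for all
      survivors.\<close>
    define E where "E = {p \<in> Pset - F. p < L}"
    have E: "finite E" "E \<subseteq> Pset - F" unfolding E_def by auto
    have "(\<Sum>n<L. W n) \<le> (\<Sum>n<L. \<Sum>p\<in>E. if p dvd n \<and> n > 0 then 1 else 0)"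
    proof (rule sum_mono)
      fix n assume n: "n \<in> {..<L}"
      define P where "P = (\<Prod>p\<in>F. if n mod p = 0 then 0 else 1 :: real)"
      have WP: "W n = (if n mod 8 = 3 then 1 else 0) * P" by (simp only: W_def P_def)
      show "W n \<le> (\<Sum>p\<in>E. if p dvd n \<and> n > 0 then 1 else 0)"
      proof (cases "n mod 8 = 3 \<and> (\<forall>p\<in>F. n mod p \<noteq> 0)")
        case True
        have n0: "n > 0" using True by (auto intro!: Nat.gr0I)
        obtain p where p: "p \<in> Pset" "p dvd n" using has_Pset_factor True by blast
        have "p \<notin> F" using True p by auto
        moreover have "p < L" using dvd_imp_le[OF p(2) n0] n by simp
        ultimately have pE: "p \<in> E" using p by (simp add: E_def)
        have "P = 1" unfolding P_def using True by (intro prod.neutral) auto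
        hence "W n = 1" using True unfolding WP by simp
        also have "1 = (\<Sum>p\<in>{p}. if p dvd n \<and> n > 0 then 1 else 0 :: real)" using p n0 by simp
        also have "\<dots> \<le> (\<Sum>p\<in>E. if p dvd n \<and> n > 0 then 1 else 0)" using pE E by (intro sum_mono2) auto
        finally show ?thesis .
      next
        case False
        have "P = 0" if "n mod 8 = 3"
          unfolding P_def using that False by (intro prod_zero F(1)) auto
        hence "W n = 0" unfolding WP by simp
        thus ?thesis by (simp add: sum_nonneg)
      qed
    qed
    also have "\<dots> = (\<Sum>p\<in>E. \<Sum>n<L. if p dvd n \<and> n > 0 then 1 else 0)" by (rule sum.swap)
    also have "\<dots> \<le> (\<Sum>p\<in>E. real L * (1 / real p))"
    proof (rule sum_mono)
      fix p assume "p \<in> E"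
      hence p: "p > 0" unfolding E_def using Pset_prime(2) by fastforce
      have "card {n \<in> {..<L}. p dvd n \<and> n > 0} \<le> card ((\<lambda>j. p * j) ` {1..L div p})"
      proof (rule card_mono)
        show "{n \<in> {..<L}. p dvd n \<and> n > 0} \<subseteq> (\<lambda>j. p * j) ` {1..L div p}"
        proof
          fix n assume "n \<in> {n \<in> {..<L}. p dvd n \<and> n > 0}"
          then obtain j where j: "n = p * j" "n < L" "n > 0" by auto
          hence "j \<ge> 1" by (cases j) auto
          moreover have "j \<le> L div p" using j p by (metis div_le_mono less_imp_le nonzero_mult_div_cancel_left not_gr0)
          ultimately show "n \<in> (\<lambda>j. p * j) ` {1..L div p}" using j by auto
        qed
      qed simp
      also have "\<dots> \<le> L div p" using card_image_le[of "{1..L div p}" "\<lambda>j. p * j"] by simp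
      finally have c1: "real (card {n \<in> {..<L}. p dvd n \<and> n > 0}) \<le> real (L div p)" by (rule of_nat_mono)
      have c2: "real (L div p) \<le> real L / real p" by (rule of_nat_div_le_of_nat)
      have "(\<Sum>n<L. if p dvd n \<and> n > 0 then 1 else 0 :: real) \<le> real L / real p"
        unfolding sum_if_card[OF finite_lessThan] using c1 c2 by (rule order_trans)
      thus "(\<Sum>n<L. if p dvd n \<and> n > 0 then 1 else 0 :: real) \<le> real L * (1 / real p)" unfolding times_divide_eq_right mult_1_right .
    qed
    also have "\<dots> = real L * (\<Sum>p\<in>E. 1 / real p)" by (simp add: sum_distrib_left)
    also have "\<dots> \<le> real L * (\<delta> / 16)" using tail[OF E] by (intro mult_left_mono) auto
    finally show ?thesis .
  qed
  hence "(\<Prod>p\<in>F. real p - 1) \<le> 8 * (\<Prod>p\<in>F. real p) * (\<delta> / 16)" unfolding sumW by (simp add: L_def)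
  also have "(\<Prod>p\<in>F. real p - 1) = (\<Prod>p\<in>F. real p) * (\<Prod>p\<in>F. 1 - 1 / real p)"
  proof -
    have "real p - 1 = real p * (1 - 1 / real p)" if "p \<in> F" for p
      using Fp(2)[OF that] by (simp add: field_simps)
    hence "(\<Prod>p\<in>F. real p - 1) = (\<Prod>p\<in>F. real p * (1 - 1 / real p))" by (intro prod.cong) auto
    thus ?thesis by (simp add: prod.distrib)
  qed
  finally have "(\<Prod>p\<in>F. real p) * (\<Prod>p\<in>F. 1 - 1 / real p) \<le> 8 * (\<Prod>p\<in>F. real p) * (\<delta> / 16)" .
  moreover have "8 * x * (\<delta> / 16) = x * (\<delta> / 2)" for x by simp
  ultimately have "(\<Prod>p\<in>F. real p) * (\<Prod>p\<in>F. 1 - 1 / real p) \<le> (\<Prod>p\<in>F. real p) * (\<delta> / 2)" by (simp only:)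
  moreover have "(\<Prod>p\<in>F. real p) > 0" using Fp(1) prime_gt_0_nat by (intro prod_pos) auto
  ultimately have "(\<Prod>p\<in>F. 1 - 1 / real p) \<le> \<delta> / 2" by (rule mult_left_le_imp_le)
  thus False using prod_ge \<open>\<delta> > 0\<close> by linarith
qed

section \<open>Integers with few exact prime divisors\<close>

definition exactly_div :: "nat \<Rightarrow> nat \<Rightarrow> bool" where "exactly_div p n \<longleftrightarrow> p dvd n \<and> \<not> p\<^sup>2 dvd n"

lemma exactly_div_mod: "exactly_div p (n mod p\<^sup>2) \<longleftrightarrow> exactly_div p n"
  unfolding exactly_div_def by (simp add: dvd_mod_iff)

lemma sum_exactly_div:
  assumes "p > 1"
  shows "(\<Sum>b<p\<^sup>2. if exactly_div p b then 1/2 else 1 :: real) = real p ^ 2 * (1 - (1 / real p) * (1 - 1 / real p) / 2)"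
proof -
  have set: "{b. b < p\<^sup>2 \<and> exactly_div p b} = (\<lambda>j. p * j) ` {1..<p}"
  proof (intro equalityI subsetI)
    fix b assume "b \<in> {b. b < p\<^sup>2 \<and> exactly_div p b}"
    then obtain j where j: "b = p * j" "b < p\<^sup>2" "\<not> p\<^sup>2 dvd b" by (auto simp: exactly_div_def)
    have "j < p" using j assms by (simp add: power2_eq_square)
    moreover have "j \<noteq> 0"
    proof
      assume "j = 0"
      thus False using j by simp
    qed
    hence "j \<ge> 1" by simp
    ultimately show "b \<in> (\<lambda>j. p * j) ` {1..<p}" using j by auto
  next
    fix b assume "b \<in> (\<lambda>j. p * j) ` {1..<p}"
    then obtain j where j: "b = p * j" "1 \<le> j" "j < p" by auto
    have "\<not> p dvd j" using j by (auto dest: dvd_imp_le)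
    thus "b \<in> {b. b < p\<^sup>2 \<and> exactly_div p b}" using j assms by (auto simp: exactly_div_def power2_eq_square)
  qed
  have "card {b. b < p\<^sup>2 \<and> exactly_div p b} = p - 1"
    unfolding set by (subst card_image) (use assms in \<open>auto simp: inj_on_def\<close>)
  hence card: "real (card {b. b < p\<^sup>2 \<and> exactly_div p b}) = real p - 1" using assms by simp
  have "(\<Sum>b<p\<^sup>2. if exactly_div p b then 1/2 else 1 :: real) = (\<Sum>b<p\<^sup>2. 1 - (if exactly_div p b then 1/2 else 0))" by (intro sum.cong) auto
  also have "\<dots> = real p ^ 2 - (\<Sum>b<p\<^sup>2. if exactly_div p b then 1/2 else 0)" by (simp add: sum_subtractf)
  also have "(\<Sum>b<p\<^sup>2. if exactly_div p b then 1/2 else 0 :: real) = (real p - 1) / 2"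
  proof -
    have "(\<Sum>b<p\<^sup>2. if exactly_div p b then 1/2 else 0 :: real) = (\<Sum>b<p\<^sup>2. (if exactly_div p b then 1 else 0) / 2)" by (intro sum.cong) auto
    also have "\<dots> = (\<Sum>b<p\<^sup>2. if exactly_div p b then 1 else 0) / 2" by (rule sum_divide_distrib[symmetric])
    also have "(\<Sum>b<p\<^sup>2. if exactly_div p b then 1 else 0) = real (card {b \<in> {..<p\<^sup>2}. exactly_div p b})" by (rule sum_if_card) simp
    also have "{b \<in> {..<p\<^sup>2}. exactly_div p b} = {b. b < p\<^sup>2 \<and> exactly_div p b}" by auto
    finally show ?thesis unfolding card .
  qed
  also have "real p ^ 2 - (real p - 1) / 2 = real p ^ 2 * (1 - (1 / real p) * (1 - 1 / real p) / 2)"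
    using assms by (simp add: field_simps power2_eq_square)
  finally show ?thesis .
qed

lemma exactly_div_primes_factor:
  fixes n :: nat
  assumes "n > 0" "distinct ps" "\<And>p. p \<in> set ps \<Longrightarrow> prime p \<and> exactly_div p n"
  shows "\<exists>n'. n = prod_list ps * n' \<and> (\<forall>p\<in>set ps. \<not> p dvd n')"
  using assms(2,3)
proof (induction ps)
  case (Cons p ps)
  then obtain n' where n': "n = prod_list ps * n'" "\<forall>p\<in>set ps. \<not> p dvd n'" by auto
  have p: "prime p" "p dvd n" "\<not> p\<^sup>2 dvd n" using Cons.prems(2)[of p] by (auto simp: exactly_div_def)
  have "\<not> p dvd prod_list ps"
  proof
    assume "p dvd prod_list ps"
    then obtain r where "r \<in> set ps" "p dvd r" using prime_dvd_prod_listD[OF p(1)] by blast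
    moreover from this have "p = r" using Cons.prems(2)[of r] p(1) primes_dvd_imp_eq by auto
    ultimately show False using Cons.prems(1) by simp
  qed
  hence "p dvd n'" using p(1,2) n'(1) prime_dvd_mult_iff by blast
  then obtain m where m: "n' = p * m" by auto
  have "\<not> p dvd m"
  proof
    assume "p dvd m"
    then obtain j where "m = p * j" by auto
    hence "n = p\<^sup>2 * (prod_list ps * j)" using n'(1) m by (simp add: power2_eq_square mult_ac)
    thus False using p(3) by simp
  qed
  moreover have "n = prod_list (p # ps) * m" using n'(1) m by simp
  moreover have "\<forall>r\<in>set ps. \<not> r dvd m" using n'(2) m by auto
  ultimately show ?case by (intro exI[of _ m]) auto
qed simp

lemma many_exactI:
  assumes F: "finite F" "F \<subseteq> Pset" and n: "n > 0" and card: "card {p \<in> F. exactly_div p n} \<ge> N"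
  shows "many_exact N n"
proof -
  define ps where "ps = sorted_list_of_set {p \<in> F. exactly_div p n}"
  have ps: "set ps = {p \<in> F. exactly_div p n}" "distinct ps" "length ps \<ge> N"
    unfolding ps_def using F card by auto
  have "prime p \<and> exactly_div p n" if "p \<in> set ps" for p using that ps F Pset_prime by auto
  then obtain n' where n': "n = prod_list ps * n'" "\<forall>p\<in>set ps. \<not> p dvd n'"
    using exactly_div_primes_factor[OF n ps(2)] by blast
  have "n' > 0" using n n' by (auto intro!: Nat.gr0I)
  thus ?thesis unfolding many_exact_def using ps n' F by blast
qed

text \<open>The mean of 2 to the power -\<omega>, with \<omega> the number of exact divisors in a finite set F, is a product over F that
  tends to 0 as the set grows.\<close>
lemma bad_density:
  fixes e :: real
  assumes e: "e > 0"
  shows "\<exists>X0. \<forall>X\<ge>X0. real (card {n. real n \<le> X \<and> \<not> many_exact N n}) \<le> e * X"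
proof -
  \<comment> \<open>As 1 - 1/p \<ge> 2/3, each local mean is at most exp(-1/(3p)), so a reciprocal
    sum above B gives a global mean of at most e / 2^(N+1).\<close>
  define B where "B = 3 * ln (2 ^ N * 2 / e)"
  obtain F where F: "finite F" "F \<subseteq> Pset" "(\<Sum>p\<in>F. 1 / real p) > B" using Pset_divergent by blast
  have Fp: "prime p" "p \<ge> 3" if "p \<in> F" for p using Pset_prime[OF subsetD[OF F(2) that]] by blast+
  define w where "w = (\<lambda>n. \<Prod>p\<in>F. if exactly_div p n then 1/2 else 1 :: real)"
  define L where "L = (\<Prod>p\<in>F. p\<^sup>2)"
  define c where "c = (\<Prod>p\<in>F. 1 - (1 / real p) * (1 - 1 / real p) / 2)"
  have L0: "L > 0" unfolding L_def using Fp(2) by (intro prod_pos) fastforce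
  have sumw: "(\<Sum>n<L. w n) = real L * c"
  proof -
    have cpr: "coprime (p\<^sup>2) (r\<^sup>2)" if "p \<in> F" "r \<in> F" "p \<noteq> r" for p r
      using primes_coprime[OF Fp(1)[OF that(1)] Fp(1)[OF that(2)] that(3)] by simp
    have pos: "p\<^sup>2 > 0" if "p \<in> F" for p using Fp(2)[OF that] by simp
    have "(\<Sum>n<1 * (\<Prod>p\<in>F. p\<^sup>2). 1 * (\<Prod>p\<in>F. if exactly_div p (n mod p\<^sup>2) then 1/2 else 1 :: real))
       = (\<Sum>a<1::nat. 1) * (\<Prod>p\<in>F. \<Sum>b<p\<^sup>2. if exactly_div p b then 1/2 else 1)"
    proof (rule sum_crt_prod[of F 1 "\<lambda>p. p\<^sup>2" "\<lambda>_. 1" "\<lambda>p b. if exactly_div p b then 1/2 else 1"])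
      show "finite F" "(0::nat) < 1" by (rule F(1)) simp
      show "coprime 1 (p\<^sup>2)" for p :: nat by simp
    qed (fact pos cpr)+
    hence "(\<Sum>n<L. w n) = (\<Prod>p\<in>F. \<Sum>b<p\<^sup>2. if exactly_div p b then 1/2 else 1)"
      unfolding w_def L_def exactly_div_mod by simp
    also have "\<dots> = (\<Prod>p\<in>F. real p ^ 2 * (1 - (1 / real p) * (1 - 1 / real p) / 2))"
    proof (rule prod.cong[OF refl])
      fix p assume "p \<in> F"
      hence "p > 1" using Fp(2)[of p] by simp
      thus "(\<Sum>b<p\<^sup>2. if exactly_div p b then 1/2 else 1) = real p ^ 2 * (1 - (1 / real p) * (1 - 1 / real p) / 2)" by (rule sum_exactly_div)
    qed
    also have "\<dots> = real L * c" unfolding L_def c_def by (simp add: prod.distrib)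
    finally show ?thesis .
  qed
  have half: "0 \<le> 1 - y / 2" if "y \<le> 1 * 1" for y :: real using that by simp
  have cle: "2 ^ N * c \<le> e / 2"
  proof -
    have "c \<le> (\<Prod>p\<in>F. exp (- (1 / real p) / 3))"
      unfolding c_def
    proof (intro prod_mono conjI)
      fix p assume "p \<in> F"
      hence p: "real p \<ge> 3" using Fp(2)[of p] by simp
      hence b: "1 / real p \<le> 1/3" "1 / real p \<ge> 0" by (auto simp: field_simps)
      have "(1 / real p) * (1 - 1 / real p) \<le> 1 * 1" using b by (intro mult_mono) auto
      thus "0 \<le> 1 - (1 / real p) * (1 - 1 / real p) / 2" by (rule half)
      have "(1 / real p) * (1 - 1 / real p) \<ge> (1 / real p) * (2 / 3)" using b by (intro mult_left_mono) auto
      moreover have "1 - y / 2 \<le> 1 + (- x / 3)" if "y \<ge> x * (2 / 3)" for x y :: real using that by simp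
      ultimately have "1 - (1 / real p) * (1 - 1 / real p) / 2 \<le> 1 + (- (1 / real p) / 3)" by blast
      also have "\<dots> \<le> exp (- (1 / real p) / 3)" by (rule exp_ge_add_one_self)
      finally show "1 - (1 / real p) * (1 - 1 / real p) / 2 \<le> exp (- (1 / real p) / 3)" .
    qed
    also have "\<dots> = exp (\<Sum>p\<in>F. - (1 / real p) / 3)" using F by (simp only: exp_sum)
    also have "(\<Sum>p\<in>F. - (1 / real p) / 3) = - (\<Sum>p\<in>F. 1 / real p) / 3" by (simp only: sum_divide_distrib[symmetric] sum_negf)
    also have "exp (- (\<Sum>p\<in>F. 1 / real p) / 3) \<le> exp (- ln (2 ^ N * 2 / e))" using F(3) unfolding B_def by simp
    also have "\<dots> = e / (2 ^ N * 2)" using e by (simp add: exp_minus)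
    finally have "2 ^ N * c \<le> 2 ^ N * (e / (2 ^ N * 2))" by (rule mult_left_mono) simp
    thus ?thesis by simp
  qed
  \<comment> \<open>A Markov-type bound: an integer with at most N exact divisors in F has weight at
    least 2^(-N), so \<open>2 ^ N * w\<close> dominates the indicator of the exceptional set. The
    exceptional n = 0 has no exact divisor and weight 1.\<close>
  have wbad: "1 \<le> 2 ^ N * w n" if "\<not> many_exact N n" for n
  proof -
    have wn: "w n = (1/2) ^ card {p \<in> F. exactly_div p n}"
      unfolding w_def using F by (simp add: prod.If_cases Int_def)
    have "card {p \<in> F. exactly_div p n} \<le> N"
    proof (cases "n = 0")
      case True
      thus ?thesis by (simp add: exactly_div_def)
    next
      case False
      thus ?thesis using many_exactI[OF F(1,2), of n N] that by fastforce
    qed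
    hence "(1/2::real) ^ N \<le> w n" unfolding wn by (intro power_decreasing) auto
    hence "2 ^ N * (1/2::real) ^ N \<le> 2 ^ N * w n" by (intro mult_left_mono) auto
    thus ?thesis by (simp add: power_mult_distrib[symmetric])
  qed
  have w0: "w n \<ge> 0" for n unfolding w_def by (intro prod_nonneg) auto
  have per: "w (n + L) = w n" for n
    unfolding w_def
  proof (rule prod.cong[OF refl])
    fix p assume "p \<in> F"
    hence "p\<^sup>2 dvd L" unfolding L_def using F by (intro dvd_prodI)
    hence "(n + L) mod p\<^sup>2 = n mod p\<^sup>2" by auto
    hence "exactly_div p (n + L) = exactly_div p n" using exactly_div_mod[of p "n + L"] exactly_div_mod[of p n] by simp
    thus "(if exactly_div p (n + L) then 1/2 else 1 :: real) = (if exactly_div p n then 1/2 else 1)" by simp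
  qed
  have "real (card {n. real n \<le> X \<and> \<not> many_exact N n}) \<le> e * X" if X: "X \<ge> real L" for X
  proof -
    \<comment> \<open>T periods of length L cover the integers up to X. Rounding up costs at most
      one period, so L T \<le> X + L \<le> 2X, which explains the bound e/2 on
      \<open>2 ^ N * c\<close>.\<close>
    define T where "T = nat \<lfloor>X\<rfloor> div L + 1"
    have X0: "X > 0" using X L0 by simp
    have sub: "{n. real n \<le> X \<and> \<not> many_exact N n} \<subseteq> {n \<in> {..<L * T}. \<not> many_exact N n}"
    proof
      fix n assume "n \<in> {n. real n \<le> X \<and> \<not> many_exact N n}"
      hence n: "real n \<le> X" "\<not> many_exact N n" by auto
      have "n \<le> nat \<lfloor>X\<rfloor>" using n(1) by (simp add: le_nat_iff le_floor_iff)
      also have "nat \<lfloor>X\<rfloor> < L * T" unfolding T_def using L0 by (simp add: dividend_less_times_div)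
      finally show "n \<in> {n \<in> {..<L * T}. \<not> many_exact N n}" using n by simp
    qed
    have "card {n. real n \<le> X \<and> \<not> many_exact N n} \<le> card {n \<in> {..<L * T}. \<not> many_exact N n}" by (rule card_mono[OF _ sub]) simp
    hence "real (card {n. real n \<le> X \<and> \<not> many_exact N n}) \<le> real (card {n \<in> {..<L * T}. \<not> many_exact N n})" by simp
    also have "\<dots> = (\<Sum>n\<in>{n \<in> {..<L * T}. \<not> many_exact N n}. 1)" by simp
    also have "\<dots> \<le> (\<Sum>n\<in>{n \<in> {..<L * T}. \<not> many_exact N n}. 2 ^ N * w n)" by (intro sum_mono wbad) auto
    also have "\<dots> \<le> (\<Sum>n<L * T. 2 ^ N * w n)" using w0 by (intro sum_mono2) auto
    also have "\<dots> = 2 ^ N * (\<Sum>n<L * T. w n)" by (rule sum_distrib_left[symmetric])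
    also have "(\<Sum>n<L * T. w n) = real T * (\<Sum>n<L. w n)" by (rule sum_blocks[of w L T, OF per])
    also have "(\<Sum>n<L. w n) = real L * c" by (rule sumw)
    also have "2 ^ N * (real T * (real L * c)) = (2 ^ N * c) * (real L * real T)" by (simp only: mult_ac)
    also have "\<dots> \<le> (e / 2) * (X + X)"
    proof (rule mult_mono)
      have "L * (nat \<lfloor>X\<rfloor> div L) \<le> nat \<lfloor>X\<rfloor>" by simp
      hence "L * T \<le> nat \<lfloor>X\<rfloor> + L" unfolding T_def by simp
      hence "real (L * T) \<le> real (nat \<lfloor>X\<rfloor> + L)" by (simp only: of_nat_le_iff)
      also have "\<dots> = real (nat \<lfloor>X\<rfloor>) + real L" by (rule of_nat_add)
      also have "\<dots> \<le> X + X" using X X0 by (intro add_mono) (auto intro: of_nat_floor)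
      finally show "real L * real T \<le> X + X" by (simp only: of_nat_mult)
    qed (use cle e in auto)
    finally show ?thesis by simp
  qed
  thus ?thesis by blast
qed

theorem theorem1p10:
  fixes k \<alpha> m :: nat
  assumes "k \<ge> 1" and "\<alpha> \<ge> 1" and "m \<ge> 1" and "gcd m 2 = 1"
  shows "((\<lambda>X::real. real (card {n::nat. real n \<le> X \<and>
             (2::int) ^ k dvd overcubic (2 ^ \<alpha> * m) n}) / X) \<longlongrightarrow> 1) at_top"
proof -
  define c where "c = 2 ^ \<alpha> * m"
  have ev: "even c" and c0: "c > 0" unfolding c_def using assms by auto
  hence c2: "c \<ge> 2" by (auto elim!: evenE)
  have "two_adic (Abs_fps (overcubic c))" by (rule two_adic_generating[OF ev c0 gen_theta[OF c2]])
  then obtain N where N: "\<And>n. many_exact N n \<Longrightarrow> (2::int) ^ k dvd overcubic c n"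
    using two_adic_coeff_dvd[of _ k] by force
  define S where "S = (\<lambda>X::real. {n::nat. real n \<le> X \<and> (2::int) ^ k dvd overcubic c n})"
  have card_le: "{n::nat. real n \<le> X} = {..nat \<lfloor>X\<rfloor>}" if "X \<ge> 0" for X :: real
    using that by (auto simp: le_nat_iff le_floor_iff)
  have "((\<lambda>X. real (card (S X)) / X) \<longlongrightarrow> 1) at_top"
  proof (rule tendstoI)
    fix e :: real assume e: "e > 0"
    obtain X0 where X0: "\<And>X. X \<ge> X0 \<Longrightarrow> real (card {n. real n \<le> X \<and> \<not> many_exact N n}) \<le> (e / 2) * X"
      using bad_density[of "e / 2" N] e by auto
    \<comment> \<open>The count includes n = 0 and may reach X + 1; the excess 1/X is below e once X
      > 1/e.\<close>
    show "eventually (\<lambda>X. dist (real (card (S X)) / X) 1 < e) at_top"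
      using eventually_ge_at_top[of X0] eventually_gt_at_top[of "1 / e"] eventually_gt_at_top[of 0]
    proof eventually_elim
      case (elim X)
      define B where "B = {n. real n \<le> X \<and> \<not> many_exact N n}"
      have all: "{n::nat. real n \<le> X} = {..nat \<lfloor>X\<rfloor>}" using elim by (intro card_le) simp
      have fin: "finite {n::nat. real n \<le> X}" unfolding all by simp
      have cardall: "card {n::nat. real n \<le> X} = nat \<lfloor>X\<rfloor> + 1" unfolding all by simp
      have "card (S X) \<le> card {n::nat. real n \<le> X}" unfolding S_def by (rule card_mono[OF fin]) auto
      hence "real (card (S X)) \<le> real (nat \<lfloor>X\<rfloor>) + 1" unfolding cardall by linarith
      hence upper: "real (card (S X)) \<le> X + 1" using of_nat_floor[of X] elim by linarith
      have "card {n::nat. real n \<le> X} \<le> card (S X \<union> B)"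
        by (rule card_mono) (use N in \<open>auto simp: S_def B_def intro: finite_subset[OF _ fin]\<close>)
      also have "\<dots> \<le> card (S X) + card B" by (rule card_Un_le)
      finally have "real (nat \<lfloor>X\<rfloor>) + 1 \<le> real (card (S X)) + real (card B)" unfolding cardall by linarith
      moreover have "real (card B) \<le> (e / 2) * X" unfolding B_def by (rule X0[OF elim(1)])
      moreover have "X \<le> real (nat \<lfloor>X\<rfloor>) + 1" using elim by linarith
      ultimately have lower: "X - (e / 2) * X \<le> real (card (S X))" by linarith
      have "real (card (S X)) / X \<le> (X + 1) / X" by (rule divide_right_mono[OF upper]) (use elim in simp)
      also have "\<dots> = 1 + 1 / X" using elim by (simp add: field_simps)
      also have "\<dots> < 1 + e" using elim e by (simp add: field_simps)
      finally have u: "real (card (S X)) / X < 1 + e" .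
      have "1 - e / 2 = (X - (e / 2) * X) / X" using elim by (simp add: field_simps)
      also have "\<dots> \<le> real (card (S X)) / X" by (rule divide_right_mono[OF lower]) (use elim in simp)
      finally show ?case using u e by (simp add: dist_real_def)
    qed
  qed
  thus ?thesis unfolding S_def c_def .
qed

end
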